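(* Let $(P,A)$ be a $\Sigma$-free substitude, let $\mathbf{p}=\mathcal{P}^{\mathcal{P}_{f,g}}$ be the classifier for free algebra extensions, and let $\mathcal{M}$ be a cocomplete category. For any functor $\mathbf{X}:\mathbf{p}\to\mathcal{M}$, the colimit of $\mathbf{X}$ is a sequential colimit of pushouts in $\mathcal{M}$. More precisely, for $S_k=\mathrm{colim}_{\mathbf{p}^{(k)}}\mathbf{X}|_{\mathbf{p}^{(k)}}$ one has $$S=\mathrm{colim}_{\mathbf{p}}\mathbf{X}\cong\mathrm{colim}_kS_k,$$ where for $k\ge 1$ the canonical morphism $S_{k-1}\to S_k$ is part of a pushout square in $\mathcal{M}$ $$\begin{array}{ccc}Q_k&\xrightarrow{\;w_k\;}&L_k\\ {\scriptstyle\alpha_k}\downarrow&&\downarrow\\ S_{k-1}&\longrightarrow&S_k\end{array}$$ in which $Q_k$ (resp. $L_k$) is the colimit of the restriction of $\mathbf{X}$ to $\mathbf{q}^{(k)}$ (resp. $\mathbf{l}^{(k)}$).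
   Context: A substitude $(P,A)$ is a $\mathrm{Set}$-valued coloured symmetric operad $P$ whose colours are the objects of a small category $A$, together with an identity-on-objects functor $\eta$ from $A$ to the category of unary operations of $P$. It is $\Sigma$-free if, with $\mathsf{M}A$ and $SA$ the free strict monoidal and free strict symmetric monoidal categories on $A$ and $\epsilon:\mathsf{M}A\to SA$ the canonical functor, $P$, viewed as a functor $(SA)^{op}\times A\to\mathrm{Set}$, is the left Kan extension along $\epsilon\times1$ of some functor $(\mathsf{M}A)^{op}\times A\to\mathrm{Set}$. A categorical $P$-algebra is a $P$-algebra $C$ in $\mathrm{Cat}$. An internal $\mathcal{P}_{f,g}$-algebra in $C$ consists of objects $X(a),K(a),L(a)\in C(a)$ for $a\in A$; morphisms $p(X(a_1),\dots,X(a_n))\to X(a)$ for all $p\in P(a_1,\dots,a_n;a)$ satisfying associativity, unit and equivariance conditions; morphisms $\eta(u)(K(a))\to K(b)$ and $\eta(u)(L(a))\to L(b)$ for $u:a\to b$ in $A$, functorial in $u$; and morphisms $f_a:K(a)\to L(a)$, $g_a:K(a)\to X(a)$ compatible with the actions of $A$. The classifier $\mathcal{P}^{\mathcal{P}_{f,g}}$ is the categorical $P$-algebra representing the 2-functor sending $C$ to the category of internal $\mathcal{P}_{f,g}$-algebras in $C$; it is regarded as a category, the coproduct over $a\in A$ of its components. Explicitly, let $\mathcal{P}(1)$ be the set of operations of $P$ up to reordering of inputs (the value at the terminal object of the polynomial monad for $P$-algebras). Objects of $\mathbf{p}$ are elements of $\mathcal{P}(1)$, viewed as corollas, whose inputs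 (edges) are each coloured by $X$, $K$ or $L$. Morphisms are generated by: $X$-generators (from the $P$-algebra structure on $X$-edges, including nullary operations, and the unary action of morphisms of $A$ on $K$- and $L$-edges), $F$-generators (replace a $K$-edge by an $L$-edge, via $f$) and $G$-generators (replace a $K$-edge by an $X$-edge, via $g$), subject to the relations of an internal $\mathcal{P}_{f,g}$-algebra. An object of $\mathbf{p}$ is of type $(p,q)$ if it has exactly $p$ $K$-edges and $q$ $L$-edges; its degree is $p+q$. $\mathbf{p}^{(k)}$ is the full subcategory of $\mathbf{p}$ on the objects of degree $\le k$; $\mathbf{w}^{(k)}$ the full subcategory on the objects of degree exactly $k$; $\mathbf{q}^{(k)}$ the full subcategory of $\mathbf{w}^{(k)}$ on the objects of type $(p,k-p)$ with $p\neq0$; $\mathbf{l}^{(k)}$ the full subcategory of $\mathbf{w}^{(k)}$ on the objects of type $(0,k)$. *)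

theory Defs
  imports Main "HOL-Library.FuncSet" "HOL-Combinatorics.Permutations"
begin

section \<open>Categories\<close>

text \<open>Categories are given by carrier sets, so that a category whose objects and arrows are taken
  from a type \<open>'s\<close> is a small category relative to the universe \<open>'s\<close>.\<close>

record ('o, 'm) cat =
  Obj :: "'o set"
  Arr :: "'m set"
  Dom :: "'m \<Rightarrow> 'o"
  Cod :: "'m \<Rightarrow> 'o"
  Idn :: "'o \<Rightarrow> 'm"
  Cmp :: "'m \<Rightarrow> 'm \<Rightarrow> 'm"  \<comment> \<open>\<open>Cmp C g f\<close> is \<open>g\<close> after \<open>f\<close>\<close>

definition Hom :: "('o, 'm) cat \<Rightarrow> 'o \<Rightarrow> 'o \<Rightarrow> 'm set" where
  "Hom C x y = {f \<in> Arr C. Dom C f = x \<and> Cod C f = y}"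

locale category =
  fixes C :: "('o, 'm) cat"
  assumes Dom_Obj: "f \<in> Arr C \<Longrightarrow> Dom C f \<in> Obj C"
    and Cod_Obj: "f \<in> Arr C \<Longrightarrow> Cod C f \<in> Obj C"
    and Idn_Hom: "x \<in> Obj C \<Longrightarrow> Idn C x \<in> Hom C x x"
    and Cmp_Hom: "f \<in> Hom C x y \<Longrightarrow> g \<in> Hom C y z \<Longrightarrow> Cmp C g f \<in> Hom C x z"
    and Cmp_Idn_right: "f \<in> Hom C x y \<Longrightarrow> Cmp C f (Idn C x) = f"
    and Cmp_Idn_left: "f \<in> Hom C x y \<Longrightarrow> Cmp C (Idn C y) f = f"
    and Cmp_assoc: "f \<in> Hom C w x \<Longrightarrow> g \<in> Hom C x y \<Longrightarrow> h \<in> Hom C y z \<Longrightarrow>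
      Cmp C h (Cmp C g f) = Cmp C (Cmp C h g) f"

record ('o, 'm, 'o1, 'm1) func =
  FOb :: "'o \<Rightarrow> 'o1"
  FAr :: "'m \<Rightarrow> 'm1"

definition is_functor ::
    "('o, 'm) cat \<Rightarrow> ('o1, 'm1) cat \<Rightarrow> ('o, 'm, 'o1, 'm1) func \<Rightarrow> bool" where
  "is_functor C D F \<longleftrightarrow>
     (\<forall>x\<in>Obj C. FOb F x \<in> Obj D) \<and>
     (\<forall>f\<in>Arr C. FAr F f \<in> Hom D (FOb F (Dom C f)) (FOb F (Cod C f))) \<and>
     (\<forall>x\<in>Obj C. FAr F (Idn C x) = Idn D (FOb F x)) \<and>
     (\<forall>f\<in>Arr C. \<forall>g\<in>Arr C. Cod C f = Dom C g \<longrightarrow>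
        FAr F (Cmp C g f) = Cmp D (FAr F g) (FAr F f))"

definition comp_func ::
    "('o1, 'm1, 'o2, 'm2) func \<Rightarrow> ('o, 'm, 'o1, 'm1) func \<Rightarrow> ('o, 'm, 'o2, 'm2) func" where
  "comp_func G F = \<lparr>FOb = FOb G \<circ> FOb F, FAr = FAr G \<circ> FAr F\<rparr>"

definition is_nat_trans :: "('o, 'm) cat \<Rightarrow> ('o1, 'm1) cat \<Rightarrow>
    ('o, 'm, 'o1, 'm1) func \<Rightarrow> ('o, 'm, 'o1, 'm1) func \<Rightarrow> ('o \<Rightarrow> 'm1) \<Rightarrow> bool" where
  "is_nat_trans C D F G \<tau> \<longleftrightarrow>
     (\<forall>x\<in>Obj C. \<tau> x \<in> Hom D (FOb F x) (FOb G x)) \<and>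
     (\<forall>f\<in>Arr C. Cmp D (\<tau> (Cod C f)) (FAr F f) = Cmp D (FAr G f) (\<tau> (Dom C f)))"

definition op_cat :: "('o, 'm) cat \<Rightarrow> ('o, 'm) cat" where
  "op_cat C = \<lparr>Obj = Obj C, Arr = Arr C, Dom = Cod C, Cod = Dom C, Idn = Idn C,
     Cmp = (\<lambda>g f. Cmp C f g)\<rparr>"

definition prod_cat ::
    "('o, 'm) cat \<Rightarrow> ('o1, 'm1) cat \<Rightarrow> ('o \<times> 'o1, 'm \<times> 'm1) cat" where
  "prod_cat C D = \<lparr>Obj = Obj C \<times> Obj D, Arr = Arr C \<times> Arr D,
     Dom = map_prod (Dom C) (Dom D), Cod = map_prod (Cod C) (Cod D),
     Idn = map_prod (Idn C) (Idn D),
     Cmp = (\<lambda>g f. (Cmp C (fst g) (fst f), Cmp D (snd g) (snd f)))\<rparr>"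

definition prod_func :: "('o, 'm, 'o1, 'm1) func \<Rightarrow> ('p, 'n, 'p1, 'n1) func \<Rightarrow>
    ('o \<times> 'p, 'm \<times> 'n, 'o1 \<times> 'p1, 'm1 \<times> 'n1) func" where
  "prod_func F G = \<lparr>FOb = map_prod (FOb F) (FOb G), FAr = map_prod (FAr F) (FAr G)\<rparr>"

definition id_func :: "('o, 'm, 'o, 'm) func" where
  "id_func = \<lparr>FOb = (\<lambda>x. x), FAr = (\<lambda>f. f)\<rparr>"

definition list_cat :: "('o, 'm) cat list \<Rightarrow> ('o list, 'm list) cat" where
  "list_cat Cs = \<lparr>Obj = {xs. list_all2 (\<lambda>x C. x \<in> Obj C) xs Cs},
     Arr = {fs. list_all2 (\<lambda>f C. f \<in> Arr C) fs Cs},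
     Dom = map2 Dom Cs, Cod = map2 Cod Cs, Idn = map2 Idn Cs,
     Cmp = (\<lambda>gs fs. map2 (\<lambda>C (g, f). Cmp C g f) Cs (zip gs fs))\<rparr>"
  \<comment> \<open>the finite product of a list of categories\<close>

definition full_sub :: "('o, 'm) cat \<Rightarrow> 'o set \<Rightarrow> ('o, 'm) cat" where
  "full_sub C S = C\<lparr>Obj := Obj C \<inter> S, Arr := {f \<in> Arr C. Dom C f \<in> S \<and> Cod C f \<in> S}\<rparr>"

definition set_cat :: "('s set, 's set \<times> ('s \<Rightarrow> 's) \<times> 's set) cat" where
  "set_cat = \<lparr>Obj = UNIV, Arr = {(S, h, T). h \<in> S \<rightarrow>\<^sub>E T},
     Dom = (\<lambda>(S, h, T). S), Cod = (\<lambda>(S, h, T). T),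
     Idn = (\<lambda>S. (S, \<lambda>x\<in>S. x, S)),
     Cmp = (\<lambda>(S', g, T') (S, h, T). (S, compose S g h, T'))\<rparr>"

definition is_left_Kan :: "('o, 'm) cat \<Rightarrow> ('o1, 'm1) cat \<Rightarrow> ('o2, 'm2) cat \<Rightarrow>
    ('o, 'm, 'o1, 'm1) func \<Rightarrow> ('o, 'm, 'o2, 'm2) func \<Rightarrow>
    ('o1, 'm1, 'o2, 'm2) func \<Rightarrow> ('o \<Rightarrow> 'm2) \<Rightarrow> bool" where
  "is_left_Kan C D E K F L \<alpha> \<longleftrightarrow>
     is_functor C D K \<and> is_functor C E F \<and> is_functor D E L \<and>
     is_nat_trans C E F (comp_func L K) \<alpha> \<and>
     (\<forall>G \<beta>. is_functor D E G \<and> is_nat_trans C E F (comp_func G K) \<beta> \<longrightarrow>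
        (\<exists>\<gamma>. is_nat_trans D E L G \<gamma> \<and> (\<forall>x\<in>Obj C. Cmp E (\<gamma> (FOb K x)) (\<alpha> x) = \<beta> x) \<and>
          (\<forall>\<gamma>'. is_nat_trans D E L G \<gamma>' \<and> (\<forall>x\<in>Obj C. Cmp E (\<gamma>' (FOb K x)) (\<alpha> x) = \<beta> x) \<longrightarrow>
             (\<forall>y\<in>Obj D. \<gamma>' y = \<gamma> y))))"
  \<comment> \<open>\<open>L\<close> with unit \<open>\<alpha>\<close> is the left Kan extension of \<open>F\<close> along \<open>K\<close>\<close>


section \<open>Colimits and pushouts\<close>

definition is_cocone :: "('o, 'm) cat \<Rightarrow> ('i, 'j) cat \<Rightarrow> ('i, 'j, 'o, 'm) func \<Rightarrow>
    'o \<Rightarrow> ('i \<Rightarrow> 'm) \<Rightarrow> bool" where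
  "is_cocone M J F c \<phi> \<longleftrightarrow> c \<in> Obj M \<and> (\<forall>x\<in>Obj J. \<phi> x \<in> Hom M (FOb F x) c) \<and>
     (\<forall>f\<in>Arr J. Cmp M (\<phi> (Cod J f)) (FAr F f) = \<phi> (Dom J f))"

definition is_colimit :: "('o, 'm) cat \<Rightarrow> ('i, 'j) cat \<Rightarrow> ('i, 'j, 'o, 'm) func \<Rightarrow>
    'o \<Rightarrow> ('i \<Rightarrow> 'm) \<Rightarrow> bool" where
  "is_colimit M J F c \<phi> \<longleftrightarrow> is_functor J M F \<and> is_cocone M J F c \<phi> \<and>
     (\<forall>d \<psi>. is_cocone M J F d \<psi> \<longrightarrow>
        (\<exists>!h. h \<in> Hom M c d \<and> (\<forall>x\<in>Obj J. Cmp M h (\<phi> x) = \<psi> x)))"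

definition cocomplete :: "'s itself \<Rightarrow> ('o, 'm) cat \<Rightarrow> bool" where
  "cocomplete _ M \<longleftrightarrow> category M \<and>
     (\<forall>(J :: ('s, 's) cat) F. category J \<and> is_functor J M F \<longrightarrow> (\<exists>c \<phi>. is_colimit M J F c \<phi>))"
  \<comment> \<open>all colimits indexed by categories that are small relative to the universe \<open>'s\<close>\<close>

definition colimit :: "('o, 'm) cat \<Rightarrow> ('i, 'j) cat \<Rightarrow> ('i, 'j, 'o, 'm) func \<Rightarrow>
    'o \<times> ('i \<Rightarrow> 'm)" where
  "colimit M J F = (SOME (c, \<phi>). is_colimit M J F c \<phi>)"

definition colim_obj :: "('o, 'm) cat \<Rightarrow> ('i, 'j) cat \<Rightarrow> ('i, 'j, 'o, 'm) func \<Rightarrow> 'o" where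
  "colim_obj M J F = fst (colimit M J F)"

definition colim_inj :: "('o, 'm) cat \<Rightarrow> ('i, 'j) cat \<Rightarrow> ('i, 'j, 'o, 'm) func \<Rightarrow> 'i \<Rightarrow> 'm" where
  "colim_inj M J F = snd (colimit M J F)"

definition colim_map :: "('o, 'm) cat \<Rightarrow> ('i, 'j) cat \<Rightarrow> ('i, 'j) cat \<Rightarrow>
    ('i, 'j, 'o, 'm) func \<Rightarrow> 'm" where
  "colim_map M J' J F = (THE h. h \<in> Hom M (colim_obj M J' F) (colim_obj M J F) \<and>
     (\<forall>x\<in>Obj J'. Cmp M h (colim_inj M J' F x) = colim_inj M J F x))"
  \<comment> \<open>the canonical map between the colimits of \<open>F\<close> over a subcategory \<open>J'\<close> and over \<open>J\<close>\<close>

definition is_pushout :: "('o, 'm) cat \<Rightarrow> 'm \<Rightarrow> 'm \<Rightarrow> 'm \<Rightarrow> 'm \<Rightarrow> bool" where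
  "is_pushout M f g h k \<longleftrightarrow>
     {f, g, h, k} \<subseteq> Arr M \<and> Dom M f = Dom M g \<and> Cod M f = Dom M h \<and> Cod M g = Dom M k \<and>
     Cod M h = Cod M k \<and> Cmp M h f = Cmp M k g \<and>
     (\<forall>u\<in>Arr M. \<forall>v\<in>Arr M. Dom M u = Cod M f \<and> Dom M v = Cod M g \<and> Cod M u = Cod M v \<and>
        Cmp M u f = Cmp M v g \<longrightarrow>
        (\<exists>!m. m \<in> Hom M (Cod M h) (Cod M u) \<and> Cmp M m h = u \<and> Cmp M m k = v))"
  \<comment> \<open>\<open>f\<close> and \<open>g\<close> form the span, \<open>h\<close> (opposite \<open>g\<close>) and \<open>k\<close> (opposite \<open>f\<close>) the cospan\<close>

definition omega_cat :: "(nat, nat \<times> nat) cat" where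
  "omega_cat = \<lparr>Obj = UNIV, Arr = {(i, j). i \<le> j}, Dom = fst, Cod = snd, Idn = (\<lambda>i. (i, i)),
     Cmp = (\<lambda>g f. (fst f, snd g))\<rparr>"


section \<open>Substitudes\<close>

text \<open>The operations of all arities are collected in one set \<open>Ops\<close>;
  \<open>P(a\<^sub>1,\<dots>,a\<^sub>n;a)\<close> is \<open>operations P [a\<^sub>1,\<dots>,a\<^sub>n] a\<close>. For a permutation \<open>\<sigma>\<close> of \<open>{0..<n}\<close>,
  \<open>Sym P p \<sigma>\<close> is the right action, whose \<open>i\<close>-th input is the \<open>\<sigma> i\<close>-th input of \<open>p\<close>.\<close>

record 's substitude_data =
  Col :: "('s, 's) cat"
  Ops :: "'s set"
  Src :: "'s \<Rightarrow> 's list"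
  Tgt :: "'s \<Rightarrow> 's"
  Unt :: "'s \<Rightarrow> 's"
  Sub :: "'s \<Rightarrow> 's list \<Rightarrow> 's"
  Sym :: "'s \<Rightarrow> (nat \<Rightarrow> nat) \<Rightarrow> 's"
  Eta :: "'s \<Rightarrow> 's"

definition operations :: "'s substitude_data \<Rightarrow> 's list \<Rightarrow> 's \<Rightarrow> 's set" where
  "operations P as a = {p \<in> Ops P. Src P p = as \<and> Tgt P p = a}"

text \<open>\<open>blocks ns\<close> cuts \<open>[0..<sum_list ns]\<close> into consecutive blocks of lengths \<open>ns\<close>. The two
  permutations below are characterised, for \<open>ns = map length xss\<close>, by
  \<open>permute_list (block_perm \<sigma> ns) (concat xss) = concat (permute_list \<sigma> xss)\<close> and
  \<open>permute_list (block_sum \<sigma>s ns) (concat xss) = concat (map2 permute_list \<sigma>s xss)\<close>.\<close>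

definition blocks :: "nat list \<Rightarrow> nat list list" where
  "blocks ns = map (\<lambda>i. [sum_list (take i ns)..<sum_list (take (Suc i) ns)]) [0..<length ns]"

definition perm_of_list :: "nat list \<Rightarrow> nat \<Rightarrow> nat" where
  "perm_of_list xs i = (if i < length xs then xs ! i else i)"

definition block_perm :: "(nat \<Rightarrow> nat) \<Rightarrow> nat list \<Rightarrow> nat \<Rightarrow> nat" where
  "block_perm \<sigma> ns = perm_of_list (concat (permute_list \<sigma> (blocks ns)))"

definition block_sum :: "(nat \<Rightarrow> nat) list \<Rightarrow> nat list \<Rightarrow> nat \<Rightarrow> nat" where
  "block_sum \<sigma>s ns = perm_of_list (concat (map2 permute_list \<sigma>s (blocks ns)))"

definition substitutable :: "'s substitude_data \<Rightarrow> 's \<Rightarrow> 's list \<Rightarrow> bool" where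
  "substitutable P p qs \<longleftrightarrow> p \<in> Ops P \<and> set qs \<subseteq> Ops P \<and> map (Tgt P) qs = Src P p"

definition arity_perm :: "'s substitude_data \<Rightarrow> 's \<Rightarrow> (nat \<Rightarrow> nat) \<Rightarrow> bool" where
  "arity_perm P p \<sigma> \<longleftrightarrow> \<sigma> permutes {..<length (Src P p)}"

locale substitude =
  fixes P :: "'s substitude_data"
  assumes Col_category: "category (Col P)"
    and Src_Obj: "p \<in> Ops P \<Longrightarrow> set (Src P p) \<subseteq> Obj (Col P)"
    and Tgt_Obj: "p \<in> Ops P \<Longrightarrow> Tgt P p \<in> Obj (Col P)"
    and Unt_Ops: "a \<in> Obj (Col P) \<Longrightarrow> Unt P a \<in> operations P [a] a"
    and Sub_Ops: "substitutable P p qs \<Longrightarrow>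
      Sub P p qs \<in> operations P (concat (map (Src P) qs)) (Tgt P p)"
    and Sub_Unt_right: "p \<in> Ops P \<Longrightarrow> Sub P p (map (Unt P) (Src P p)) = p"
    and Sub_Unt_left: "p \<in> Ops P \<Longrightarrow> Sub P (Unt P (Tgt P p)) [p] = p"
    and Sub_assoc: "substitutable P p qs \<Longrightarrow> list_all2 (substitutable P) qs rss \<Longrightarrow>
      Sub P (Sub P p qs) (concat rss) = Sub P p (map2 (Sub P) qs rss)"
    and Sym_Ops: "p \<in> Ops P \<Longrightarrow> arity_perm P p \<sigma> \<Longrightarrow>
      Sym P p \<sigma> \<in> operations P (permute_list \<sigma> (Src P p)) (Tgt P p)"
    and Sym_id: "p \<in> Ops P \<Longrightarrow> Sym P p id = p"
    and Sym_comp: "p \<in> Ops P \<Longrightarrow> arity_perm P p \<sigma> \<Longrightarrow> arity_perm P p \<tau> \<Longrightarrow>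
      Sym P p (\<sigma> \<circ> \<tau>) = Sym P (Sym P p \<sigma>) \<tau>"
    and Sub_Sym_outer: "substitutable P p qs \<Longrightarrow> arity_perm P p \<sigma> \<Longrightarrow>
      Sub P (Sym P p \<sigma>) (permute_list \<sigma> qs) =
      Sym P (Sub P p qs) (block_perm \<sigma> (map (length \<circ> Src P) qs))"
    and Sub_Sym_inner: "substitutable P p qs \<Longrightarrow> list_all2 (arity_perm P) qs \<sigma>s \<Longrightarrow>
      Sub P p (map2 (Sym P) qs \<sigma>s) =
      Sym P (Sub P p qs) (block_sum \<sigma>s (map (length \<circ> Src P) qs))"
    and Eta_Ops: "u \<in> Arr (Col P) \<Longrightarrow> Eta P u \<in> operations P [Dom (Col P) u] (Cod (Col P) u)"
    and Eta_Idn: "a \<in> Obj (Col P) \<Longrightarrow> Eta P (Idn (Col P) a) = Unt P a"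
    and Eta_Cmp: "u \<in> Hom (Col P) a b \<Longrightarrow> v \<in> Hom (Col P) b c \<Longrightarrow>
      Eta P (Cmp (Col P) v u) = Sub P (Eta P v) [Eta P u]"


subsection \<open>Sigma-freeness\<close>

definition free_mon :: "('o, 'm) cat \<Rightarrow> ('o list, 'm list) cat" where
  "free_mon A = \<lparr>Obj = lists (Obj A), Arr = lists (Arr A),
     Dom = map (Dom A), Cod = map (Cod A), Idn = map (Idn A), Cmp = map2 (Cmp A)\<rparr>"

text \<open>An arrow \<open>(\<sigma>, us) : [a\<^sub>0,\<dots>] \<rightarrow> [b\<^sub>0,\<dots>]\<close> of the free strict symmetric monoidal category has
  \<open>us ! i : a\<^sub>i \<rightarrow> b\<^bsub>\<sigma> i\<^esub>\<close>.\<close>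

definition free_sym_mon :: "('o, 'm) cat \<Rightarrow> ('o list, (nat \<Rightarrow> nat) \<times> 'm list) cat" where
  "free_sym_mon A = \<lparr>Obj = lists (Obj A),
     Arr = {(\<sigma>, us). us \<in> lists (Arr A) \<and> \<sigma> permutes {..<length us}},
     Dom = (\<lambda>(\<sigma>, us). map (Dom A) us),
     Cod = (\<lambda>(\<sigma>, us). permute_list (inv \<sigma>) (map (Cod A) us)),
     Idn = (\<lambda>as. (id, map (Idn A) as)),
     Cmp = (\<lambda>(\<tau>, vs) (\<sigma>, us). (\<tau> \<circ> \<sigma>, map2 (Cmp A) (permute_list \<sigma> vs) us))\<rparr>"

definition free_mon_incl :: "('o list, 'm list, 'o list, (nat \<Rightarrow> nat) \<times> 'm list) func" where
  "free_mon_incl = \<lparr>FOb = (\<lambda>as. as), FAr = (\<lambda>us. (id, us))\<rparr>"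

definition substitude_func :: "'s substitude_data \<Rightarrow>
    ('s list \<times> 's, ((nat \<Rightarrow> nat) \<times> 's list) \<times> 's,
     's set, 's set \<times> ('s \<Rightarrow> 's) \<times> 's set) func" where
  "substitude_func P = \<lparr>FOb = (\<lambda>(as, a). operations P as a),
     FAr = (\<lambda>(f, v).
       let S = operations P (Cod (free_sym_mon (Col P)) f) (Dom (Col P) v);
           T = operations P (Dom (free_sym_mon (Col P)) f) (Cod (Col P) v)
       in (S, \<lambda>q\<in>S. Sub P (Eta P v) [Sub P (Sym P q (fst f)) (map (Eta P) (snd f))], T))\<rparr>"

definition sigma_free :: "'s substitude_data \<Rightarrow> bool" where
  "sigma_free P \<longleftrightarrow> (\<exists>D \<alpha>.
     is_left_Kan (prod_cat (op_cat (free_mon (Col P))) (Col P))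
       (prod_cat (op_cat (free_sym_mon (Col P))) (Col P)) set_cat
       (prod_func free_mon_incl id_func) D (substitude_func P) \<alpha>)"


section \<open>Categorical algebras\<close>

record 's cat_alg =
  Cmpt :: "'s \<Rightarrow> ('s, 's) cat"
  Act :: "'s \<Rightarrow> ('s list, 's list, 's, 's) func"

definition inputs_cat :: "'s substitude_data \<Rightarrow> 's cat_alg \<Rightarrow> 's \<Rightarrow> ('s list, 's list) cat" where
  "inputs_cat P C p = list_cat (map (Cmpt C) (Src P p))"

locale categorical_algebra =
  fixes P :: "'s substitude_data" and C :: "'s cat_alg"
  assumes Cmpt_category: "a \<in> Obj (Col P) \<Longrightarrow> category (Cmpt C a)"
    and Act_functor: "p \<in> Ops P \<Longrightarrow> is_functor (inputs_cat P C p) (Cmpt C (Tgt P p)) (Act C p)"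
    and Act_Unt_Obj: "a \<in> Obj (Col P) \<Longrightarrow> x \<in> Obj (Cmpt C a) \<Longrightarrow> FOb (Act C (Unt P a)) [x] = x"
    and Act_Unt_Arr: "a \<in> Obj (Col P) \<Longrightarrow> f \<in> Arr (Cmpt C a) \<Longrightarrow> FAr (Act C (Unt P a)) [f] = f"
    and Act_Sub_Obj: "substitutable P p qs \<Longrightarrow>
      list_all2 (\<lambda>xs q. xs \<in> Obj (inputs_cat P C q)) xss qs \<Longrightarrow>
      FOb (Act C (Sub P p qs)) (concat xss) = FOb (Act C p) (map2 (\<lambda>q. FOb (Act C q)) qs xss)"
    and Act_Sub_Arr: "substitutable P p qs \<Longrightarrow>
      list_all2 (\<lambda>fs q. fs \<in> Arr (inputs_cat P C q)) fss qs \<Longrightarrow>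
      FAr (Act C (Sub P p qs)) (concat fss) = FAr (Act C p) (map2 (\<lambda>q. FAr (Act C q)) qs fss)"
    and Act_Sym_Obj: "p \<in> Ops P \<Longrightarrow> arity_perm P p \<sigma> \<Longrightarrow> xs \<in> Obj (inputs_cat P C p) \<Longrightarrow>
      FOb (Act C (Sym P p \<sigma>)) (permute_list \<sigma> xs) = FOb (Act C p) xs"
    and Act_Sym_Arr: "p \<in> Ops P \<Longrightarrow> arity_perm P p \<sigma> \<Longrightarrow> fs \<in> Arr (inputs_cat P C p) \<Longrightarrow>
      FAr (Act C (Sym P p \<sigma>)) (permute_list \<sigma> fs) = FAr (Act C p) fs"

definition is_alg_mor :: "'s substitude_data \<Rightarrow> 's cat_alg \<Rightarrow> 's cat_alg \<Rightarrow>
    ('s \<Rightarrow> ('s, 's, 's, 's) func) \<Rightarrow> bool" where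
  "is_alg_mor P C D H \<longleftrightarrow>
     (\<forall>a\<in>Obj (Col P). is_functor (Cmpt C a) (Cmpt D a) (H a)) \<and>
     (\<forall>p\<in>Ops P. \<forall>xs\<in>Obj (inputs_cat P C p).
        FOb (H (Tgt P p)) (FOb (Act C p) xs) = FOb (Act D p) (map2 (\<lambda>a. FOb (H a)) (Src P p) xs)) \<and>
     (\<forall>p\<in>Ops P. \<forall>fs\<in>Arr (inputs_cat P C p).
        FAr (H (Tgt P p)) (FAr (Act C p) fs) = FAr (Act D p) (map2 (\<lambda>a. FAr (H a)) (Src P p) fs))"

definition is_alg_trans :: "'s substitude_data \<Rightarrow> 's cat_alg \<Rightarrow> 's cat_alg \<Rightarrow>
    ('s \<Rightarrow> ('s, 's, 's, 's) func) \<Rightarrow> ('s \<Rightarrow> ('s, 's, 's, 's) func) \<Rightarrow> ('s \<Rightarrow> 's \<Rightarrow> 's) \<Rightarrow> bool" where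
  "is_alg_trans P C D H H' \<theta> \<longleftrightarrow>
     (\<forall>a\<in>Obj (Col P). is_nat_trans (Cmpt C a) (Cmpt D a) (H a) (H' a) (\<theta> a)) \<and>
     (\<forall>p\<in>Ops P. \<forall>xs\<in>Obj (inputs_cat P C p).
        \<theta> (Tgt P p) (FOb (Act C p) xs) = FAr (Act D p) (map2 \<theta> (Src P p) xs))"

definition total_cat :: "'s substitude_data \<Rightarrow> 's cat_alg \<Rightarrow> ('s \<times> 's, 's \<times> 's) cat" where
  "total_cat P C = \<lparr>Obj = (SIGMA a : Obj (Col P). Obj (Cmpt C a)),
     Arr = (SIGMA a : Obj (Col P). Arr (Cmpt C a)),
     Dom = (\<lambda>(a, f). (a, Dom (Cmpt C a) f)), Cod = (\<lambda>(a, f). (a, Cod (Cmpt C a) f)),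
     Idn = (\<lambda>(a, x). (a, Idn (Cmpt C a) x)),
     Cmp = (\<lambda>(b, g) (a, f). (a, Cmp (Cmpt C a) g f))\<rparr>"
  \<comment> \<open>the coproduct of the components over all colours\<close>


section \<open>Internal algebras and their classifier\<close>

record 's internal_alg =
  XOb :: "'s \<Rightarrow> 's"
  KOb :: "'s \<Rightarrow> 's"
  LOb :: "'s \<Rightarrow> 's"
  XAct :: "'s \<Rightarrow> 's"  \<comment> \<open>indexed by the operations of \<open>P\<close>\<close>
  KAct :: "'s \<Rightarrow> 's"  \<comment> \<open>indexed by the arrows of \<open>Col P\<close>, as is \<open>LAct\<close>\<close>
  LAct :: "'s \<Rightarrow> 's"
  FMap :: "'s \<Rightarrow> 's"
  GMap :: "'s \<Rightarrow> 's"

definition is_A_object ::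
    "'s substitude_data \<Rightarrow> 's cat_alg \<Rightarrow> ('s \<Rightarrow> 's) \<Rightarrow> ('s \<Rightarrow> 's) \<Rightarrow> bool" where
  "is_A_object P C Z act \<longleftrightarrow>
     (\<forall>a\<in>Obj (Col P). Z a \<in> Obj (Cmpt C a)) \<and>
     (\<forall>a b. \<forall>u\<in>Hom (Col P) a b. act u \<in> Hom (Cmpt C b) (FOb (Act C (Eta P u)) [Z a]) (Z b)) \<and>
     (\<forall>a\<in>Obj (Col P). act (Idn (Col P) a) = Idn (Cmpt C a) (Z a)) \<and>
     (\<forall>a b c. \<forall>u\<in>Hom (Col P) a b. \<forall>v\<in>Hom (Col P) b c.
        act (Cmp (Col P) v u) = Cmp (Cmpt C c) (act v) (FAr (Act C (Eta P v)) [act u]))"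

definition is_A_map :: "'s substitude_data \<Rightarrow> 's cat_alg \<Rightarrow> ('s \<Rightarrow> 's) \<Rightarrow> ('s \<Rightarrow> 's) \<Rightarrow>
    ('s \<Rightarrow> 's) \<Rightarrow> ('s \<Rightarrow> 's) \<Rightarrow> ('s \<Rightarrow> 's) \<Rightarrow> bool" where
  "is_A_map P C Z act Z' act' h \<longleftrightarrow>
     (\<forall>a\<in>Obj (Col P). h a \<in> Hom (Cmpt C a) (Z a) (Z' a)) \<and>
     (\<forall>a b. \<forall>u\<in>Hom (Col P) a b.
        Cmp (Cmpt C b) (h b) (act u) = Cmp (Cmpt C b) (act' u) (FAr (Act C (Eta P u)) [h a]))"

locale internal_algebra =
  fixes P :: "'s substitude_data" and C :: "'s cat_alg" and U :: "'s internal_alg"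
  assumes XOb_Obj: "a \<in> Obj (Col P) \<Longrightarrow> XOb U a \<in> Obj (Cmpt C a)"
    and XAct_Hom: "p \<in> Ops P \<Longrightarrow> XAct U p \<in>
      Hom (Cmpt C (Tgt P p)) (FOb (Act C p) (map (XOb U) (Src P p))) (XOb U (Tgt P p))"
    and XAct_Unt: "a \<in> Obj (Col P) \<Longrightarrow> XAct U (Unt P a) = Idn (Cmpt C a) (XOb U a)"
    and XAct_Sub: "substitutable P p qs \<Longrightarrow> XAct U (Sub P p qs) =
      Cmp (Cmpt C (Tgt P p)) (XAct U p) (FAr (Act C p) (map (XAct U) qs))"
    and XAct_Sym: "p \<in> Ops P \<Longrightarrow> arity_perm P p \<sigma> \<Longrightarrow> XAct U (Sym P p \<sigma>) = XAct U p"
    and K_object: "is_A_object P C (KOb U) (KAct U)"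
    and L_object: "is_A_object P C (LOb U) (LAct U)"
    and F_map: "is_A_map P C (KOb U) (KAct U) (LOb U) (LAct U) (FMap U)"
    and G_map: "is_A_map P C (KOb U) (KAct U) (XOb U) (\<lambda>u. XAct U (Eta P u)) (GMap U)"

record 's internal_mor =
  XMor :: "'s \<Rightarrow> 's"
  KMor :: "'s \<Rightarrow> 's"
  LMor :: "'s \<Rightarrow> 's"

definition is_internal_mor :: "'s substitude_data \<Rightarrow> 's cat_alg \<Rightarrow>
    's internal_alg \<Rightarrow> 's internal_alg \<Rightarrow> 's internal_mor \<Rightarrow> bool" where
  "is_internal_mor P C U V h \<longleftrightarrow>
     (\<forall>a\<in>Obj (Col P). XMor h a \<in> Hom (Cmpt C a) (XOb U a) (XOb V a)) \<and>
     (\<forall>p\<in>Ops P. Cmp (Cmpt C (Tgt P p)) (XMor h (Tgt P p)) (XAct U p) =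
        Cmp (Cmpt C (Tgt P p)) (XAct V p) (FAr (Act C p) (map (XMor h) (Src P p)))) \<and>
     is_A_map P C (KOb U) (KAct U) (KOb V) (KAct V) (KMor h) \<and>
     is_A_map P C (LOb U) (LAct U) (LOb V) (LAct V) (LMor h) \<and>
     (\<forall>a\<in>Obj (Col P).
        Cmp (Cmpt C a) (LMor h a) (FMap U a) = Cmp (Cmpt C a) (FMap V a) (KMor h a) \<and>
        Cmp (Cmpt C a) (XMor h a) (GMap U a) = Cmp (Cmpt C a) (GMap V a) (KMor h a))"

definition image_alg :: "'s substitude_data \<Rightarrow> ('s \<Rightarrow> ('s, 's, 's, 's) func) \<Rightarrow>
    's internal_alg \<Rightarrow> 's internal_alg" where
  "image_alg P H U = \<lparr>XOb = (\<lambda>a. FOb (H a) (XOb U a)),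
     KOb = (\<lambda>a. FOb (H a) (KOb U a)), LOb = (\<lambda>a. FOb (H a) (LOb U a)),
     XAct = (\<lambda>p. FAr (H (Tgt P p)) (XAct U p)),
     KAct = (\<lambda>u. FAr (H (Cod (Col P) u)) (KAct U u)),
     LAct = (\<lambda>u. FAr (H (Cod (Col P) u)) (LAct U u)),
     FMap = (\<lambda>a. FAr (H a) (FMap U a)), GMap = (\<lambda>a. FAr (H a) (GMap U a))\<rparr>"

text \<open>Structure maps are total HOL functions whose values outside the carriers are irrelevant, so
  equality of internal algebras and of morphisms of algebras means agreement on the carriers.\<close>

definition same_internal_alg ::
    "'s substitude_data \<Rightarrow> 's internal_alg \<Rightarrow> 's internal_alg \<Rightarrow> bool" where
  "same_internal_alg P U V \<longleftrightarrow>
     (\<forall>a\<in>Obj (Col P). XOb U a = XOb V a \<and> KOb U a = KOb V a \<and> LOb U a = LOb V a \<and>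
        FMap U a = FMap V a \<and> GMap U a = GMap V a) \<and>
     (\<forall>p\<in>Ops P. XAct U p = XAct V p) \<and>
     (\<forall>u\<in>Arr (Col P). KAct U u = KAct V u \<and> LAct U u = LAct V u)"

definition same_alg_mor :: "'s substitude_data \<Rightarrow> 's cat_alg \<Rightarrow>
    ('s \<Rightarrow> ('s, 's, 's, 's) func) \<Rightarrow> ('s \<Rightarrow> ('s, 's, 's, 's) func) \<Rightarrow> bool" where
  "same_alg_mor P C H H' \<longleftrightarrow> (\<forall>a\<in>Obj (Col P).
     (\<forall>x\<in>Obj (Cmpt C a). FOb (H a) x = FOb (H' a) x) \<and>
     (\<forall>f\<in>Arr (Cmpt C a). FAr (H a) f = FAr (H' a) f))"

definition restricts_to :: "'s substitude_data \<Rightarrow> 's internal_alg \<Rightarrow>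
    ('s \<Rightarrow> 's \<Rightarrow> 's) \<Rightarrow> 's internal_mor \<Rightarrow> bool" where
  "restricts_to P U \<theta> h \<longleftrightarrow> (\<forall>a\<in>Obj (Col P).
     \<theta> a (XOb U a) = XMor h a \<and> \<theta> a (KOb U a) = KMor h a \<and> \<theta> a (LOb U a) = LMor h a)"

text \<open>\<open>U\<close> is a universal internal algebra in \<open>C\<close>: for every \<open>D\<close>, the functor from the category
  of algebra morphisms \<open>C \<rightarrow> D\<close> and algebra transformations to the category of internal algebras
  in \<open>D\<close>, given by the image of \<open>U\<close>, is bijective on objects and fully faithful, i.e. an
  isomorphism of categories. By the Yoneda lemma this says that \<open>C\<close> represents the 2-functor of
  internal algebras.\<close>

definition classifier :: "'s substitude_data \<Rightarrow> 's cat_alg \<Rightarrow> 's internal_alg \<Rightarrow> bool" where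
  "classifier P C U \<longleftrightarrow> categorical_algebra P C \<and> internal_algebra P C U \<and>
     (\<forall>D. categorical_algebra P D \<longrightarrow>
       (\<forall>V. internal_algebra P D V \<longrightarrow>
         (\<exists>H. is_alg_mor P C D H \<and> same_internal_alg P (image_alg P H U) V \<and>
           (\<forall>H'. is_alg_mor P C D H' \<and> same_internal_alg P (image_alg P H' U) V \<longrightarrow>
              same_alg_mor P C H H'))) \<and>
       (\<forall>H H' h. is_alg_mor P C D H \<and> is_alg_mor P C D H' \<and>
           is_internal_mor P D (image_alg P H U) (image_alg P H' U) h \<longrightarrow>
         (\<exists>\<theta>. is_alg_trans P C D H H' \<theta> \<and> restricts_to P U \<theta> h \<and>
           (\<forall>\<theta>'. is_alg_trans P C D H H' \<theta>' \<and> restricts_to P U \<theta>' h \<longrightarrow>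
              (\<forall>a\<in>Obj (Col P). \<forall>x\<in>Obj (Cmpt C a). \<theta>' a x = \<theta> a x)))))"


section \<open>The filtration of the classifier\<close>

datatype edge = X_edge | K_edge | L_edge

fun edge_obj :: "'s internal_alg \<Rightarrow> edge \<Rightarrow> 's \<Rightarrow> 's" where
  "edge_obj U X_edge a = XOb U a"
| "edge_obj U K_edge a = KOb U a"
| "edge_obj U L_edge a = LOb U a"

text \<open>The object of the classifier that corresponds to a corolla \<open>p\<close> with inputs labelled by \<open>es\<close>
  is the value of \<open>p\<close> at the corresponding universal objects.\<close>

definition corolla :: "'s substitude_data \<Rightarrow> 's cat_alg \<Rightarrow> 's internal_alg \<Rightarrow>
    's \<Rightarrow> edge list \<Rightarrow> 's \<times> 's" where
  "corolla P C U p es = (Tgt P p, FOb (Act C p) (map2 (edge_obj U) es (Src P p)))"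

definition has_type :: "'s substitude_data \<Rightarrow> 's cat_alg \<Rightarrow> 's internal_alg \<Rightarrow>
    's \<times> 's \<Rightarrow> nat \<Rightarrow> nat \<Rightarrow> bool" where
  "has_type P C U x m n \<longleftrightarrow> (\<exists>p\<in>Ops P. \<exists>es. length es = length (Src P p) \<and>
     x = corolla P C U p es \<and> count_list es K_edge = m \<and> count_list es L_edge = n)"

definition p_sub :: "'s substitude_data \<Rightarrow> 's cat_alg \<Rightarrow> 's internal_alg \<Rightarrow> nat \<Rightarrow>
    ('s \<times> 's, 's \<times> 's) cat" where
  "p_sub P C U k = full_sub (total_cat P C) {x. \<exists>m n. has_type P C U x m n \<and> m + n \<le> k}"

definition w_sub :: "'s substitude_data \<Rightarrow> 's cat_alg \<Rightarrow> 's internal_alg \<Rightarrow> nat \<Rightarrow>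
    ('s \<times> 's, 's \<times> 's) cat" where
  "w_sub P C U k = full_sub (total_cat P C) {x. \<exists>m n. has_type P C U x m n \<and> m + n = k}"

definition q_sub :: "'s substitude_data \<Rightarrow> 's cat_alg \<Rightarrow> 's internal_alg \<Rightarrow> nat \<Rightarrow>
    ('s \<times> 's, 's \<times> 's) cat" where
  "q_sub P C U k =
     full_sub (w_sub P C U k) {x. \<exists>m n. has_type P C U x m n \<and> m + n = k \<and> m \<noteq> 0}"

definition l_sub :: "'s substitude_data \<Rightarrow> 's cat_alg \<Rightarrow> 's internal_alg \<Rightarrow> nat \<Rightarrow>
    ('s \<times> 's, 's \<times> 's) cat" where
  "l_sub P C U k = full_sub (w_sub P C U k) {x. has_type P C U x 0 k}"

definition filtration :: "'s substitude_data \<Rightarrow> 's cat_alg \<Rightarrow> 's internal_alg \<Rightarrow> ('o, 'm) cat \<Rightarrow>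
    ('s \<times> 's, 's \<times> 's, 'o, 'm) func \<Rightarrow> (nat, nat \<times> nat, 'o, 'm) func" where
  "filtration P C U M X = \<lparr>FOb = (\<lambda>k. colim_obj M (p_sub P C U k) X),
     FAr = (\<lambda>(i, j). colim_map M (p_sub P C U i) (p_sub P C U j) X)\<rparr>"

end

theory Submission
  imports Defs "HOL-Library.Nat_Bijection"
begin

text \<open>Every object of the classifier is a decorated corolla, unique up to a permutation of its inputs:
  uniqueness is detected by the free algebra on the labels with indiscrete components. Every arrow
  into a corolla \<open>p\<close> is obtained by applying \<open>p\<close> to arrows with a single edge as target, each of
  which first changes all labels to that of the edge and then applies a structure map; the arrows
  of this form are the arrows of a subalgebra, so uniqueness in the universal property makes them
  exhaust the classifier. Hence an arrow out of an object of \<open>q_sub k\<close> that stays in degree \<open>k\<close>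
  and loses all \<open>K\<close>-edges factors through the arrow turning every \<open>K\<close> into \<open>L\<close>, and one that
  lowers the degree factors through an arrow turning some \<open>K\<close> into \<open>X\<close>; the latter can all be
  completed to the arrow turning every \<open>K\<close> into \<open>X\<close>. So the categories of arrows from an object of
  \<open>q_sub k\<close> into \<open>l_sub k\<close> and into \<open>p_sub (k - 1)\<close> are connected, which gives the pushout.\<close>

section \<open>Colimits over full subcategories\<close>

text \<open>The classifier is known only through its universal property among algebras whose
  carriers lie in the universe \<open>'s\<close>; there is no presentation by generators and
  relations to induct on, so facts about its objects and arrows are extracted from test algebras
  over \<open>'s\<close>. Equality of corollas needs a target in which decorated operations are
  elements of \<open>'s\<close>; an infinite universe admits injective codes for pairs and for
  operations with a list of labels. The same pairing makes \<open>total_cat\<close>, whose objects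
  and arrows are pairs, small in the sense of \<open>cocomplete\<close>. For arrows the delicate
  point is closure under composition. The order of label change and structure map is stable because
  a change made after a structure map equals a change made before another one: \<open>f\<close> and
  \<open>g\<close> commute with the action of \<open>A\<close>, and only identities start at
  \<open>X\<close> and \<open>L\<close>. A second obstacle is that a middle object determines its
  operation and labels only up to a reordering, so the presentations have to be matched before
  composing.\<close>

lemma HomD:
  assumes "f \<in> Hom C x y"
  shows "f \<in> Arr C" "Dom C f = x" "Cod C f = y"
  using assms by (simp_all add: Hom_def)

lemma Arr_Hom: "f \<in> Arr C \<Longrightarrow> f \<in> Hom C (Dom C f) (Cod C f)"
  by (simp add: Hom_def)

lemma (in category) Hom_Obj:
  assumes "f \<in> Hom C x y"
  shows "x \<in> Obj C" "y \<in> Obj C"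
  using HomD[OF assms] Dom_Obj Cod_Obj by blast+

lemma is_functor_Obj: "is_functor C D F \<Longrightarrow> x \<in> Obj C \<Longrightarrow> FOb F x \<in> Obj D"
  by (simp add: is_functor_def)

lemma is_functor_Hom:
  "is_functor C D F \<Longrightarrow> f \<in> Hom C x y \<Longrightarrow> FAr F f \<in> Hom D (FOb F x) (FOb F y)"
  by (auto simp: is_functor_def Hom_def)

lemma is_functor_Idn: "is_functor C D F \<Longrightarrow> x \<in> Obj C \<Longrightarrow> FAr F (Idn C x) = Idn D (FOb F x)"
  by (simp add: is_functor_def)

lemma is_functor_Cmp:
  "is_functor C D F \<Longrightarrow> f \<in> Hom C x y \<Longrightarrow> g \<in> Hom C y z \<Longrightarrow>
    FAr F (Cmp C g f) = Cmp D (FAr F g) (FAr F f)"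
  by (auto simp: is_functor_def Hom_def)

lemma full_sub_simps [simp]:
  "Obj (full_sub C S) = Obj C \<inter> S"
  "Arr (full_sub C S) = {f \<in> Arr C. Dom C f \<in> S \<and> Cod C f \<in> S}"
  "Dom (full_sub C S) = Dom C" "Cod (full_sub C S) = Cod C"
  "Idn (full_sub C S) = Idn C" "Cmp (full_sub C S) = Cmp C"
  by (simp_all add: full_sub_def)

lemma full_sub_full_sub: "full_sub (full_sub C S) S' = full_sub C (S \<inter> S')"
  by (simp add: full_sub_def Int_assoc) (rule arg_cong2[where f = "\<lambda>a b. C\<lparr>Obj := a, Arr := b\<rparr>"], auto)

lemma category_full_sub:
  assumes "category C"
  shows "category (full_sub C S)"
proof -
  interpret category C by fact
  show ?thesis
    apply unfold_locales
    using Dom_Obj Cod_Obj Idn_Hom Cmp_Hom Cmp_Idn_left Cmp_Idn_right Cmp_assoc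
    by (auto simp: Hom_def)
qed

lemma is_functor_full_sub: "is_functor C D F \<Longrightarrow> is_functor (full_sub C S) D F"
  by (simp add: is_functor_def)

lemma is_cocone_Hom: "is_cocone M J F c \<phi> \<Longrightarrow> x \<in> Obj J \<Longrightarrow> \<phi> x \<in> Hom M (FOb F x) c"
  by (simp add: is_cocone_def)

lemma is_cocone_nat:
  "is_cocone M J F c \<phi> \<Longrightarrow> f \<in> Hom J x y \<Longrightarrow> Cmp M (\<phi> y) (FAr F f) = \<phi> x"
  by (auto simp: is_cocone_def Hom_def)

lemma is_cocone_compose:
  assumes "category M" "is_functor J M F" "is_cocone M J F c \<phi>" "h \<in> Hom M c d"
    and J: "category J"
  shows "is_cocone M J F d (\<lambda>x. Cmp M h (\<phi> x))"
proof -
  interpret M: category M by fact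
  interpret J: category J by fact
  show ?thesis
    unfolding is_cocone_def
  proof (intro conjI ballI)
    show "d \<in> Obj M" using M.Hom_Obj assms(4) by blast
    show "Cmp M h (\<phi> x) \<in> Hom M (FOb F x) d" if "x \<in> Obj J" for x
      using M.Cmp_Hom is_cocone_Hom assms that by metis
    show "Cmp M (Cmp M h (\<phi> (Cod J f))) (FAr F f) = Cmp M h (\<phi> (Dom J f))" if "f \<in> Arr J" for f
      using M.Cmp_assoc[OF is_functor_Hom[OF assms(2) Arr_Hom[OF that]]
          is_cocone_Hom[OF assms(3)] assms(4)] J.Cod_Obj that
        is_cocone_nat[OF assms(3) Arr_Hom[OF that]] by simp
  qed
qed

lemma is_colimit_cocone: "is_colimit M J F c \<phi> \<Longrightarrow> is_cocone M J F c \<phi>"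
  by (simp add: is_colimit_def)

lemma is_colimit_factor:
  assumes "is_colimit M J F c \<phi>" "is_cocone M J F d \<psi>"
  obtains h where "h \<in> Hom M c d" "\<And>x. x \<in> Obj J \<Longrightarrow> Cmp M h (\<phi> x) = \<psi> x"
  using assms unfolding is_colimit_def by blast

lemma is_colimit_eqI:
  assumes "category M" "category J" "is_colimit M J F c \<phi>" "h \<in> Hom M c d" "h' \<in> Hom M c d"
    "\<And>x. x \<in> Obj J \<Longrightarrow> Cmp M h (\<phi> x) = Cmp M h' (\<phi> x)"
  shows "h = h'"
proof -
  have F: "is_functor J M F" "is_cocone M J F c \<phi>"
    using assms(3) by (simp_all add: is_colimit_def)
  have "is_cocone M J F d (\<lambda>x. Cmp M h' (\<phi> x))"
    by (rule is_cocone_compose[OF assms(1) F assms(5,2)])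
  then have "\<exists>!h. h \<in> Hom M c d \<and> (\<forall>x\<in>Obj J. Cmp M h (\<phi> x) = Cmp M h' (\<phi> x))"
    using assms(3) unfolding is_colimit_def by blast
  then show ?thesis using assms by blast
qed

text \<open>The colimits in the statement are Hilbert choices, which mean something only when a
  colimit exists; this says that the choice is one.\<close>

definition has_colimit :: "('o, 'm) cat \<Rightarrow> ('i, 'j) cat \<Rightarrow> ('i, 'j, 'o, 'm) func \<Rightarrow> bool" where
  "has_colimit M J F \<longleftrightarrow> is_colimit M J F (colim_obj M J F) (colim_inj M J F)"

lemma has_colimitI: "is_colimit M J F c \<phi> \<Longrightarrow> has_colimit M J F"
  unfolding has_colimit_def colim_obj_def colim_inj_def colimit_def
  by (rule someI2_ex[where P = "\<lambda>(c, \<phi>). is_colimit M J F c \<phi>"]) auto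

lemma has_colimit_cocone:
  "has_colimit M J F \<Longrightarrow> is_cocone M J F (colim_obj M J F) (colim_inj M J F)"
  by (simp add: has_colimit_def is_colimit_def)

text \<open>\<open>cocomplete\<close> speaks only of index categories whose objects and arrows both
  lie in the universe; this is the isomorphic copy of \<open>J\<close> there. It is meaningful for
  injective \<open>e\<close> and \<open>d\<close>, when \<open>inv\<close> undoes the
  coding.\<close>

definition image_cat :: "('i \<Rightarrow> 'k) \<Rightarrow> ('j \<Rightarrow> 'l) \<Rightarrow> ('i, 'j) cat \<Rightarrow> ('k, 'l) cat" where
  "image_cat e d J = \<lparr>Obj = e ` Obj J, Arr = d ` Arr J,
     Dom = (\<lambda>f. e (Dom J (inv d f))), Cod = (\<lambda>f. e (Cod J (inv d f))),
     Idn = (\<lambda>x. d (Idn J (inv e x))), Cmp = (\<lambda>g f. d (Cmp J (inv d g) (inv d f)))\<rparr>"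

text \<open>A cocone over \<open>J\<close> and a cocone over its copy are the same family of maps up
  to reindexing, so a colimit over the copy is a colimit over \<open>J\<close>.\<close>

lemma has_colimit_small:
  fixes J :: "('i, 'j) cat" and e :: "'i \<Rightarrow> 's" and d :: "'j \<Rightarrow> 's"
  assumes "cocomplete TYPE('s) M" "category J" "is_functor J M F" "inj e" "inj d"
  shows "has_colimit M J F"
proof -
  interpret J: category J by fact
  define J' where "J' = image_cat e d J"
  define F' where "F' = \<lparr>FOb = FOb F \<circ> inv e, FAr = FAr F \<circ> inv d\<rparr>"
  have [simp]: "inv e (e x) = x" "inv d (d f) = f" for x f
    using assms(4,5) by simp_all
  note simps = J'_def F'_def image_cat_def Hom_def
  have homJ': "Hom J' x y = d ` {f. \<exists>a b. x = e a \<and> y = e b \<and> f \<in> Hom J a b}" for x y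
    by (auto simp: simps)
  \<comment> \<open>Composable arrows of \<open>J'\<close> come from composable arrows of
    \<open>J\<close>: injectivity of \<open>e\<close> identifies the middle objects.\<close>
  have homE: "f \<in> Hom J' (e a) y \<Longrightarrow> \<exists>g b. f = d g \<and> y = e b \<and> g \<in> Hom J a b" for f a y
    using assms(4) by (auto simp: homJ' inj_eq)
  have homI: "f \<in> Hom J a b \<Longrightarrow> d f \<in> Hom J' (e a) (e b)" for f a b
    by (auto simp: homJ')
  have cmp: "Cmp J' (d g) (d f) = d (Cmp J g f)" "Idn J' (e x) = d (Idn J x)" for f g x
    by (simp_all add: J'_def image_cat_def)
  have "category J'"
  proof
    show "Dom J' f \<in> Obj J'" "Cod J' f \<in> Obj J'" if "f \<in> Arr J'" for f
      using that J.Dom_Obj J.Cod_Obj by (auto simp: J'_def image_cat_def)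
    show "Idn J' x \<in> Hom J' x x" if x: "x \<in> Obj J'" for x
    proof -
      obtain a where "x = e a" "a \<in> Obj J" using x by (auto simp: J'_def image_cat_def)
      then show ?thesis using homI[OF J.Idn_Hom] by (simp add: cmp)
    qed
    show "Cmp J' g f \<in> Hom J' x z" if fg: "f \<in> Hom J' x y" "g \<in> Hom J' y z" for f g x y z
    proof -
      obtain f' a b where f: "f = d f'" "x = e a" "y = e b" "f' \<in> Hom J a b"
        using fg(1) by (auto simp: homJ')
      obtain g' c where g: "g = d g'" "z = e c" "g' \<in> Hom J b c"
        using homE fg(2) f(3) by blast
      show ?thesis using homI[OF J.Cmp_Hom[OF f(4) g(3)]] f g by (simp add: cmp)
    qed
    show "Cmp J' f (Idn J' x) = f" "Cmp J' (Idn J' y) f = f" if "f \<in> Hom J' x y" for f x y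
      using that J.Cmp_Idn_right J.Cmp_Idn_left by (auto simp: homJ' cmp)
    show "Cmp J' h (Cmp J' g f) = Cmp J' (Cmp J' h g) f"
      if fg: "f \<in> Hom J' w x" "g \<in> Hom J' x y" "h \<in> Hom J' y z" for f g h w x y z
    proof -
      obtain f' a b where f: "f = d f'" "w = e a" "x = e b" "f' \<in> Hom J a b"
        using fg(1) by (auto simp: homJ')
      obtain g' c where g: "g = d g'" "y = e c" "g' \<in> Hom J b c"
        using homE fg(2) f(3) by blast
      obtain h' k where h: "h = d h'" "h' \<in> Hom J c k"
        using homE fg(3) g(2) by blast
      show ?thesis using J.Cmp_assoc[OF f(4) g(3) h(2)] f g h by (simp add: cmp)
    qed
  qed
  moreover have "is_functor J' M F'"
    using assms(3) by (auto simp: simps is_functor_def inj_eq assms(4,5))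
  ultimately obtain c \<phi> where col: "is_colimit M J' F' c \<phi>"
    using assms(1) unfolding cocomplete_def by blast
  have "is_colimit M J F c (\<phi> \<circ> e)"
    unfolding is_colimit_def
  proof (intro conjI allI impI)
    show "is_functor J M F" by fact
    show "is_cocone M J F c (\<phi> \<circ> e)"
      using is_colimit_cocone[OF col] by (auto simp: is_cocone_def simps)
    fix d' \<psi>
    assume "is_cocone M J F d' \<psi>"
    then have "is_cocone M J' F' d' (\<psi> \<circ> inv e)"
      by (auto simp: is_cocone_def simps)
    then have "\<exists>!h. h \<in> Hom M c d' \<and> (\<forall>x\<in>Obj J'. Cmp M h (\<phi> x) = (\<psi> \<circ> inv e) x)"
      using col unfolding is_colimit_def by blast
    then show "\<exists>!h. h \<in> Hom M c d' \<and> (\<forall>x\<in>Obj J. Cmp M h ((\<phi> \<circ> e) x) = \<psi> x)"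
      by (simp add: J'_def image_cat_def)
  qed
  then show ?thesis by (rule has_colimitI)
qed

text \<open>The property that \<open>colim_map\<close> selects by a definite description; equations
  between canonical maps are derived from it by uniqueness.\<close>

definition comparison :: "('o, 'm) cat \<Rightarrow> ('i, 'j) cat \<Rightarrow> ('i, 'j) cat \<Rightarrow>
    ('i, 'j, 'o, 'm) func \<Rightarrow> 'm \<Rightarrow> bool" where
  "comparison M J' J F h \<longleftrightarrow> h \<in> Hom M (colim_obj M J' F) (colim_obj M J F) \<and>
     (\<forall>x\<in>Obj J'. Cmp M h (colim_inj M J' F x) = colim_inj M J F x)"

lemma comparison_unique:
  assumes "category M" "category J'" "has_colimit M J' F"
    "comparison M J' J F h" "comparison M J' J F h'"
  shows "h = h'"
  by (rule is_colimit_eqI[OF assms(1,2) assms(3)[unfolded has_colimit_def]])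
    (use assms(4,5) in \<open>auto simp: comparison_def\<close>)

text \<open>The injections over the larger index category restrict to a cocone over the smaller one.
  The inclusion is required on objects of \<open>J\<close> only, which suits
  \<open>pushout_of_full_subs\<close>, where \<open>B\<close> is controlled only there.\<close>

lemma comparison_colim_map:
  assumes "category M" "category J" "has_colimit M (full_sub J S) F" "has_colimit M (full_sub J S') F"
    and sub: "Obj J \<inter> S \<subseteq> S'"
  shows "comparison M (full_sub J S) (full_sub J S') F (colim_map M (full_sub J S) (full_sub J S') F)"
proof -
  interpret J: category J by fact
  have "is_cocone M (full_sub J S) F (colim_obj M (full_sub J S') F) (colim_inj M (full_sub J S') F)"
    using has_colimit_cocone[OF assms(4)] sub J.Dom_Obj J.Cod_Obj
    unfolding is_cocone_def by (auto simp: subset_iff)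
  then obtain h where "comparison M (full_sub J S) (full_sub J S') F h"
    using is_colimit_factor[OF assms(3)[unfolded has_colimit_def]] unfolding comparison_def by metis
  moreover have "colim_map M (full_sub J S) (full_sub J S') F =
      (THE h. comparison M (full_sub J S) (full_sub J S') F h)"
    by (simp add: colim_map_def comparison_def)
  ultimately show ?thesis
    using theI[of "comparison M (full_sub J S) (full_sub J S') F"]
      comparison_unique[OF assms(1) category_full_sub[OF assms(2)] assms(3)] by metis
qed

lemma comparison_trans:
  assumes "category M" "is_functor J M F" "has_colimit M J F" "comparison M J J' F h" "comparison M J' J'' F h'"
    "has_colimit M J' F" "Obj J \<subseteq> Obj J'"
  shows "comparison M J J'' F (Cmp M h' h)"
proof -
  interpret M: category M by fact
  have h: "h \<in> Hom M (colim_obj M J F) (colim_obj M J' F)" "h' \<in> Hom M (colim_obj M J' F) (colim_obj M J'' F)"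
    using assms by (auto simp: comparison_def)
  have "Cmp M (Cmp M h' h) (colim_inj M J F x) = colim_inj M J'' F x" if "x \<in> Obj J" for x
    using M.Cmp_assoc[OF is_cocone_Hom[OF has_colimit_cocone[OF assms(3)] that] h] that assms(4,5,7)
    by (auto simp: comparison_def)
  with M.Cmp_Hom[OF h] show ?thesis by (simp add: comparison_def)
qed

section \<open>Colimits over an exhausting sequence of full subcategories\<close>

lemma full_sub_UNIV: "full_sub C UNIV = C"
  by (simp add: full_sub_def)

text \<open>A cocone on the sequence assigns to \<open>x\<close> the same map at every stage
  containing it, so the assembled family does not depend on the stage chosen; it is a cocone over
  \<open>J\<close> because every arrow lies in some stage.\<close>

theorem sequential_colimit:
  fixes A :: "nat \<Rightarrow> 'i set"
  assumes M: "category M" and J: "category J" and F: "is_functor J M F"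
    and mono: "\<And>i j. i \<le> j \<Longrightarrow> A i \<subseteq> A j" and exh: "Obj J \<subseteq> (\<Union>k. A k)"
    and colA: "\<And>k. has_colimit M (full_sub J (A k)) F" and colJ: "has_colimit M J F"
  shows "is_colimit M omega_cat
    \<lparr>FOb = (\<lambda>k. colim_obj M (full_sub J (A k)) F),
     FAr = (\<lambda>(i, j). colim_map M (full_sub J (A i)) (full_sub J (A j)) F)\<rparr>
    (colim_obj M J F) (\<lambda>k. colim_map M (full_sub J (A k)) J F)"
proof -
  interpret M: category M by fact
  interpret J: category J by fact
  let ?A = "\<lambda>k. full_sub J (A k)"
  let ?m = "\<lambda>i j. colim_map M (?A i) (?A j) F"
  let ?c = "\<lambda>k. colim_map M (?A k) J F"
  let ?D = "\<lparr>FOb = (\<lambda>k. colim_obj M (?A k) F), FAr = (\<lambda>(i, j). ?m i j)\<rparr>"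
  have FA: "is_functor (?A k) M F" and catA: "category (?A k)" for k
    by (simp_all add: is_functor_full_sub F category_full_sub J)
  have m: "comparison M (?A i) (?A j) F (?m i j)" if "i \<le> j" for i j
    by (rule comparison_colim_map[OF M J colA colA]) (use mono[OF that] in blast)
  have c: "comparison M (?A k) J F (?c k)" for k
    using comparison_colim_map[OF M J colA[of k], of UNIV] colJ by (simp add: full_sub_UNIV)
  have uniq: "comparison M (?A i) J' F h \<Longrightarrow> comparison M (?A i) J' F h' \<Longrightarrow> h = h'" for i J' h h'
    using comparison_unique[OF M catA colA] .
  have sub: "Obj (?A i) \<subseteq> Obj (?A j)" if "i \<le> j" for i j
    using mono[OF that] by auto
  have mm: "?m i l = Cmp M (?m j l) (?m i j)" if "i \<le> j" "j \<le> l" for i j l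
    by (rule uniq[OF m comparison_trans[OF M FA colA m m colA sub]]) (use that in auto)
  have cm: "Cmp M (?c j) (?m i j) = ?c i" if "i \<le> j" for i j
    by (rule uniq[OF comparison_trans[OF M FA colA m c colA sub] c]) (use that in auto)
  have inj: "colim_inj M (?A i) F x \<in> Hom M (FOb F x) (colim_obj M (?A i) F)"
    if "x \<in> Obj J" "x \<in> A i" for i x
    using is_cocone_Hom[OF has_colimit_cocone[OF colA]] that by simp
  have mI: "Cmp M (?m i j) (colim_inj M (?A i) F x) = colim_inj M (?A j) F x"
    if "i \<le> j" "x \<in> Obj J" "x \<in> A i" for i j x
    using m[OF that(1)] that by (simp add: comparison_def)
  have cI: "Cmp M (?c i) (colim_inj M (?A i) F x) = colim_inj M J F x"
    if "x \<in> Obj J" "x \<in> A i" for i x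
    using c[of i] that by (simp add: comparison_def)
  have mH: "?m i j \<in> Hom M (colim_obj M (?A i) F) (colim_obj M (?A j) F)" if "i \<le> j" for i j
    using m[OF that] by (simp add: comparison_def)
  have cH: "?c i \<in> Hom M (colim_obj M (?A i) F) (colim_obj M J F)" for i
    using c by (simp add: comparison_def)
  have oA: "colim_obj M (?A i) F \<in> Obj M" for i
    using has_colimit_cocone[OF colA] by (simp add: is_cocone_def)
  have "comparison M (?A i) (?A i) F (Idn M (colim_obj M (?A i) F))" for i
    using M.Idn_Hom[OF oA] M.Cmp_Idn_left[OF inj] unfolding comparison_def by simp
  then have "Idn M (colim_obj M (?A i) F) = ?m i i" for i
    using uniq m[OF order_refl] by blast
  then have functorial: "is_functor omega_cat M ?D"
    unfolding is_functor_def using oA mH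
    by (simp add: omega_cat_def) (metis mm)
  have cocone: "is_cocone M omega_cat ?D (colim_obj M J F) ?c"
    using has_colimit_cocone[OF colJ] cH cm by (auto simp: is_cocone_def omega_cat_def)
  have "\<exists>!h. h \<in> Hom M (colim_obj M J F) d \<and> (\<forall>x\<in>Obj omega_cat. Cmp M h (?c x) = \<psi> x)"
    if co: "is_cocone M omega_cat ?D d \<psi>" for d \<psi>
  proof -
    have \<psi>H: "\<psi> i \<in> Hom M (colim_obj M (?A i) F) d" for i
      using co by (simp add: is_cocone_def omega_cat_def)
    have \<psi>m: "Cmp M (\<psi> j) (?m i j) = \<psi> i" if "i \<le> j" for i j
      using co that by (auto simp: is_cocone_def omega_cat_def)
    have dM: "d \<in> Obj M" using co by (simp add: is_cocone_def)
    define \<chi> where "\<chi> i x = Cmp M (\<psi> i) (colim_inj M (?A i) F x)" for i x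
    \<comment> \<open>The least stage is only a definite choice; as shown below, any stage
      containing \<open>x\<close> gives the same map.\<close>
    define lev where "lev x = (LEAST k. x \<in> A k)" for x
    have lev: "x \<in> A (lev x)" if "x \<in> Obj J" for x
      using exh that unfolding lev_def by (auto intro: LeastI)
    have \<chi>_up: "\<chi> i x = \<chi> j x" if "i \<le> j" "x \<in> Obj J" "x \<in> A i" for i j x
      using M.Cmp_assoc[OF inj[OF that(2,3)] mH[OF that(1)] \<psi>H] \<psi>m[OF that(1)] mI[OF that]
      by (simp add: \<chi>_def)
    have \<chi>_lev: "\<chi> i x = \<chi> (lev x) x" if "x \<in> Obj J" "x \<in> A i" for i x
      by (rule \<chi>_up[symmetric]) (use lev that in \<open>auto simp: lev_def intro: Least_le\<close>)
    have \<chi>_cocone: "is_cocone M (?A i) F d (\<chi> i)" for i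
      unfolding \<chi>_def
      by (rule is_cocone_compose[OF M FA has_colimit_cocone[OF colA] \<psi>H catA])
    have "is_cocone M J F d (\<lambda>x. \<chi> (lev x) x)"
      unfolding is_cocone_def
    proof (intro conjI ballI dM)
      show "\<chi> (lev x) x \<in> Hom M (FOb F x) d" if "x \<in> Obj J" for x
        using is_cocone_Hom[OF \<chi>_cocone, of x "lev x"] lev that by simp
      fix f assume f: "f \<in> Arr J"
      \<comment> \<open>The stages are full, so \<open>f\<close> itself lies in any stage that
        contains both of its ends.\<close>
      define k where "k = max (lev (Dom J f)) (lev (Cod J f))"
      have D: "Dom J f \<in> Obj J" "Cod J f \<in> Obj J" using f J.Dom_Obj J.Cod_Obj by auto
      then have k: "Dom J f \<in> A k" "Cod J f \<in> A k"
        using lev mono[of "lev (Dom J f)" k] mono[of "lev (Cod J f)" k] by (auto simp: k_def)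
      then have "Cmp M (\<chi> k (Cod J f)) (FAr F f) = \<chi> k (Dom J f)"
        using \<chi>_cocone[of k] f by (simp add: is_cocone_def)
      then show "Cmp M (\<chi> (lev (Cod J f)) (Cod J f)) (FAr F f) = \<chi> (lev (Dom J f)) (Dom J f)"
        using \<chi>_lev D k by metis
    qed
    then obtain h where h: "h \<in> Hom M (colim_obj M J F) d"
      and hI: "\<And>x. x \<in> Obj J \<Longrightarrow> Cmp M h (colim_inj M J F x) = \<chi> (lev x) x"
      using is_colimit_factor[OF colJ[unfolded has_colimit_def]] by blast
    have hc: "Cmp M h (?c k) = \<psi> k" for k
    proof (rule is_colimit_eqI[OF M catA colA[unfolded has_colimit_def] M.Cmp_Hom[OF cH h] \<psi>H])
      fix x assume "x \<in> Obj (?A k)"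
      then have x: "x \<in> Obj J" "x \<in> A k" by auto
      show "Cmp M (Cmp M h (?c k)) (colim_inj M (?A k) F x) = Cmp M (\<psi> k) (colim_inj M (?A k) F x)"
        using M.Cmp_assoc[OF inj[OF x] cH h] cI[OF x] hI[OF x(1)] \<chi>_lev[OF x]
        by (simp add: \<chi>_def)
    qed
    show ?thesis
    proof (rule ex1I[of _ h])
      show "h \<in> Hom M (colim_obj M J F) d \<and> (\<forall>x\<in>Obj omega_cat. Cmp M h (?c x) = \<psi> x)"
        using h hc by simp
      fix h'
      assume "h' \<in> Hom M (colim_obj M J F) d \<and> (\<forall>x\<in>Obj omega_cat. Cmp M h' (?c x) = \<psi> x)"
      then have h': "h' \<in> Hom M (colim_obj M J F) d" "\<And>k. Cmp M h' (?c k) = \<psi> k"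
        by (auto simp: omega_cat_def)
      show "h' = h"
      proof (rule is_colimit_eqI[OF M J colJ[unfolded has_colimit_def] h'(1) h])
        fix x assume x: "x \<in> Obj J"
        note i = inj[OF x lev[OF x]]
        show "Cmp M h' (colim_inj M J F x) = Cmp M h (colim_inj M J F x)"
          using M.Cmp_assoc[OF i cH h'(1)] M.Cmp_assoc[OF i cH h] h'(2) hc cI[OF x lev[OF x]] by simp
      qed
    qed
  qed
  with functorial cocone show ?thesis by (simp add: is_colimit_def)
qed

text \<open>The category of arrows from \<open>x\<close> into the full subcategory on \<open>S\<close> is then connected, since
  each of its objects is linked to a fixed one by a span.\<close>

definition spanned_under :: "('i, 'j) cat \<Rightarrow> 'i set \<Rightarrow> 'i \<Rightarrow> bool" where
  "spanned_under J S x \<longleftrightarrow> (\<exists>y g. y \<in> S \<and> g \<in> Hom J x y \<and>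
     (\<forall>z\<in>S. \<forall>f\<in>Hom J x z. \<exists>w\<in>S. \<exists>\<gamma>\<in>Hom J x w. \<exists>h\<in>Hom J w z. \<exists>h'\<in>Hom J w y.
        f = Cmp J h \<gamma> \<and> g = Cmp J h' \<gamma>))"

text \<open>Composing \<open>\<gamma>\<close> with an arrow inside \<open>S\<close> does not change
  its value under the cocone, so both legs of a span give the value of \<open>\<gamma>\<close>;
  hence every \<open>f\<close> has the value of the fixed \<open>g\<close>.\<close>

lemma spanned_under_extend:
  assumes M: "category M" and J: "category J" and F: "is_functor J M F"
    and co: "is_cocone M (full_sub J S) F c \<phi>" and x: "spanned_under J S x"
  obtains i where "i \<in> Hom M (FOb F x) c"
    "\<And>z f. z \<in> S \<Longrightarrow> f \<in> Hom J x z \<Longrightarrow> Cmp M (\<phi> z) (FAr F f) = i"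
    "\<exists>z\<in>S. \<exists>f. f \<in> Hom J x z"
proof -
  interpret M: category M by fact
  interpret J: category J by fact
  obtain y g where y: "y \<in> S" "g \<in> Hom J x y"
    and spans: "\<And>z f. z \<in> S \<Longrightarrow> f \<in> Hom J x z \<Longrightarrow> \<exists>w\<in>S. \<exists>\<gamma>\<in>Hom J x w. \<exists>h\<in>Hom J w z. \<exists>h'\<in>Hom J w y.
        f = Cmp J h \<gamma> \<and> g = Cmp J h' \<gamma>"
    using x unfolding spanned_under_def by blast
  have \<phi>: "\<phi> z \<in> Hom M (FOb F z) c" if "z \<in> S" "z \<in> Obj J" for z
    using is_cocone_Hom[OF co] that by simp
  have slide: "Cmp M (\<phi> z) (FAr F (Cmp J h \<gamma>)) = Cmp M (\<phi> w) (FAr F \<gamma>)"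
    if "w \<in> S" "z \<in> S" "\<gamma> \<in> Hom J x w" "h \<in> Hom J w z" for w z \<gamma> h
  proof -
    have "h \<in> Hom (full_sub J S) w z" using that by (auto simp: Hom_def)
    then have "Cmp M (\<phi> z) (FAr F h) = \<phi> w" by (rule is_cocone_nat[OF co])
    moreover have "Cmp M (\<phi> z) (Cmp M (FAr F h) (FAr F \<gamma>)) = Cmp M (Cmp M (\<phi> z) (FAr F h)) (FAr F \<gamma>)"
      using that J.Hom_Obj by (intro M.Cmp_assoc) (auto intro!: is_functor_Hom[OF F] \<phi>)
    ultimately show ?thesis using is_functor_Cmp[OF F that(3,4)] by simp
  qed
  have eq: "Cmp M (\<phi> z) (FAr F f) = Cmp M (\<phi> y) (FAr F g)" if "z \<in> S" "f \<in> Hom J x z" for z f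
    using spans[OF that] slide that y by metis
  have "Cmp M (\<phi> y) (FAr F g) \<in> Hom M (FOb F x) c"
    using y J.Hom_Obj by (intro M.Cmp_Hom) (auto intro!: is_functor_Hom[OF F] \<phi>)
  then show ?thesis using that eq y by blast
qed

text \<open>Every object of \<open>Q\<close> maps to \<open>A\<close> and to \<open>L\<close> in an essentially unique way; this is what
  glues the colimits over \<open>A\<close> and \<open>L\<close> along \<open>Q\<close>.\<close>

theorem pushout_of_full_subs:
  assumes M: "category M" and J: "category J" and F: "is_functor J M F"
    and B: "Obj J \<inter> B = Obj J \<inter> (A \<union> Q \<union> L)"
    and disj: "A \<inter> Q = {}" "A \<inter> L = {}" "Q \<inter> L = {}"
    and from_A: "\<And>x y f. x \<in> A \<Longrightarrow> y \<in> B \<Longrightarrow> f \<in> Hom J x y \<Longrightarrow> y \<in> A"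
    and from_L: "\<And>x y f. x \<in> L \<Longrightarrow> y \<in> B \<Longrightarrow> f \<in> Hom J x y \<Longrightarrow> y \<in> L"
    and spans: "\<And>x. x \<in> Obj J \<Longrightarrow> x \<in> Q \<Longrightarrow> spanned_under J A x"
      "\<And>x. x \<in> Obj J \<Longrightarrow> x \<in> Q \<Longrightarrow> spanned_under J L x"
    and col: "\<And>S. has_colimit M (full_sub J S) F"
  shows "\<exists>w \<alpha>.
      w \<in> Hom M (colim_obj M (full_sub J Q) F) (colim_obj M (full_sub J L) F) \<and>
      \<alpha> \<in> Hom M (colim_obj M (full_sub J Q) F) (colim_obj M (full_sub J A) F) \<and>
      (\<forall>x \<in> Obj (full_sub J Q). \<forall>y \<in> Obj (full_sub J L). \<forall>f \<in> Hom J x y.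
        Cmp M w (colim_inj M (full_sub J Q) F x) =
        Cmp M (colim_inj M (full_sub J L) F y) (FAr F f)) \<and>
      (\<forall>x \<in> Obj (full_sub J Q). \<forall>y \<in> Obj (full_sub J A). \<forall>f \<in> Hom J x y.
        Cmp M \<alpha> (colim_inj M (full_sub J Q) F x) =
        Cmp M (colim_inj M (full_sub J A) F y) (FAr F f)) \<and>
      is_pushout M w \<alpha> (colim_map M (full_sub J L) (full_sub J B) F)
        (colim_map M (full_sub J A) (full_sub J B) F)"
proof -
  interpret M: category M by fact
  interpret J: category J by fact
  let ?o = "\<lambda>S. colim_obj M (full_sub J S) F" and ?i = "\<lambda>S. colim_inj M (full_sub J S) F"
  have cat: "category (full_sub J S)" and func: "is_functor (full_sub J S) M F" for S
    by (simp_all add: is_functor_full_sub F category_full_sub J)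
  have inj: "?i S x \<in> Hom M (FOb F x) (?o S)" if "x \<in> Obj J" "x \<in> S" for S x
    using is_cocone_Hom[OF has_colimit_cocone[OF col]] that by simp
  have inj_nat: "Cmp M (?i S y) (FAr F f) = ?i S x" if "f \<in> Hom J x y" "x \<in> S" "y \<in> S" for S x y f
    by (rule is_cocone_nat[OF has_colimit_cocone[OF col]]) (use that in \<open>auto simp: Hom_def\<close>)
  have uniq: "h = h'" if "h \<in> Hom M (?o S) d" "h' \<in> Hom M (?o S) d"
    "\<And>x. x \<in> Obj J \<Longrightarrow> x \<in> S \<Longrightarrow> Cmp M h (?i S x) = Cmp M h' (?i S x)" for S d h h'
    by (rule is_colimit_eqI[OF M cat col[unfolded has_colimit_def] that(1,2)]) (use that(3) in auto)

  \<comment> \<open>The common value of the cocone on all arrows from \<open>x\<close> into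
    \<open>S\<close> is itself a cocone over \<open>Q\<close> as \<open>x\<close> varies. This is
    applied with \<open>L\<close> to get \<open>w\<close> and with \<open>A\<close> to get
    \<open>\<alpha>\<close>.\<close>
  have into: "\<exists>w. w \<in> Hom M (?o Q) (?o S) \<and>
      (\<forall>x y f. x \<in> Q \<longrightarrow> y \<in> S \<longrightarrow> f \<in> Hom J x y \<longrightarrow> Cmp M w (?i Q x) = Cmp M (?i S y) (FAr F f))"
    if sp: "\<And>x. x \<in> Obj J \<Longrightarrow> x \<in> Q \<Longrightarrow> spanned_under J S x" for S
  proof -
    let ?P = "\<lambda>x i. i \<in> Hom M (FOb F x) (?o S) \<and>
      (\<forall>z f. z \<in> S \<longrightarrow> f \<in> Hom J x z \<longrightarrow> Cmp M (?i S z) (FAr F f) = i) \<and> (\<exists>z\<in>S. \<exists>f. f \<in> Hom J x z)"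
    have "\<forall>x \<in> Obj J \<inter> Q. \<exists>i. ?P x i"
    proof
      fix x assume "x \<in> Obj J \<inter> Q"
      then have "spanned_under J S x" using sp by simp
      then obtain i where "i \<in> Hom M (FOb F x) (?o S)"
        "\<And>z f. z \<in> S \<Longrightarrow> f \<in> Hom J x z \<Longrightarrow> Cmp M (?i S z) (FAr F f) = i"
        "\<exists>z\<in>S. \<exists>f. f \<in> Hom J x z"
        using spanned_under_extend[OF M J F has_colimit_cocone[OF col]] by metis
      then show "\<exists>i. ?P x i" by blast
    qed
    from bchoice[OF this] obtain \<beta> where \<beta>P: "\<And>x. x \<in> Obj J \<Longrightarrow> x \<in> Q \<Longrightarrow> ?P x (\<beta> x)"
      by blast
    have \<beta>H: "\<And>x. x \<in> Obj J \<Longrightarrow> x \<in> Q \<Longrightarrow> \<beta> x \<in> Hom M (FOb F x) (?o S)"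
      and \<beta>: "\<And>x z f. x \<in> Obj J \<Longrightarrow> x \<in> Q \<Longrightarrow> z \<in> S \<Longrightarrow> f \<in> Hom J x z \<Longrightarrow> Cmp M (?i S z) (FAr F f) = \<beta> x"
      and ex: "\<And>x. x \<in> Obj J \<Longrightarrow> x \<in> Q \<Longrightarrow> \<exists>z\<in>S. \<exists>f. f \<in> Hom J x z"
      using \<beta>P by blast+
    have "is_cocone M (full_sub J Q) F (?o S) \<beta>"
      unfolding is_cocone_def
    proof (intro conjI ballI)
      show "?o S \<in> Obj M" using has_colimit_cocone[OF col] by (simp add: is_cocone_def)
      show "\<beta> x \<in> Hom M (FOb F x) (?o S)" if "x \<in> Obj (full_sub J Q)" for x
        using that \<beta>H by simp
      fix f assume "f \<in> Arr (full_sub J Q)"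
      then have f: "f \<in> Hom J (Dom J f) (Cod J f)" "Dom J f \<in> Q" "Cod J f \<in> Q"
        by (auto simp: Hom_def)
      note fo = J.Hom_Obj[OF f(1)]
      obtain z g where z: "z \<in> S" "g \<in> Hom J (Cod J f) z" using ex[OF fo(2) f(3)] by blast
      note zo = J.Hom_Obj[OF z(2)]
      have "Cmp M (\<beta> (Cod J f)) (FAr F f) = Cmp M (Cmp M (?i S z) (FAr F g)) (FAr F f)"
        using \<beta>[OF fo(2) f(3) z] by simp
      also have "\<dots> = Cmp M (?i S z) (FAr F (Cmp J g f))"
        using M.Cmp_assoc[OF is_functor_Hom[OF F f(1)] is_functor_Hom[OF F z(2)] inj[OF zo(2) z(1)]]
          is_functor_Cmp[OF F f(1) z(2)] by simp
      also have "\<dots> = \<beta> (Dom J f)"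
        by (rule \<beta>[OF fo(1) f(2) z(1) J.Cmp_Hom[OF f(1) z(2)]])
      finally show "Cmp M (\<beta> (Cod (full_sub J Q) f)) (FAr F f) = \<beta> (Dom (full_sub J Q) f)" by simp
    qed
    then obtain w where "w \<in> Hom M (?o Q) (?o S)" "\<And>x. x \<in> Obj (full_sub J Q) \<Longrightarrow> Cmp M w (?i Q x) = \<beta> x"
      using is_colimit_factor[OF col[unfolded has_colimit_def]] by blast
    moreover from this have "Cmp M w (?i Q x) = Cmp M (?i S y) (FAr F f)"
      if "x \<in> Q" "y \<in> S" "f \<in> Hom J x y" for x y f
      using \<beta>[OF _ that] J.Hom_Obj(1)[OF that(3)] that(1) by simp
    ultimately show ?thesis by blast
  qed
  obtain w where w: "w \<in> Hom M (?o Q) (?o L)"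
    and wI: "\<And>x y f. x \<in> Q \<Longrightarrow> y \<in> L \<Longrightarrow> f \<in> Hom J x y \<Longrightarrow> Cmp M w (?i Q x) = Cmp M (?i L y) (FAr F f)"
    using into[OF spans(2)] by blast
  obtain \<alpha> where \<alpha>: "\<alpha> \<in> Hom M (?o Q) (?o A)"
    and \<alpha>I: "\<And>x y f. x \<in> Q \<Longrightarrow> y \<in> A \<Longrightarrow> f \<in> Hom J x y \<Longrightarrow> Cmp M \<alpha> (?i Q x) = Cmp M (?i A y) (FAr F f)"
    using into[OF spans(1)] by blast
  define l where "l = colim_map M (full_sub J L) (full_sub J B) F"
  define a where "a = colim_map M (full_sub J A) (full_sub J B) F"
  have "comparison M (full_sub J L) (full_sub J B) F l" "comparison M (full_sub J A) (full_sub J B) F a"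
    unfolding l_def a_def using B by (auto intro!: comparison_colim_map[OF M J col col])
  then have l: "l \<in> Hom M (?o L) (?o B)" "\<And>x. x \<in> Obj J \<Longrightarrow> x \<in> L \<Longrightarrow> Cmp M l (?i L x) = ?i B x"
    and a: "a \<in> Hom M (?o A) (?o B)" "\<And>x. x \<in> Obj J \<Longrightarrow> x \<in> A \<Longrightarrow> Cmp M a (?i A x) = ?i B x"
    by (auto simp: comparison_def)
  have ex: "\<exists>z\<in>S. \<exists>f. f \<in> Hom J x z" if "spanned_under J S x" for S x
    using that unfolding spanned_under_def by blast
  have via: "Cmp M (Cmp M h v) (?i Q x) = Cmp M (Cmp M h (?i S y)) (FAr F f)"
    if "v \<in> Hom M (?o Q) (?o S)" "h \<in> Hom M (?o S) d" "x \<in> Q" "y \<in> S" "f \<in> Hom J x y"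
      "Cmp M v (?i Q x) = Cmp M (?i S y) (FAr F f)" for S d v h x y f
    using M.Cmp_assoc[OF inj[OF J.Hom_Obj(1)[OF that(5)] that(3)] that(1,2)] that(6)
      M.Cmp_assoc[OF is_functor_Hom[OF F that(5)] inj[OF J.Hom_Obj(2)[OF that(5)] that(4)] that(2)]
    by simp
  have comm: "Cmp M l w = Cmp M a \<alpha>"
  proof (rule uniq[OF M.Cmp_Hom[OF w l(1)] M.Cmp_Hom[OF \<alpha> a(1)]])
    fix x assume x: "x \<in> Obj J" "x \<in> Q"
    obtain y f where y: "y \<in> L" "f \<in> Hom J x y" using ex[OF spans(2)[OF x]] by blast
    obtain z g where z: "z \<in> A" "g \<in> Hom J x z" using ex[OF spans(1)[OF x]] by blast
    have yz: "y \<in> B" "z \<in> B" "x \<in> B" "y \<in> Obj J" "z \<in> Obj J" using y z x B J.Hom_Obj by blast+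
    have "Cmp M (Cmp M l w) (?i Q x) = ?i B x"
      using via[OF w l(1) x(2) y wI[OF x(2) y]] l(2) y yz inj_nat by simp
    moreover have "Cmp M (Cmp M a \<alpha>) (?i Q x) = ?i B x"
      using via[OF \<alpha> a(1) x(2) z \<alpha>I[OF x(2) z]] a(2) z yz inj_nat by simp
    ultimately show "Cmp M (Cmp M l w) (?i Q x) = Cmp M (Cmp M a \<alpha>) (?i Q x)" by simp
  qed
  have univ: "\<exists>!m. m \<in> Hom M (?o B) d \<and> Cmp M m l = u \<and> Cmp M m a = v"
    if u: "u \<in> Hom M (?o L) d" and v: "v \<in> Hom M (?o A) d" and uv: "Cmp M u w = Cmp M v \<alpha>" for u v d
  proof -
    \<comment> \<open>On \<open>Q\<close> the value is forced from either side, by \<open>u\<close>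
      after \<open>w\<close> or by \<open>v\<close> after \<open>\<alpha>\<close>, and these agree
      by \<open>uv\<close>.\<close>
    define \<psi> where "\<psi> x = (if x \<in> A then Cmp M v (?i A x) else if x \<in> L then Cmp M u (?i L x)
        else Cmp M (Cmp M u w) (?i Q x))" for x
    have \<psi>A: "\<psi> x = Cmp M v (?i A x)" if "x \<in> A" for x using that by (simp add: \<psi>_def)
    have \<psi>L: "\<psi> x = Cmp M u (?i L x)" if "x \<in> L" for x using that disj by (auto simp: \<psi>_def)
    have \<psi>Q: "\<psi> x = Cmp M (Cmp M u w) (?i Q x)" if "x \<in> Q" for x using that disj by (auto simp: \<psi>_def)
    have sub: "is_cocone M (full_sub J S) F d (\<lambda>x. Cmp M h (?i S x))" if "h \<in> Hom M (?o S) d" for S h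
      by (rule is_cocone_compose[OF M func has_colimit_cocone[OF col] that cat])
    have sub_nat: "Cmp M (Cmp M h (?i S y)) (FAr F f) = Cmp M h (?i S x)"
      if "h \<in> Hom M (?o S) d" "f \<in> Hom J x y" "x \<in> S" "y \<in> S" for S h x y f
      by (rule is_cocone_nat[OF sub[OF that(1)]]) (use that in \<open>auto simp: Hom_def\<close>)
    have "is_cocone M (full_sub J B) F d \<psi>"
      unfolding is_cocone_def
    proof (intro conjI ballI)
      show "d \<in> Obj M" using M.Hom_Obj u by blast
      show "\<psi> x \<in> Hom M (FOb F x) d" if "x \<in> Obj (full_sub J B)" for x
        using that B unfolding \<psi>_def by (auto intro!: M.Cmp_Hom u v w inj)
      fix f assume "f \<in> Arr (full_sub J B)"
      then have f: "f \<in> Hom J (Dom J f) (Cod J f)" and D: "Dom J f \<in> B" "Cod J f \<in> B"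
        by (auto simp: Hom_def)
      note fo = J.Hom_Obj[OF f]
      \<comment> \<open>No arrow within \<open>B\<close> leaves \<open>A\<close> or
        \<open>L\<close>, so only arrows starting in \<open>Q\<close> cross from one piece to
        another.\<close>
      consider "Dom J f \<in> A" "Cod J f \<in> A" | "Dom J f \<in> L" "Cod J f \<in> L" | "Dom J f \<in> Q" "Cod J f \<in> Q"
        | "Dom J f \<in> Q" "Cod J f \<in> A" | "Dom J f \<in> Q" "Cod J f \<in> L"
        using B fo D from_A[OF _ D(2) f] from_L[OF _ D(2) f] by blast
      then have "Cmp M (\<psi> (Cod J f)) (FAr F f) = \<psi> (Dom J f)"
      proof cases
        case 1 then show ?thesis using sub_nat[OF v f] \<psi>A by simp
      next
        case 2 then show ?thesis using sub_nat[OF u f] \<psi>L by simp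
      next
        case 3 then show ?thesis using sub_nat[OF M.Cmp_Hom[OF w u] f] \<psi>Q by simp
      next
        case 4 then show ?thesis using via[OF \<alpha> v 4 f \<alpha>I[OF 4 f]] \<psi>Q \<psi>A uv by simp
      next
        case 5 then show ?thesis using via[OF w u 5 f wI[OF 5 f]] \<psi>Q \<psi>L by simp
      qed
      then show "Cmp M (\<psi> (Cod (full_sub J B) f)) (FAr F f) = \<psi> (Dom (full_sub J B) f)" by simp
    qed
    then obtain m where m: "m \<in> Hom M (?o B) d" "\<And>x. x \<in> Obj J \<Longrightarrow> x \<in> B \<Longrightarrow> Cmp M m (?i B x) = \<psi> x"
      using is_colimit_factor[OF col[unfolded has_colimit_def]] by (metis full_sub_simps(1) IntI)
    have BI: "x \<in> Obj J \<Longrightarrow> x \<in> A \<Longrightarrow> x \<in> B" "x \<in> Obj J \<Longrightarrow> x \<in> L \<Longrightarrow> x \<in> B" for x using B by blast+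
    have ml: "Cmp M m l = u"
      by (rule uniq[OF M.Cmp_Hom[OF l(1) m(1)] u])
        (use M.Cmp_assoc[OF inj l(1) m(1)] l(2) m(2) \<psi>L BI in simp)
    have ma: "Cmp M m a = v"
      by (rule uniq[OF M.Cmp_Hom[OF a(1) m(1)] v])
        (use M.Cmp_assoc[OF inj a(1) m(1)] a(2) m(2) \<psi>A BI in simp)
    show ?thesis
    proof (rule ex1I[of _ m])
      show "m \<in> Hom M (?o B) d \<and> Cmp M m l = u \<and> Cmp M m a = v" using m ml ma by simp
      fix m' assume m': "m' \<in> Hom M (?o B) d \<and> Cmp M m' l = u \<and> Cmp M m' a = v"
      have atA: "Cmp M m' (?i B x) = Cmp M m (?i B x)" if "x \<in> Obj J" "x \<in> A" for x
        using M.Cmp_assoc[OF inj[OF that] a(1)] m(1) m' a(2)[OF that] ma by metis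
      have atL: "Cmp M m' (?i B x) = Cmp M m (?i B x)" if "x \<in> Obj J" "x \<in> L" for x
        using M.Cmp_assoc[OF inj[OF that] l(1)] m(1) m' l(2)[OF that] ml by metis
      show "m' = m"
      proof (rule uniq[of _ B d])
        fix x assume x: "x \<in> Obj J" "x \<in> B"
        \<comment> \<open>An object of \<open>Q\<close> has an arrow to \<open>L\<close>, so a map
          out of the colimit over \<open>B\<close> is determined at that object by its values on
          \<open>L\<close>.\<close>
        have "Cmp M m' (?i B x) = Cmp M m (?i B x)" if q: "x \<in> Q"
        proof -
          obtain y f where y: "y \<in> L" "f \<in> Hom J x y" using ex[OF spans(2)[OF x(1) q]] by blast
          have yo: "y \<in> Obj J" "y \<in> B" using y J.Hom_Obj B by blast+
          have "Cmp M n (?i B x) = Cmp M (Cmp M n (?i B y)) (FAr F f)" if "n \<in> Hom M (?o B) d" for n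
            using M.Cmp_assoc[OF is_functor_Hom[OF F y(2)] inj[OF yo] that] inj_nat[OF y(2) x(2) yo(2)] by simp
          then show ?thesis using atL[OF yo(1) y(1)] m(1) m' by simp
        qed
        then show "Cmp M m' (?i B x) = Cmp M m (?i B x)" using x B atA atL by blast
      qed (use m m' in auto)
    qed
  qed
  have "is_pushout M w \<alpha> l a"
    unfolding is_pushout_def
  proof (intro conjI ballI impI)
    fix u v
    assume "u \<in> Arr M" "v \<in> Arr M" "Dom M u = Cod M w \<and> Dom M v = Cod M \<alpha> \<and> Cod M u = Cod M v \<and>
        Cmp M u w = Cmp M v \<alpha>"
    then show "\<exists>!m. m \<in> Hom M (Cod M l) (Cod M u) \<and> Cmp M m l = u \<and> Cmp M m a = v"
      using univ[of u "Cod M u" v] HomD[OF w] HomD[OF \<alpha>] HomD[OF l(1)] by (simp add: Hom_def)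
  qed (use HomD[OF w] HomD[OF \<alpha>] HomD[OF l(1)] HomD[OF a(1)] comm in auto)
  then show ?thesis
    using w \<alpha> wI \<alpha>I unfolding l_def a_def by (intro exI[of _ w] exI[of _ \<alpha>]) auto
qed

section \<open>Block permutations and grafting of decorated operations\<close>

lemma permute_list_perm_of_list:
  assumes "length l = length ys" shows "permute_list (perm_of_list l) ys = map ((!) ys) l"
proof (rule nth_equalityI)
  show "length (permute_list (perm_of_list l) ys) = length (map ((!) ys) l)" using assms by simp
  fix i assume "i < length (permute_list (perm_of_list l) ys)"
  then have i: "i < length ys" by simp
  have "permute_list (perm_of_list l) ys ! i = ys ! perm_of_list l i"
    using i unfolding permute_list_def by simp
  also have "... = ys ! (l ! i)" using i assms unfolding perm_of_list_def by simp
  finally show "permute_list (perm_of_list l) ys ! i = map ((!) ys) l ! i" using i assms by simp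
qed

lemma perm_of_list_permutes:
  assumes "mset l = mset [0..<n]"
  shows "perm_of_list l permutes {..<n}"
proof -
  have len: "length l = n"
    using mset_eq_length[OF assms] by simp
  have dist: "distinct l"
    using mset_eq_imp_distinct_iff[OF assms] by simp
  have setl: "set l = {..<n}"
    using mset_eq_setD[OF assms] by (simp add: atLeast0LessThan)
  have "bij_betw ((!) l) {..<n} {..<n}"
    by (rule bij_betw_nth[OF dist]) (simp_all only: len setl)
  then have "bij_betw (perm_of_list l) {..<n} {..<n}"
    by (rule bij_betw_cong[THEN iffD1, rotated]) (simp add: perm_of_list_def len)
  then show ?thesis
    by (rule bij_imp_permutes) (simp add: perm_of_list_def len)
qed

text \<open>Appending on the right leaves the offsets of the earlier blocks unchanged, hence the
  inductions from the right below.\<close>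

lemma blocks_snoc: "blocks (ns @ [n]) = blocks ns @ [[sum_list ns..<sum_list ns + n]]"
proof -
  have "sum_list (take i (ns @ [n])) = sum_list (take i ns)" if "i \<le> length ns" for i
    using that by simp
  then show ?thesis unfolding blocks_def by simp
qed

lemma concat_blocks: "concat (blocks ns) = [0..<sum_list ns]"
proof (induction ns rule: rev_induct)
  case Nil
  then show ?case by (simp add: blocks_def)
next
  case (snoc n ns)
  then show ?case using upt_add_eq_append[of 0 "sum_list ns" n] by (simp add: blocks_snoc)
qed

lemma length_blocks [simp]: "length (blocks ns) = length ns"
  by (simp add: blocks_def)

lemma map_length_blocks: "map length (blocks ns) = ns"
proof (induction ns rule: rev_induct)
  case Nil
  then show ?case by (simp add: blocks_def)
qed (simp add: blocks_snoc)

text \<open>Presents arbitrary lists as images of the index blocks; the two permutation identities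
  below then follow because permuting a list commutes with mapping over it.\<close>

lemma map_nth_blocks: "map (map ((!) (concat xss))) (blocks (map length xss)) = xss"
proof (induction xss rule: rev_induct)
  case Nil
  then show ?case by (simp add: blocks_def)
next
  case (snoc xs xss)
  have "(concat xss @ xs) ! i = concat xss ! i" if "b \<in> set (blocks (map length xss))" "i \<in> set b" for b i
  proof -
    have "i \<in> set (concat (blocks (map length xss)))" using that by auto
    then show ?thesis unfolding concat_blocks by (simp add: nth_append length_concat)
  qed
  then have "map (map ((!) (concat xss @ xs))) (blocks (map length xss)) =
      map (map ((!) (concat xss))) (blocks (map length xss))"
    by (intro map_cong refl)
  moreover have "map ((!) (concat xss @ xs)) [length (concat xss)..<length (concat xss) + length xs] = xs"
    by (rule nth_equalityI) (simp_all add: nth_append)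
  ultimately show ?case using snoc by (simp add: blocks_snoc length_concat)
qed

lemma mset_concat_permute_list:
  assumes "\<sigma> permutes {..<length xss}"
  shows "mset (concat (permute_list \<sigma> xss)) = mset (concat xss)"
  using mset_permute_list[OF assms] by (simp add: mset_concat flip: sum_mset_sum_list)

lemma block_perm_permutes:
  assumes "\<sigma> permutes {..<length ns}"
  shows "block_perm \<sigma> ns permutes {..<sum_list ns}"
  unfolding block_perm_def
  by (rule perm_of_list_permutes) (simp add: mset_concat_permute_list assms flip: concat_blocks)

lemma permute_list_block_perm:
  assumes "\<sigma> permutes {..<length xss}"
  shows "permute_list (block_perm \<sigma> (map length xss)) (concat xss) = concat (permute_list \<sigma> xss)"
proof -
  let ?b = "blocks (map length xss)"
  have "mset (concat (permute_list \<sigma> ?b)) = mset (concat ?b)"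
    by (rule mset_concat_permute_list) (simp add: assms)
  then have "length (concat (permute_list \<sigma> ?b)) = length (concat xss)"
    using mset_eq_length concat_blocks length_concat by (metis diff_zero length_upt)
  then have "permute_list (block_perm \<sigma> (map length xss)) (concat xss) =
      concat (map (map ((!) (concat xss))) (permute_list \<sigma> ?b))"
    unfolding block_perm_def by (simp add: permute_list_perm_of_list map_concat)
  also have "\<dots> = concat (permute_list \<sigma> (map (map ((!) (concat xss))) ?b))"
    by (subst permute_list_map) (simp_all add: assms)
  finally show ?thesis by (simp only: map_nth_blocks)
qed

lemma mset_concat_map2_permute_list:
  assumes "list_all2 (\<lambda>\<sigma> xs. \<sigma> permutes {..<length xs}) \<sigma>s xss"
  shows "mset (concat (map2 permute_list \<sigma>s xss)) = mset (concat xss)"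
  using assms by induction auto

lemma map2_permute_list_map:
  assumes "list_all2 (\<lambda>\<sigma> xs. \<sigma> permutes {..<length xs}) \<sigma>s xss"
  shows "map2 permute_list \<sigma>s (map (map f) xss) = map (map f) (map2 permute_list \<sigma>s xss)"
  using assms by induction (auto simp: permute_list_map)

lemma block_sum_perms:
  assumes "list_all2 (\<lambda>\<sigma> n. \<sigma> permutes {..<n}) \<sigma>s ns"
  shows "list_all2 (\<lambda>\<sigma> xs. \<sigma> permutes {..<length xs}) \<sigma>s (blocks ns)"
  using assms list_all2_map2[of "\<lambda>\<sigma> n. \<sigma> permutes {..<n}" \<sigma>s length "blocks ns"]
  by (simp add: map_length_blocks)

lemma block_sum_permutes:
  assumes "list_all2 (\<lambda>\<sigma> n. \<sigma> permutes {..<n}) \<sigma>s ns"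
  shows "block_sum \<sigma>s ns permutes {..<sum_list ns}"
  unfolding block_sum_def
  by (rule perm_of_list_permutes)
    (simp add: mset_concat_map2_permute_list[OF block_sum_perms[OF assms]] flip: concat_blocks)

lemma permute_list_block_sum:
  assumes "list_all2 (\<lambda>\<sigma> xs. \<sigma> permutes {..<length xs}) \<sigma>s xss"
  shows "permute_list (block_sum \<sigma>s (map length xss)) (concat xss) = concat (map2 permute_list \<sigma>s xss)"
proof -
  let ?b = "blocks (map length xss)"
  have perms: "list_all2 (\<lambda>\<sigma> xs. \<sigma> permutes {..<length xs}) \<sigma>s ?b"
    using assms by (intro block_sum_perms) (simp add: list_all2_map2)
  have "length (concat (map2 permute_list \<sigma>s ?b)) = length (concat xss)"
    using mset_concat_map2_permute_list[OF perms] mset_eq_length concat_blocks length_concat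
    by (metis diff_zero length_upt)
  then have "permute_list (block_sum \<sigma>s (map length xss)) (concat xss) =
      concat (map (map ((!) (concat xss))) (map2 permute_list \<sigma>s ?b))"
    unfolding block_sum_def by (simp add: permute_list_perm_of_list map_concat)
  also have "\<dots> = concat (map2 permute_list \<sigma>s (map (map ((!) (concat xss))) ?b))"
    by (simp only: map2_permute_list_map[OF perms])
  finally show ?thesis by (simp only: map_nth_blocks)
qed

lemma list_all2_choice:
  assumes "list_all2 (\<lambda>x y. \<exists>z. R x y z) xs ys"
  obtains zs where "length zs = length xs" "list_all2 (\<lambda>x (y, z). R x y z) xs (zip ys zs)"
proof -
  have "\<exists>zs. length zs = length xs \<and> list_all2 (\<lambda>x (y, z). R x y z) xs (zip ys zs)"
    using assms
  proof induction
    case (Cons x xs y ys)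
    then obtain z zs where "R x y z" "length zs = length xs"
      "list_all2 (\<lambda>x (y, z). R x y z) xs (zip ys zs)" by blast
    then show ?case by (intro exI[of _ "z # zs"]) simp
  qed simp
  with that show ?thesis by blast
qed

text \<open>The labels have arbitrary type: edges are used for objects, pairs of edges for label
  changes.\<close>

definition decorated :: "'s substitude_data \<Rightarrow> 's \<times> 'e list \<Rightarrow> bool" where
  "decorated P x \<longleftrightarrow> fst x \<in> Ops P \<and> length (snd x) = length (Src P (fst x))"

text \<open>Reordering of inputs, the relation under which operations become corollas. It is an
  equivalence on decorated operations.\<close>

definition perm_equiv :: "'s substitude_data \<Rightarrow> 's \<times> 'e list \<Rightarrow> 's \<times> 'e list \<Rightarrow> bool" where
  "perm_equiv P x y \<longleftrightarrow>
     (\<exists>\<sigma>. arity_perm P (fst x) \<sigma> \<and> y = (Sym P (fst x) \<sigma>, permute_list \<sigma> (snd x)))"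

text \<open>Substitution together with concatenation of labels: the action of \<open>P\<close> on
  the free algebra before passing to classes.\<close>

definition graft :: "'s substitude_data \<Rightarrow> 's \<Rightarrow> ('s \<times> 'e list) list \<Rightarrow> 's \<times> 'e list" where
  "graft P p xs = (Sub P p (map fst xs), concat (map snd xs))"

definition graftable :: "'s substitude_data \<Rightarrow> 's \<Rightarrow> ('s \<times> 'e list) list \<Rightarrow> bool" where
  "graftable P p xs \<longleftrightarrow> p \<in> Ops P \<and> (\<forall>x\<in>set xs. decorated P x) \<and> map (Tgt P \<circ> fst) xs = Src P p"

context substitude
begin

lemma operations_simps:
  assumes "q \<in> operations P as a"
  shows "q \<in> Ops P" "Src P q = as" "Tgt P q = a"
  using assms by (simp_all add: operations_def)

lemmas Unt_simps = operations_simps[OF Unt_Ops]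
lemmas Sub_simps = operations_simps[OF Sub_Ops]
lemmas Sym_simps = operations_simps[OF Sym_Ops]
lemmas Eta_simps = operations_simps[OF Eta_Ops]

lemma Src_nth_Obj: "p \<in> Ops P \<Longrightarrow> a \<in> set (Src P p) \<Longrightarrow> a \<in> Obj (Col P)"
  using Src_Obj by blast

lemma graftable_substitutable: "graftable P p xs \<Longrightarrow> substitutable P p (map fst xs)"
  by (auto simp: graftable_def substitutable_def decorated_def)

lemma graftable_lengths: "graftable P p xs \<Longrightarrow> map length (map snd xs) = map (length \<circ> Src P) (map fst xs)"
  by (auto simp: graftable_def decorated_def)

lemma decorated_graft:
  assumes "graftable P p xs"
  shows "decorated P (graft P p xs)" "Tgt P (fst (graft P p xs)) = Tgt P p"
proof -
  have "length (concat (map snd xs)) = length (concat (map (Src P) (map fst xs)))"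
    unfolding length_concat using graftable_lengths[OF assms] by (metis map_map)
  then show "decorated P (graft P p xs)" "Tgt P (fst (graft P p xs)) = Tgt P p"
    using Sub_simps[OF graftable_substitutable[OF assms]] by (auto simp: decorated_def graft_def)
qed

lemma perm_equiv_decorated:
  assumes "decorated P x" "perm_equiv P x y"
  shows "decorated P y" "Tgt P (fst y) = Tgt P (fst x)" "mset (snd y) = mset (snd x)"
  using assms Sym_simps by (auto simp: decorated_def perm_equiv_def arity_perm_def)

lemma perm_equiv_refl: "decorated P x \<Longrightarrow> perm_equiv P x x"
  unfolding perm_equiv_def
  by (rule exI[of _ id]) (auto simp: decorated_def arity_perm_def permutes_id Sym_id)

lemma perm_equiv_sym:
  assumes "decorated P x" "perm_equiv P x y"
  shows "perm_equiv P y x"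
proof -
  obtain p es where x: "x = (p, es)" by (cases x)
  obtain \<sigma> where \<sigma>: "arity_perm P p \<sigma>" "y = (Sym P p \<sigma>, permute_list \<sigma> es)"
    using assms(2) x by (auto simp: perm_equiv_def)
  have p: "p \<in> Ops P" "length es = length (Src P p)" using assms(1) x by (auto simp: decorated_def)
  have perm: "\<sigma> permutes {..<length es}" "\<sigma> permutes {..<length (Src P p)}"
    using \<sigma> p by (auto simp: arity_perm_def)
  have inv: "\<sigma> \<circ> inv \<sigma> = id" "inv \<sigma> permutes {..<length (Src P p)}"
    using permutes_inv_o[OF perm(1)] permutes_inv[OF perm(2)] by auto
  have "Sym P (Sym P p \<sigma>) (inv \<sigma>) = p"
    using Sym_comp[OF p(1) \<sigma>(1), of "inv \<sigma>"] inv Sym_id[OF p(1)] by (simp add: arity_perm_def)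
  moreover have "permute_list (inv \<sigma>) (permute_list \<sigma> es) = es"
    using permute_list_compose[of "inv \<sigma>" es \<sigma>] inv p by simp
  moreover have "arity_perm P (Sym P p \<sigma>) (inv \<sigma>)"
    using inv(2) Sym_simps(2)[OF p(1) \<sigma>(1)] by (simp add: arity_perm_def)
  ultimately show ?thesis
    using x \<sigma>(2) by (auto simp: perm_equiv_def intro!: exI[of _ "inv \<sigma>"])
qed

lemma perm_equiv_trans:
  assumes "decorated P x" "perm_equiv P x y" "perm_equiv P y z"
  shows "perm_equiv P x z"
proof -
  obtain p es where x: "x = (p, es)" by (cases x)
  obtain \<sigma> where \<sigma>: "arity_perm P p \<sigma>" "y = (Sym P p \<sigma>, permute_list \<sigma> es)"
    using assms(2) x by (auto simp: perm_equiv_def)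
  have p: "p \<in> Ops P" "length es = length (Src P p)" using assms(1) x by (auto simp: decorated_def)
  obtain \<tau> where \<tau>: "arity_perm P (Sym P p \<sigma>) \<tau>"
    "z = (Sym P (Sym P p \<sigma>) \<tau>, permute_list \<tau> (permute_list \<sigma> es))"
    using assms(3) \<sigma> by (auto simp: perm_equiv_def)
  have \<tau>': "arity_perm P p \<tau>" "\<tau> permutes {..<length es}"
    using \<tau>(1) Sym_simps(2)[OF p(1) \<sigma>(1)] p by (auto simp: arity_perm_def)
  have "z = (Sym P p (\<sigma> \<circ> \<tau>), permute_list (\<sigma> \<circ> \<tau>) es)"
    using \<tau> Sym_comp[OF p(1) \<sigma>(1) \<tau>'(1)] permute_list_compose[OF \<tau>'(2)] by simp
  moreover have "arity_perm P p (\<sigma> \<circ> \<tau>)"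
    using \<sigma>(1) \<tau>'(1) by (simp add: arity_perm_def permutes_compose)
  ultimately show ?thesis using x by (auto simp: perm_equiv_def)
qed

text \<open>\<open>Sub_Sym_outer\<close> turns \<open>\<sigma>\<close> into a block permutation, and
  the same block permutation reorders the concatenated labels. This yields equivariance of the
  action on the free algebra.\<close>

lemma perm_equiv_graft_outer:
  assumes "graftable P p xs" "arity_perm P p \<sigma>"
  shows "perm_equiv P (graft P p xs) (graft P (Sym P p \<sigma>) (permute_list \<sigma> xs))"
    "graftable P (Sym P p \<sigma>) (permute_list \<sigma> xs)"
proof -
  note sub = graftable_substitutable[OF assms(1)] and len = graftable_lengths[OF assms(1)]
  have p: "p \<in> Ops P" "map (Tgt P \<circ> fst) xs = Src P p" using assms(1) by (simp_all add: graftable_def)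
  have lx: "length xs = length (Src P p)" using p(2) by (metis length_map)
  then have perm: "\<sigma> permutes {..<length xs}" using assms(2) by (simp add: arity_perm_def)
  let ?\<tau> = "block_perm \<sigma> (map (length \<circ> Src P) (map fst xs))"
  have "?\<tau> permutes {..<sum_list (map (length \<circ> Src P) (map fst xs))}"
    by (rule block_perm_permutes) (simp add: perm)
  then have "arity_perm P (Sub P p (map fst xs)) ?\<tau>"
    using Sub_simps(2)[OF sub] by (simp add: arity_perm_def length_concat comp_def)
  moreover have "permute_list ?\<tau> (concat (map snd xs)) = concat (map snd (permute_list \<sigma> xs))"
    using permute_list_block_perm[of \<sigma> "map snd xs"] perm unfolding len
    by (simp add: permute_list_map)
  moreover have "Sub P (Sym P p \<sigma>) (map fst (permute_list \<sigma> xs)) = Sym P (Sub P p (map fst xs)) ?\<tau>"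
    using Sub_Sym_outer[OF sub assms(2)] perm by (simp add: permute_list_map)
  ultimately show "perm_equiv P (graft P p xs) (graft P (Sym P p \<sigma>) (permute_list \<sigma> xs))"
    by (auto simp: perm_equiv_def graft_def intro!: exI[of _ ?\<tau>])
  show "graftable P (Sym P p \<sigma>) (permute_list \<sigma> xs)"
    using assms(1) Sym_simps[OF p(1) assms(2)] perm
    by (auto simp: graftable_def simp flip: permute_list_map)
qed

text \<open>The reorderings of the single inputs add up to a block sum. This makes grafting well
  defined on classes.\<close>

lemma perm_equiv_graft_inner:
  assumes "graftable P p xs" "list_all2 (perm_equiv P) xs ys"
  shows "perm_equiv P (graft P p xs) (graft P p ys)" "graftable P p ys"
proof -
  note sub = graftable_substitutable[OF assms(1)] and len = graftable_lengths[OF assms(1)]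
  obtain \<sigma>s where \<sigma>s: "length \<sigma>s = length xs" "list_all2 (\<lambda>x (y, \<sigma>). arity_perm P (fst x) \<sigma> \<and>
      y = (Sym P (fst x) \<sigma>, permute_list \<sigma> (snd x))) xs (zip ys \<sigma>s)"
    using list_all2_choice[OF assms(2)[unfolded perm_equiv_def[abs_def]]] by blast
  have ys: "map fst ys = map2 (Sym P) (map fst xs) \<sigma>s" "map snd ys = map2 permute_list \<sigma>s (map snd xs)"
    and ar: "list_all2 (arity_perm P) (map fst xs) \<sigma>s"
    using \<sigma>s list_all2_lengthD[OF assms(2)]
    by (auto simp: list_all2_conv_all_nth list_eq_iff_nth_eq)
  have perms: "list_all2 (\<lambda>\<sigma> es. \<sigma> permutes {..<length es}) \<sigma>s (map snd xs)"
    using ar assms(1) by (auto simp: list_all2_conv_all_nth arity_perm_def graftable_def decorated_def)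
  let ?\<tau> = "block_sum \<sigma>s (map (length \<circ> Src P) (map fst xs))"
  have "list_all2 (\<lambda>\<sigma> n. \<sigma> permutes {..<n}) \<sigma>s (map length (map snd xs))"
    using perms by (simp add: list_all2_map2)
  then have "?\<tau> permutes {..<sum_list (map (length \<circ> Src P) (map fst xs))}"
    unfolding len by (rule block_sum_permutes)
  then have "arity_perm P (Sub P p (map fst xs)) ?\<tau>"
    using Sub_simps(2)[OF sub] by (simp add: arity_perm_def length_concat comp_def)
  moreover have "permute_list ?\<tau> (concat (map snd xs)) = concat (map snd ys)"
    using permute_list_block_sum[OF perms] ys unfolding len by simp
  moreover have "Sub P p (map fst ys) = Sym P (Sub P p (map fst xs)) ?\<tau>"
    using Sub_Sym_inner[OF sub ar] ys by simp
  ultimately show "perm_equiv P (graft P p xs) (graft P p ys)"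
    by (auto simp: perm_equiv_def graft_def intro!: exI[of _ ?\<tau>])
  have "map (Tgt P \<circ> fst) ys = map (Tgt P \<circ> fst) xs" "\<forall>y\<in>set ys. decorated P y"
  proof -
    have "\<forall>x\<in>set xs. decorated P x" using assms(1) by (simp add: graftable_def)
    with assms(2) show "map (Tgt P \<circ> fst) ys = map (Tgt P \<circ> fst) xs" "\<forall>y\<in>set ys. decorated P y"
      by (induction, use perm_equiv_decorated in \<open>fastforce+\<close>)
  qed
  then show "graftable P p ys" using assms(1) by (simp add: graftable_def)
qed

text \<open>\<open>gs\<close> is the middle level of a tree of three levels, each entry being an
  operation with what is grafted onto it. The identity is \<open>Sub_assoc\<close> on operations and
  associativity of concatenation on labels.\<close>

lemma graft_graft:
  assumes "p \<in> Ops P" "map (Tgt P \<circ> fst) gs = Src P p"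
    and "\<And>g. g \<in> set gs \<Longrightarrow> graftable P (fst g) (snd g)"
  shows "graft P (Sub P p (map fst gs)) (concat (map snd gs)) = graft P p (map (\<lambda>g. graft P (fst g) (snd g)) gs)"
    "graftable P p (map (\<lambda>g. graft P (fst g) (snd g)) gs)"
    "graftable P (Sub P p (map fst gs)) (concat (map snd gs))"
proof -
  have sub: "substitutable P p (map fst gs)"
    using assms by (auto simp: substitutable_def graftable_def)
  have "list_all2 (substitutable P) (map fst gs) (map (\<lambda>g. map fst (snd g)) gs)"
    by (simp add: list_all2_conv_all_nth graftable_substitutable assms(3))
  with sub have "Sub P (Sub P p (map fst gs)) (concat (map (\<lambda>g. map fst (snd g)) gs)) =
      Sub P p (map2 (Sub P) (map fst gs) (map (\<lambda>g. map fst (snd g)) gs))"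
    by (rule Sub_assoc)
  moreover have "map2 (Sub P) (map fst gs) (map (\<lambda>g. map fst (snd g)) gs) =
      map (\<lambda>g. Sub P (fst g) (map fst (snd g))) gs"
    by (simp add: list_eq_iff_nth_eq)
  moreover have "concat (map snd (concat (map snd gs))) = concat (map (\<lambda>g. concat (map snd (snd g))) gs)"
    by (induction gs) auto
  ultimately show "graft P (Sub P p (map fst gs)) (concat (map snd gs)) = graft P p (map (\<lambda>g. graft P (fst g) (snd g)) gs)"
    by (simp add: graft_def comp_def map_concat)
  have "map (Tgt P \<circ> fst) (map (\<lambda>g. graft P (fst g) (snd g)) gs) = map (Tgt P \<circ> fst) gs"
    by (simp add: decorated_graft(2)[OF assms(3)])
  moreover have "\<forall>x\<in>set (map (\<lambda>g. graft P (fst g) (snd g)) gs). decorated P x"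
    by (simp add: decorated_graft(1)[OF assms(3)])
  ultimately show "graftable P p (map (\<lambda>g. graft P (fst g) (snd g)) gs)"
    using assms(1,2) unfolding graftable_def by metis
  have "map (Tgt P \<circ> fst) (concat (map snd gs)) = concat (map (Src P) (map fst gs))"
    unfolding map_concat map_map
    by (rule arg_cong[where f = concat]) (use assms(3) in \<open>simp add: graftable_def\<close>)
  moreover have "\<forall>x\<in>set (concat (map snd gs)). decorated P x"
    using assms(3) by (fastforce simp: graftable_def)
  ultimately show "graftable P (Sub P p (map fst gs)) (concat (map snd gs))"
    using Sub_simps[OF sub] by (simp add: graftable_def)
qed

end

section \<open>The free algebra with indiscrete components\<close>

lemma inputs_cat_simps:
  "xs \<in> Obj (inputs_cat P C p) \<longleftrightarrow> list_all2 (\<lambda>x a. x \<in> Obj (Cmpt C a)) xs (Src P p)"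
  "fs \<in> Arr (inputs_cat P C p) \<longleftrightarrow> list_all2 (\<lambda>f a. f \<in> Arr (Cmpt C a)) fs (Src P p)"
  "Dom (inputs_cat P C p) fs = map2 (\<lambda>a. Dom (Cmpt C a)) (Src P p) fs"
  "Cod (inputs_cat P C p) fs = map2 (\<lambda>a. Cod (Cmpt C a)) (Src P p) fs"
  "Idn (inputs_cat P C p) xs = map2 (\<lambda>a. Idn (Cmpt C a)) (Src P p) xs"
  "Cmp (inputs_cat P C p) gs fs = map2 (\<lambda>a (g, f). Cmp (Cmpt C a) g f) (Src P p) (zip gs fs)"
  by (simp_all add: inputs_cat_def list_cat_def list_all2_map2 zip_map1 case_prod_beta comp_def)

lemma list_all2_representatives:
  assumes "list_all2 (\<lambda>x a. \<exists>y. Q y \<and> t y = a \<and> x = g y) xs as"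
  shows "\<exists>ys. (\<forall>y\<in>set ys. Q y) \<and> map t ys = as \<and> xs = map g ys"
  using assms
proof (induction rule: list_all2_induct)
  case (Cons x xs a as)
  then obtain y ys where "Q y" "t y = a" "x = g y" "\<forall>y\<in>set ys. Q y" "map t ys = as" "xs = map g ys"
    by blast
  then show ?case by (intro exI[of _ "y # ys"]) simp
qed simp

text \<open>An arrow has to be a single element of the universe, so the unique arrow between two
  objects is the code of its pair of ends.\<close>

definition indiscrete :: "('s \<times> 's \<Rightarrow> 's) \<Rightarrow> 's set \<Rightarrow> ('s, 's) cat" where
  "indiscrete pr S = \<lparr>Obj = S, Arr = pr ` (S \<times> S), Dom = (\<lambda>f. fst (inv pr f)), Cod = (\<lambda>f. snd (inv pr f)),
     Idn = (\<lambda>x. pr (x, x)), Cmp = (\<lambda>g f. pr (fst (inv pr f), snd (inv pr g)))\<rparr>"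

lemma indiscrete_simps [simp]:
  assumes "inj pr"
  shows "Obj (indiscrete pr S) = S" "Arr (indiscrete pr S) = pr ` (S \<times> S)"
    "Dom (indiscrete pr S) (pr (x, y)) = x" "Cod (indiscrete pr S) (pr (x, y)) = y"
    "Idn (indiscrete pr S) x = pr (x, x)" "Cmp (indiscrete pr S) (pr (y', z)) (pr (x, y)) = pr (x, z)"
  using assms by (simp_all add: indiscrete_def)

lemma Hom_indiscrete:
  assumes "inj pr"
  shows "Hom (indiscrete pr S) x y = (if x \<in> S \<and> y \<in> S then {pr (x, y)} else {})"
  using assms by (auto simp: Hom_def)

lemma category_indiscrete:
  assumes "inj pr"
  shows "category (indiscrete pr S)"
  by unfold_locales (auto simp: assms Hom_indiscrete split: if_splits)

lemma is_A_map_cong: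
  assumes "is_A_map Q E Z act Z' act' h" "\<And>u. u \<in> Arr (Col Q) \<Longrightarrow> act u = act2 u"
    "\<And>u. u \<in> Arr (Col Q) \<Longrightarrow> act' u = act2' u"
  shows "is_A_map Q E Z act2 Z' act2' h"
  using assms unfolding is_A_map_def by (simp add: Hom_def)

text \<open>Every choice of objects underlies an internal algebra in an algebra with indiscrete components,
  so the free such algebra detects when two decorated corollas are equal in the classifier.\<close>

definition canonical :: "'s substitude_data \<Rightarrow> 's \<times> 'e list \<Rightarrow> 's \<times> 'e list" where
  "canonical P x = (SOME y. perm_equiv P x y)"

text \<open>Equivalence classes would be sets; chosen representatives are again decorated operations
  and can be encoded as elements of the universe.\<close>

definition free_objects :: "('s \<times> 'e list \<Rightarrow> 's) \<Rightarrow> 's substitude_data \<Rightarrow> 's \<Rightarrow> 's set" where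
  "free_objects enc P a = {enc (canonical P x) | x. decorated P x \<and> Tgt P (fst x) = a}"

definition free_act :: "('s \<times> 'e list \<Rightarrow> 's) \<Rightarrow> 's substitude_data \<Rightarrow> 's \<Rightarrow> 's list \<Rightarrow> 's" where
  "free_act enc P p xs = enc (canonical P (graft P p (map (inv enc) xs)))"

definition free_alg :: "('s \<times> 'e list \<Rightarrow> 's) \<Rightarrow> ('s \<times> 's \<Rightarrow> 's) \<Rightarrow> 's substitude_data \<Rightarrow> 's cat_alg" where
  "free_alg enc pr P = \<lparr>Cmpt = (\<lambda>a. indiscrete pr (free_objects enc P a)),
     Act = (\<lambda>p. \<lparr>FOb = free_act enc P p,
       FAr = (\<lambda>fs. pr (free_act enc P p (map (fst \<circ> inv pr) fs), free_act enc P p (map (snd \<circ> inv pr) fs)))\<rparr>)\<rparr>"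

context substitude
begin

lemma canonical:
  assumes "decorated P x"
  shows "perm_equiv P x (canonical P x)" "decorated P (canonical P x)"
    "Tgt P (fst (canonical P x)) = Tgt P (fst x)"
proof -
  show eq: "perm_equiv P x (canonical P x)"
    unfolding canonical_def by (rule someI[of _ x]) (rule perm_equiv_refl[OF assms])
  show "decorated P (canonical P x)" "Tgt P (fst (canonical P x)) = Tgt P (fst x)"
    using perm_equiv_decorated[OF assms eq] by auto
qed

lemma canonical_cong:
  assumes "decorated P x" "perm_equiv P x y"
  shows "canonical P x = canonical P y"
proof -
  have "perm_equiv P x z \<longleftrightarrow> perm_equiv P y z" for z
    using assms perm_equiv_trans perm_equiv_sym perm_equiv_decorated(1) by metis
  then show ?thesis by (simp add: canonical_def)
qed

lemma canonical_eqD: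
  assumes "decorated P x" "decorated P y" "canonical P x = canonical P y"
  shows "perm_equiv P x y"
  using canonical[OF assms(1)] canonical[OF assms(2)] perm_equiv_sym[OF assms(2)] assms(3)
    perm_equiv_trans[OF assms(1)] by metis

lemma decorated_generator: "a \<in> Obj (Col P) \<Longrightarrow> decorated P (Unt P a, [e])"
  by (simp add: decorated_def Unt_simps)

text \<open>Grafting respects reordering in each input, so the inputs may be replaced by their
  representatives.\<close>

lemma graft_canonical:
  assumes "graftable P p xs"
  shows "canonical P (graft P p (map (canonical P) xs)) = canonical P (graft P p xs)"
    "graftable P p (map (canonical P) xs)"
proof -
  have "list_all2 (perm_equiv P) xs (map (canonical P) xs)"
    using assms by (simp add: graftable_def list_all2_conv_all_nth canonical(1))
  from perm_equiv_graft_inner[OF assms this] canonical_cong[OF decorated_graft(1)[OF assms]]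
  show "canonical P (graft P p (map (canonical P) xs)) = canonical P (graft P p xs)"
    "graftable P p (map (canonical P) xs)" by auto
qed

end

locale free_algebra = substitude P
  for P :: "'s substitude_data" +
  fixes enc :: "'s \<times> 'e list \<Rightarrow> 's" and pr :: "'s \<times> 's \<Rightarrow> 's"
  assumes inj_enc: "inj enc" and inj_pr: "inj pr"
begin

abbreviation "Ob \<equiv> free_objects enc P"
abbreviation "inputs \<equiv> list_all2 (\<lambda>x a. x \<in> Ob a)"
abbreviation "arrow_inputs \<equiv> list_all2 (\<lambda>f a. f \<in> pr ` (Ob a \<times> Ob a))"
abbreviation "act \<equiv> free_act enc P"
abbreviation "D \<equiv> free_alg enc pr P"

lemma inv_enc [simp]: "inv enc (enc x) = x"
  by (simp add: inj_enc)

lemma inv_pr [simp]: "inv pr (pr x) = x"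
  by (simp add: inj_pr)

lemma free_alg_simps [simp]:
  "Cmpt D a = indiscrete pr (Ob a)" "FOb (Act D p) = act p"
  "FAr (Act D p) fs = pr (act p (map (fst \<circ> inv pr) fs), act p (map (snd \<circ> inv pr) fs))"
  by (simp_all add: free_alg_def)

lemma inputs_objects:
  assumes "p \<in> Ops P" "inputs xs (Src P p)"
  obtains ys where "graftable P p ys" "xs = map (\<lambda>y. enc (canonical P y)) ys"
proof -
  have "list_all2 (\<lambda>x a. \<exists>y. decorated P y \<and> (Tgt P \<circ> fst) y = a \<and> x = enc (canonical P y)) xs (Src P p)"
    using assms(2) by (rule list_all2_mono) (auto simp: free_objects_def)
  from list_all2_representatives[OF this] that assms(1) show ?thesis
    unfolding graftable_def by blast
qed

text \<open>The rule by which the laws of the action are reduced to properties of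
  \<open>graft\<close>.\<close>

lemma act_canonical:
  assumes "graftable P p ys"
  shows "act p (map (\<lambda>y. enc (canonical P y)) ys) = enc (canonical P (graft P p ys))"
proof -
  show ?thesis using graft_canonical(1)[OF assms] by (simp add: free_act_def comp_def)
qed

lemma act_closed:
  assumes "p \<in> Ops P" "inputs xs (Src P p)"
  shows "act p xs \<in> Ob (Tgt P p)"
proof -
  obtain ys where ys: "graftable P p ys" "xs = map (\<lambda>y. enc (canonical P y)) ys"
    using inputs_objects[OF assms] .
  then show ?thesis unfolding free_objects_def using act_canonical decorated_graft by blast
qed

lemma act_Unt:
  assumes "a \<in> Obj (Col P)" "x \<in> Ob a"
  shows "act (Unt P a) [x] = x"
proof -
  obtain y where y: "x = enc (canonical P y)" "decorated P y" "Tgt P (fst y) = a"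
    using assms(2) by (auto simp: free_objects_def)
  have "graftable P (Unt P a) [y]"
    using y Unt_simps[OF assms(1)] by (simp add: graftable_def)
  from act_canonical[OF this] y Sub_Unt_left[of "fst y"]
  show ?thesis by (simp add: graft_def decorated_def)
qed

lemma inputs_objects_list:
  assumes "list_all2 (\<lambda>xs q. inputs xs (Src P q)) xss qs" "set qs \<subseteq> Ops P"
  shows "\<exists>gs. map fst gs = qs \<and> xss = map (\<lambda>g. map (\<lambda>y. enc (canonical P y)) (snd g)) gs \<and>
    (\<forall>g\<in>set gs. graftable P (fst g) (snd g))"
  using assms
proof (induction rule: list_all2_induct)
  case (Cons xs xss q qs)
  obtain ys where "graftable P q ys" "xs = map (\<lambda>y. enc (canonical P y)) ys"
    using inputs_objects[of q xs] Cons.hyps Cons.prems by auto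
  moreover obtain gs where "map fst gs = qs" "xss = map (\<lambda>g. map (\<lambda>y. enc (canonical P y)) (snd g)) gs"
    "\<forall>g\<in>set gs. graftable P (fst g) (snd g)"
    using Cons by auto
  ultimately show ?case by (intro exI[of _ "(q, ys) # gs"]) auto
qed simp

lemma act_Sub:
  assumes "substitutable P p qs" "list_all2 (\<lambda>xs q. inputs xs (Src P q)) xss qs"
  shows "act (Sub P p qs) (concat xss) = act p (map2 act qs xss)"
proof -
  let ?e = "\<lambda>y. enc (canonical P y)"
  have p: "p \<in> Ops P" "set qs \<subseteq> Ops P" "map (Tgt P) qs = Src P p"
    using assms(1) by (auto simp: substitutable_def)
  obtain gs where gs: "map fst gs = qs" "xss = map (\<lambda>g. map ?e (snd g)) gs"
    "\<And>g. g \<in> set gs \<Longrightarrow> graftable P (fst g) (snd g)"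
    using inputs_objects_list[OF assms(2) p(2)] by blast
  have tgt: "map (Tgt P \<circ> fst) gs = Src P p" using p(3) gs(1) by (metis map_map)
  note graft_graft[OF p(1) tgt gs(3)]
  note G = this[unfolded gs(1)]
  have "concat xss = map ?e (concat (map snd gs))"
    unfolding gs(2) map_concat map_map by (simp add: comp_def)
  then have "act (Sub P p qs) (concat xss) = ?e (graft P (Sub P p qs) (concat (map snd gs)))"
    using act_canonical[OF G(3)] by simp
  also have "\<dots> = ?e (graft P p (map (\<lambda>g. graft P (fst g) (snd g)) gs))"
    using G(1) by simp
  also have "\<dots> = act p (map (\<lambda>g. ?e (graft P (fst g) (snd g))) gs)"
    using act_canonical[OF G(2)] by (simp add: comp_def)
  also have "map (\<lambda>g. ?e (graft P (fst g) (snd g))) gs = map2 act qs xss"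
  proof -
    have "map2 act qs xss = map (\<lambda>g. act (fst g) (map ?e (snd g))) gs"
      unfolding gs(2) by (subst gs(1)[symmetric]) (rule nth_equalityI, simp_all)
    also have "\<dots> = map (\<lambda>g. ?e (graft P (fst g) (snd g))) gs"
      by (rule map_cong[OF refl]) (rule act_canonical[OF gs(3)])
    finally show ?thesis by simp
  qed
  finally show ?thesis .
qed

lemma act_Sym:
  assumes "arity_perm P p \<sigma>" "p \<in> Ops P" "inputs xs (Src P p)"
  shows "act (Sym P p \<sigma>) (permute_list \<sigma> xs) = act p xs"
proof -
  let ?e = "\<lambda>y. enc (canonical P y)"
  obtain ys where ys: "graftable P p ys" "xs = map ?e ys"
    using inputs_objects[OF assms(2,3)] .
  have "length ys = length (Src P p)" using ys(1) unfolding graftable_def by (metis length_map)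
  then have perm: "\<sigma> permutes {..<length ys}" using assms(1) by (simp add: arity_perm_def)
  note outer = perm_equiv_graft_outer[OF ys(1) assms(1)]
  have "act (Sym P p \<sigma>) (permute_list \<sigma> xs) = ?e (graft P (Sym P p \<sigma>) (permute_list \<sigma> ys))"
    using act_canonical[OF outer(2)] ys(2) by (simp add: permute_list_map[OF perm])
  also have "\<dots> = ?e (graft P p ys)"
    using canonical_cong[OF decorated_graft(1)[OF ys(1)] outer(1)] by simp
  finally show ?thesis using act_canonical[OF ys(1)] ys(2) by simp
qed

lemma inputs_arrows:
  assumes "arrow_inputs fs as"
  shows "inputs (map (fst \<circ> inv pr) fs) as"
    "inputs (map (snd \<circ> inv pr) fs) as"
  unfolding list_all2_map1 using assms by (auto elim!: list_all2_mono)

lemma indiscrete_sel: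
  "Obj (indiscrete pr S) = S" "Arr (indiscrete pr S) = pr ` (S \<times> S)"
  "Dom (indiscrete pr S) f = fst (inv pr f)" "Cod (indiscrete pr S) f = snd (inv pr f)"
  "Idn (indiscrete pr S) x = pr (x, x)"
  "Cmp (indiscrete pr S) g f = pr (fst (inv pr f), snd (inv pr g))"
  by (simp_all add: indiscrete_def)

text \<open>An arrow is the pair of its ends, so each law for arrows is the law for objects applied
  to both projections.\<close>

lemma categorical_free_alg: "categorical_algebra P D"
proof (rule categorical_algebra.intro)
  fix p assume p: "p \<in> Ops P"
  have map2_const: "map2 (\<lambda>a. h) as xs = map h xs" if "length as = length xs"
    for h :: "'x \<Rightarrow> 'y" and as :: "'s list" and xs
    using that by (induction as xs rule: list_induct2) auto
  show "is_functor (inputs_cat P D p) (Cmpt D (Tgt P p)) (Act D p)"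
    unfolding is_functor_def inputs_cat_simps free_alg_simps indiscrete_sel
  proof (intro conjI ballI impI)
    fix xs assume "xs \<in> Obj (inputs_cat P D p)"
    then have xs: "inputs xs (Src P p)"
      by (simp add: inputs_cat_simps indiscrete_sel)
    then show "act p xs \<in> Ob (Tgt P p)" by (rule act_closed[OF p])
    show "pr (act p (map (fst \<circ> inv pr) (map2 (\<lambda>a x. pr (x, x)) (Src P p) xs)),
        act p (map (snd \<circ> inv pr) (map2 (\<lambda>a x. pr (x, x)) (Src P p) xs))) = pr (act p xs, act p xs)"
      using list_all2_lengthD[OF xs] by (simp add: map2_const comp_def)
  next
    fix fs assume "fs \<in> Arr (inputs_cat P D p)"
    then have fs: "arrow_inputs fs (Src P p)"
      by (simp add: inputs_cat_simps indiscrete_sel)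
    show "pr (act p (map (fst \<circ> inv pr) fs), act p (map (snd \<circ> inv pr) fs)) \<in>
      Hom (indiscrete pr (Ob (Tgt P p))) (act p (map2 (\<lambda>a f. fst (inv pr f)) (Src P p) fs))
        (act p (map2 (\<lambda>a f. snd (inv pr f)) (Src P p) fs))"
      using list_all2_lengthD[OF fs] inputs_arrows[OF fs, THEN act_closed[OF p]]
      by (simp add: Hom_indiscrete[OF inj_pr] map2_const comp_def)
    fix gs assume "gs \<in> Arr (inputs_cat P D p)"
    then have "length gs = length (Src P p)" "length fs = length (Src P p)"
      using fs by (auto simp: inputs_cat_simps dest: list_all2_lengthD)
    then show "pr (act p (map (fst \<circ> inv pr) (map2 (\<lambda>a (g, f). pr (fst (inv pr f), snd (inv pr g))) (Src P p) (zip gs fs))),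
        act p (map (snd \<circ> inv pr) (map2 (\<lambda>a (g, f). pr (fst (inv pr f), snd (inv pr g))) (Src P p) (zip gs fs)))) =
      pr (fst (inv pr (pr (act p (map (fst \<circ> inv pr) fs), act p (map (snd \<circ> inv pr) fs)))),
        snd (inv pr (pr (act p (map (fst \<circ> inv pr) gs), act p (map (snd \<circ> inv pr) gs)))))"
      by (auto intro!: arg_cong[where f = pr] arg_cong[where f = "act p"] nth_equalityI)
  qed
next
  fix p qs and xss :: "'s list list"
  assume pq: "substitutable P p qs"
    and "list_all2 (\<lambda>xs q. xs \<in> Obj (inputs_cat P D q)) xss qs"
  then show "FOb (Act D (Sub P p qs)) (concat xss) = FOb (Act D p) (map2 (\<lambda>q. FOb (Act D q)) qs xss)"
    using act_Sub[OF pq] by (simp add: inputs_cat_simps indiscrete_sel)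
next
  fix p qs and fss :: "'s list list"
  assume pq: "substitutable P p qs"
    and "list_all2 (\<lambda>fs q. fs \<in> Arr (inputs_cat P D q)) fss qs"
  then have fss: "list_all2 (\<lambda>fs q. arrow_inputs fs (Src P q)) fss qs"
    by (simp add: inputs_cat_simps indiscrete_sel)
  have "list_all2 (\<lambda>xs q. inputs xs (Src P q)) (map (map h) fss) qs"
    if "h = fst \<circ> inv pr \<or> h = snd \<circ> inv pr" for h
    unfolding list_all2_map1 using fss that inputs_arrows by (auto elim!: list_all2_mono simp: list_all2_map1)
  from act_Sub[OF pq this]
  show "FAr (Act D (Sub P p qs)) (concat fss) = FAr (Act D p) (map2 (\<lambda>q. FAr (Act D q)) qs fss)"
    by (simp add: map_concat zip_map2 case_prod_beta comp_def)
next
  fix a x assume "a \<in> Obj (Col P)" "x \<in> Obj (Cmpt D a)"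
  then show "FOb (Act D (Unt P a)) [x] = x" by (simp add: indiscrete_sel act_Unt)
next
  fix a f assume "a \<in> Obj (Col P)" "f \<in> Arr (Cmpt D a)"
  then show "FAr (Act D (Unt P a)) [f] = f" by (auto simp: indiscrete_sel act_Unt)
next
  fix p \<sigma> and xs :: "'s list"
  assume p: "p \<in> Ops P" "arity_perm P p \<sigma>" and "xs \<in> Obj (inputs_cat P D p)"
  then show "FOb (Act D (Sym P p \<sigma>)) (permute_list \<sigma> xs) = FOb (Act D p) xs"
    using act_Sym by (simp add: inputs_cat_simps indiscrete_sel)
next
  fix p \<sigma> and fs :: "'s list"
  assume p: "p \<in> Ops P" "arity_perm P p \<sigma>" and "fs \<in> Arr (inputs_cat P D p)"
  then have fs: "arrow_inputs fs (Src P p)"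
    by (simp add: inputs_cat_simps indiscrete_sel)
  then have "\<sigma> permutes {..<length fs}"
    using p(2) by (auto simp: arity_perm_def dest: list_all2_lengthD)
  with inputs_arrows[OF fs, THEN act_Sym[OF p(2,1)]]
  show "FAr (Act D (Sym P p \<sigma>)) (permute_list \<sigma> fs) = FAr (Act D p) fs"
    by (simp add: permute_list_map)
next
  fix a show "category (Cmpt D a)" by (simp add: category_indiscrete inj_pr)
qed

definition gen :: "'e \<Rightarrow> 's \<Rightarrow> 's" where
  "gen e a = enc (canonical P (Unt P a, [e]))"

lemma gen_object: "a \<in> Obj (Col P) \<Longrightarrow> gen e a \<in> Ob a"
  by (auto simp: gen_def free_objects_def decorated_generator Unt_simps intro!: exI[of _ "Unt P a"] exI[of _ "[e]"])

lemma gens_objects: "p \<in> Ops P \<Longrightarrow> inputs (map (gen e) (Src P p)) (Src P p)"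
  by (simp add: list_all2_conv_all_nth gen_object Src_nth_Obj[of p])

text \<open>Grafting units onto \<open>p\<close> returns \<open>p\<close> by the right unit law, so
  every class is the value of an operation at generators.\<close>

lemma act_gens:
  assumes "p \<in> Ops P" "length es = length (Src P p)"
  shows "act p (map2 gen es (Src P p)) = enc (canonical P (p, es))"
proof -
  let ?ys = "map2 (\<lambda>e a. (Unt P a, [e])) es (Src P p)"
  have col: "a \<in> Obj (Col P)" if "(e, a) \<in> set (zip es (Src P p))" for e a
    using Src_Obj[OF assms(1)] set_zip_rightD[OF that] by blast
  have "map (Tgt P \<circ> fst) ?ys = Src P p"
    by (rule nth_equalityI) (simp_all add: assms Unt_simps Src_nth_Obj[OF assms(1)])
  moreover have "decorated P y" if "y \<in> set ?ys" for y
    using that by (auto intro!: decorated_generator col)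
  ultimately have "graftable P p ?ys"
    unfolding graftable_def using assms(1) by blast
  from act_canonical[OF this]
  have "act p (map (\<lambda>y. enc (canonical P y)) ?ys) = enc (canonical P (graft P p ?ys))" .
  moreover have "graft P p ?ys = (p, es)"
  proof -
    have "map fst ?ys = map (Unt P) (Src P p)"
      by (rule nth_equalityI) (simp_all add: assms)
    moreover have "map snd ?ys = map (\<lambda>e. [e]) es"
      by (rule nth_equalityI) (simp_all add: assms)
    ultimately show ?thesis
      unfolding graft_def by (simp only: Sub_Unt_right[OF assms(1)] concat_map_singleton list.map_ident)
  qed
  moreover have "map (\<lambda>y. enc (canonical P y)) ?ys = map2 gen es (Src P p)"
    by (rule nth_equalityI) (simp_all add: gen_def)
  ultimately show ?thesis by (simp only:)
qed

end

text \<open>With indiscrete components the structure arrows are forced by their ends; only the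
  objects are chosen, namely the units carrying the three labels.\<close>

definition free_internal :: "('s \<times> edge list \<Rightarrow> 's) \<Rightarrow> ('s \<times> 's \<Rightarrow> 's) \<Rightarrow> 's substitude_data \<Rightarrow> 's internal_alg" where
  "free_internal enc pr P = (let g = free_algebra.gen P enc; act = free_act enc P in
     \<lparr>XOb = g X_edge, KOb = g K_edge, LOb = g L_edge,
      XAct = (\<lambda>p. pr (act p (map (g X_edge) (Src P p)), g X_edge (Tgt P p))),
      KAct = (\<lambda>u. pr (act (Eta P u) [g K_edge (Dom (Col P) u)], g K_edge (Cod (Col P) u))),
      LAct = (\<lambda>u. pr (act (Eta P u) [g L_edge (Dom (Col P) u)], g L_edge (Cod (Col P) u))),
      FMap = (\<lambda>a. pr (g K_edge a, g L_edge a)), GMap = (\<lambda>a. pr (g K_edge a, g X_edge a))\<rparr>)"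

locale free_internal_algebra = free_algebra P enc pr
  for P :: "'s substitude_data" and enc :: "'s \<times> edge list \<Rightarrow> 's" and pr :: "'s \<times> 's \<Rightarrow> 's"
begin

abbreviation "V \<equiv> free_internal enc pr P"

lemma V_simps [simp]:
  "XOb V = gen X_edge" "KOb V = gen K_edge" "LOb V = gen L_edge"
  "XAct V p = pr (act p (map (gen X_edge) (Src P p)), gen X_edge (Tgt P p))"
  "KAct V u = pr (act (Eta P u) [gen K_edge (Dom (Col P) u)], gen K_edge (Cod (Col P) u))"
  "LAct V u = pr (act (Eta P u) [gen L_edge (Dom (Col P) u)], gen L_edge (Cod (Col P) u))"
  "FMap V a = pr (gen K_edge a, gen L_edge a)" "GMap V a = pr (gen K_edge a, gen X_edge a)"
  by (simp_all add: free_internal_def Let_def)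

lemma Hom_D: "f \<in> Hom (indiscrete pr S) x y \<longleftrightarrow> x \<in> S \<and> y \<in> S \<and> f = pr (x, y)"
  by (auto simp: Hom_indiscrete[OF inj_pr])

lemma act_Eta_closed:
  assumes "u \<in> Hom (Col P) a b" "x \<in> Ob a"
  shows "act (Eta P u) [x] \<in> Ob b"
  using act_closed[of "Eta P u" "[x]"] assms Eta_simps by (auto simp: Hom_def)

lemma act_Eta_Cmp:
  assumes "u \<in> Hom (Col P) a b" "v \<in> Hom (Col P) b c" "x \<in> Ob a"
  shows "act (Eta P (Cmp (Col P) v u)) [x] = act (Eta P v) [act (Eta P u) [x]]"
proof -
  have "substitutable P (Eta P v) [Eta P u]"
    using assms(1,2) Eta_simps by (auto simp: substitutable_def Hom_def)
  from act_Sub[OF this, of "[[x]]"] show ?thesis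
    using assms Eta_simps by (auto simp: Eta_Cmp Hom_def)
qed

lemma free_A_object: "is_A_object P D (gen e)
    (\<lambda>u. pr (act (Eta P u) [gen e (Dom (Col P) u)], gen e (Cod (Col P) u)))"
  unfolding is_A_object_def
proof (intro conjI ballI allI)
  interpret A: category "Col P" by (rule Col_category)
  fix a assume a: "a \<in> Obj (Col P)"
  show "gen e a \<in> Obj (Cmpt D a)" using gen_object[OF a] by (simp add: indiscrete_sel)
  show "pr (act (Eta P (Idn (Col P) a)) [gen e (Dom (Col P) (Idn (Col P) a))], gen e (Cod (Col P) (Idn (Col P) a))) =
      Idn (Cmpt D a) (gen e a)"
    using HomD[OF A.Idn_Hom[OF a]] act_Unt[OF a gen_object[OF a]] by (simp add: indiscrete_sel Eta_Idn a)
next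
  interpret A: category "Col P" by (rule Col_category)
  fix a b u assume u: "u \<in> Hom (Col P) a b"
  note ab = A.Hom_Obj[OF u]
  show "pr (act (Eta P u) [gen e (Dom (Col P) u)], gen e (Cod (Col P) u)) \<in>
      Hom (Cmpt D b) (FOb (Act D (Eta P u)) [gen e a]) (gen e b)"
    using HomD[OF u] gen_object ab act_Eta_closed[OF u gen_object[OF ab(1)]] by (simp add: Hom_D)
  fix c v assume v: "v \<in> Hom (Col P) b c"
  show "pr (act (Eta P (Cmp (Col P) v u)) [gen e (Dom (Col P) (Cmp (Col P) v u))], gen e (Cod (Col P) (Cmp (Col P) v u))) =
      Cmp (Cmpt D c) (pr (act (Eta P v) [gen e (Dom (Col P) v)], gen e (Cod (Col P) v)))
        (FAr (Act D (Eta P v)) [pr (act (Eta P u) [gen e (Dom (Col P) u)], gen e (Cod (Col P) u))])"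
    using HomD[OF u] HomD[OF v] HomD[OF A.Cmp_Hom[OF u v]] act_Eta_Cmp[OF u v gen_object[OF ab(1)]]
    by (simp add: indiscrete_sel)
qed

lemma free_A_map: "is_A_map P D (gen e) (\<lambda>u. pr (act (Eta P u) [gen e (Dom (Col P) u)], gen e (Cod (Col P) u)))
    (gen e') (\<lambda>u. pr (act (Eta P u) [gen e' (Dom (Col P) u)], gen e' (Cod (Col P) u)))
    (\<lambda>a. pr (gen e a, gen e' a))"
  unfolding is_A_map_def
  by (auto simp: Hom_D gen_object indiscrete_sel Hom_def[of "Col P"])

text \<open>Parallel arrows are equal here, so each law amounts to an equality of ends, which comes
  from the laws of the action on objects.\<close>

lemma internal_free_alg: "internal_algebra P D V"
proof
  fix a assume a: "a \<in> Obj (Col P)"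
  show "XOb V a \<in> Obj (Cmpt D a)" using gen_object[OF a] by (simp add: indiscrete_sel)
  show "XAct V (Unt P a) = Idn (Cmpt D a) (XOb V a)"
    using act_Unt[OF a gen_object[OF a]] Unt_simps[OF a] by (simp add: indiscrete_sel)
next
  fix p assume p: "p \<in> Ops P"
  have cl: "act p (map (gen X_edge) (Src P p)) \<in> Ob (Tgt P p)" by (rule act_closed[OF p gens_objects[OF p]])
  then show "XAct V p \<in> Hom (Cmpt D (Tgt P p)) (FOb (Act D p) (map (XOb V) (Src P p))) (XOb V (Tgt P p))"
    using gen_object[OF Tgt_Obj[OF p]] by (simp add: Hom_D)
  fix \<sigma> assume \<sigma>: "arity_perm P p \<sigma>"
  show "XAct V (Sym P p \<sigma>) = XAct V p"
    using act_Sym[OF \<sigma> p gens_objects[OF p]] Sym_simps[OF p \<sigma>] \<sigma>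
    by (simp add: arity_perm_def permute_list_map)
next
  fix p qs assume pq: "substitutable P p qs"
  then have p: "p \<in> Ops P" "set qs \<subseteq> Ops P" "map (Tgt P) qs = Src P p"
    by (auto simp: substitutable_def)
  have "gen X_edge (Src P q ! i) \<in> Ob (Src P q ! i)" if "q \<in> set qs" "i < length (Src P q)" for q i
    using gen_object Src_nth_Obj[of q] p(2) nth_mem[OF that(2)] that(1) by blast
  then have "list_all2 (\<lambda>xs q. inputs xs (Src P q)) (map (\<lambda>q. map (gen X_edge) (Src P q)) qs) qs"
    by (simp add: list_all2_conv_all_nth)
  moreover have map2_same: "map2 act qs (map (\<lambda>q. map (gen X_edge) (Src P q)) qs) =
      map (\<lambda>q. act q (map (gen X_edge) (Src P q))) qs"
    by (rule nth_equalityI) simp_all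
  ultimately have "act (Sub P p qs) (map (gen X_edge) (Src P (Sub P p qs))) =
      act p (map (\<lambda>q. act q (map (gen X_edge) (Src P q))) qs)"
    using act_Sub[OF pq, of "map (\<lambda>q. map (gen X_edge) (Src P q)) qs"]
    by (simp add: Sub_simps[OF pq] map_concat comp_def)
  moreover have "map (\<lambda>q. gen X_edge (Tgt P q)) qs = map (gen X_edge) (Src P p)"
    unfolding p(3)[symmetric] by simp
  ultimately show "XAct V (Sub P p qs) = Cmp (Cmpt D (Tgt P p)) (XAct V p) (FAr (Act D p) (map (XAct V) qs))"
    by (simp add: indiscrete_sel Sub_simps[OF pq] comp_def)
next
  show "is_A_object P D (KOb V) (KAct V)" "is_A_object P D (LOb V) (LAct V)"
    using free_A_object by (simp_all add: free_internal_def Let_def)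
  show "is_A_map P D (KOb V) (KAct V) (LOb V) (LAct V) (FMap V)"
    using free_A_map by (simp add: free_internal_def Let_def)
  \<comment> \<open>The action on \<open>X\<close> is written with \<open>Src\<close> and
    \<open>Tgt\<close> of \<open>Eta P u\<close>, which agrees with the form used in
    \<open>free_A_map\<close> when \<open>u\<close> is an arrow; hence the detour through
    \<open>is_A_map_cong\<close>.\<close>
  show "is_A_map P D (KOb V) (KAct V) (XOb V) (\<lambda>u. XAct V (Eta P u)) (GMap V)"
    by (simp add: free_internal_def Let_def) (rule is_A_map_cong[OF free_A_map], auto simp: Eta_simps)
qed

end

section \<open>Encodings into an infinite universe\<close>

lemma infinite_inj_pair:
  assumes "infinite (UNIV :: 's set)"
  obtains f :: "'s \<times> 's \<Rightarrow> 's" where "inj f"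
proof -
  obtain f :: "'s \<times> 's \<Rightarrow> 's" where "bij_betw f (UNIV \<times> UNIV) UNIV"
    using card_of_Times_same_infinite[OF assms] unfolding card_of_ordIso[symmetric] by blast
  then have "inj f" by (simp add: bij_betw_def)
  with that show ?thesis .
qed

lemma infinite_inj_edges:
  assumes "infinite (UNIV :: 's set)"
  obtains f :: "'s \<times> edge list \<Rightarrow> 's" where "inj f"
proof -
  have "inj (\<lambda>e. case e of X_edge \<Rightarrow> 0::nat | K_edge \<Rightarrow> 1 | L_edge \<Rightarrow> 2)"
    by (auto simp: inj_def split: edge.splits)
  then obtain c :: "edge \<Rightarrow> nat" where "inj c" by blast
  then have "inj (list_encode \<circ> map c)"
    by (intro inj_compose inj_list_encode) simp
  moreover obtain g :: "nat \<Rightarrow> 's" where "inj g"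
    using infinite_countable_subset[OF assms] by blast
  ultimately have g: "inj (g \<circ> (list_encode \<circ> map c))" using inj_compose by blast
  obtain f :: "'s \<times> 's \<Rightarrow> 's" where f: "inj f" using infinite_inj_pair[OF assms] .
  have "inj (f \<circ> map_prod id (g \<circ> (list_encode \<circ> map c)))"
    by (rule inj_compose[OF f prod.inj_map[OF inj_on_id g]])
  then show ?thesis by (rule that)
qed

definition ob :: "'s substitude_data \<Rightarrow> 's cat_alg \<Rightarrow> 's internal_alg \<Rightarrow> 's \<Rightarrow> edge list \<Rightarrow> 's" where
  "ob P C U p es = FOb (Act C p) (map2 (edge_obj U) es (Src P p))"

lemma corolla_ob: "corolla P C U p es = (Tgt P p, ob P C U p es)"
  by (simp add: corolla_def ob_def)

text \<open>The universal property sends the edges of \<open>U\<close> to the generators of the free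
  algebra, hence a corolla to the code of its class; equal corollas therefore have equal
  classes.\<close>

theorem corolla_eq_perm_equiv:
  fixes P :: "'s substitude_data"
  assumes inf: "infinite (UNIV :: 's set)" and P: "substitude P" and cl: "classifier P C U"
    and dec: "decorated P (p, es)" "decorated P (p', es')"
    and eq: "corolla P C U p es = corolla P C U p' es'"
  shows "perm_equiv P (p, es) (p', es')"
proof -
  obtain pr :: "'s \<times> 's \<Rightarrow> 's" where pr: "inj pr" using infinite_inj_pair[OF inf] .
  obtain enc :: "'s \<times> edge list \<Rightarrow> 's" where enc: "inj enc" using infinite_inj_edges[OF inf] .
  interpret substitude P by fact
  interpret free_internal_algebra P enc pr
    by unfold_locales (simp_all add: pr enc)
  interpret internal_algebra P C U using cl by (simp add: classifier_def)
  obtain H where H: "is_alg_mor P C D H" "same_internal_alg P (image_alg P H U) V"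
    using cl categorical_free_alg internal_free_alg unfolding classifier_def by blast
  have edge: "edge_obj U e a \<in> Obj (Cmpt C a)" if "a \<in> Obj (Col P)" for e a
    using that XOb_Obj K_object L_object by (cases e) (auto simp: is_A_object_def)
  have H_edge: "FOb (H a) (edge_obj U e a) = gen e a" if "a \<in> Obj (Col P)" for e a
    using H(2) that by (cases e) (auto simp: same_internal_alg_def image_alg_def)
  have H_ob: "FOb (H (Tgt P q)) (ob P C U q fs) = enc (canonical P (q, fs))"
    if "decorated P (q, fs)" for q fs
  proof -
    have q: "q \<in> Ops P" "length fs = length (Src P q)" using that by (auto simp: decorated_def)
    have "map2 (edge_obj U) fs (Src P q) \<in> Obj (inputs_cat P C q)"
      using q by (auto simp: inputs_cat_simps list_all2_conv_all_nth edge Src_nth_Obj[OF q(1)])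
    then have "FOb (H (Tgt P q)) (ob P C U q fs) =
        act q (map2 (\<lambda>a. FOb (H a)) (Src P q) (map2 (edge_obj U) fs (Src P q)))"
      using H(1) q(1) unfolding is_alg_mor_def ob_def by simp
    also have "map2 (\<lambda>a. FOb (H a)) (Src P q) (map2 (edge_obj U) fs (Src P q)) = map2 gen fs (Src P q)"
      by (rule nth_equalityI) (simp_all add: q(2) H_edge Src_nth_Obj[OF q(1)])
    finally show ?thesis using act_gens[OF q] by simp
  qed
  have "enc (canonical P (p, es)) = enc (canonical P (p', es'))"
    using H_ob[OF dec(1)] H_ob[OF dec(2)] eq by (simp add: corolla_ob)
  then show ?thesis using canonical_eqD[OF dec] enc by (simp add: inj_eq)
qed

section \<open>Generation of the classifier by its universal internal algebra\<close>

definition sub_alg :: "'s cat_alg \<Rightarrow> ('s \<Rightarrow> 's set) \<Rightarrow> ('s \<Rightarrow> 's set) \<Rightarrow> 's cat_alg" where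
  "sub_alg C SO SA = C\<lparr>Cmpt := (\<lambda>a. (Cmpt C a)\<lparr>Obj := SO a, Arr := SA a\<rparr>)\<rparr>"

lemma sub_alg_simps [simp]:
  "Obj (Cmpt (sub_alg C SO SA) a) = SO a" "Arr (Cmpt (sub_alg C SO SA) a) = SA a"
  "Dom (Cmpt (sub_alg C SO SA) a) = Dom (Cmpt C a)" "Cod (Cmpt (sub_alg C SO SA) a) = Cod (Cmpt C a)"
  "Idn (Cmpt (sub_alg C SO SA) a) = Idn (Cmpt C a)" "Cmp (Cmpt (sub_alg C SO SA) a) = Cmp (Cmpt C a)"
  "Act (sub_alg C SO SA) = Act C"
  by (simp_all add: sub_alg_def)

lemma Hom_sub_alg: "Hom (Cmpt (sub_alg C SO SA) a) x y = {f \<in> SA a. Dom (Cmpt C a) f = x \<and> Cod (Cmpt C a) f = y}"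
  by (simp add: Hom_def)

locale subalgebra = categorical_algebra P C + substitude P
  for P :: "'s substitude_data" and C :: "'s cat_alg" +
  fixes SO SA :: "'s \<Rightarrow> 's set"
  assumes SO: "a \<in> Obj (Col P) \<Longrightarrow> SO a \<subseteq> Obj (Cmpt C a)"
    and SA: "a \<in> Obj (Col P) \<Longrightarrow> SA a \<subseteq> Arr (Cmpt C a)"
    and SA_Dom: "a \<in> Obj (Col P) \<Longrightarrow> f \<in> SA a \<Longrightarrow> Dom (Cmpt C a) f \<in> SO a"
    and SA_Cod: "a \<in> Obj (Col P) \<Longrightarrow> f \<in> SA a \<Longrightarrow> Cod (Cmpt C a) f \<in> SO a"
    and SA_Idn: "a \<in> Obj (Col P) \<Longrightarrow> x \<in> SO a \<Longrightarrow> Idn (Cmpt C a) x \<in> SA a"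
    and SA_Cmp: "a \<in> Obj (Col P) \<Longrightarrow> f \<in> SA a \<Longrightarrow> g \<in> SA a \<Longrightarrow> Cod (Cmpt C a) f = Dom (Cmpt C a) g \<Longrightarrow>
      Cmp (Cmpt C a) g f \<in> SA a"
    and SO_Act: "p \<in> Ops P \<Longrightarrow> list_all2 (\<lambda>x a. x \<in> SO a) xs (Src P p) \<Longrightarrow> FOb (Act C p) xs \<in> SO (Tgt P p)"
    and SA_Act: "p \<in> Ops P \<Longrightarrow> list_all2 (\<lambda>f a. f \<in> SA a) fs (Src P p) \<Longrightarrow> FAr (Act C p) fs \<in> SA (Tgt P p)"
begin

abbreviation "S \<equiv> sub_alg C SO SA"

lemma inputs_sub:
  assumes "p \<in> Ops P"
  shows "xs \<in> Obj (inputs_cat P S p) \<Longrightarrow> xs \<in> Obj (inputs_cat P C p)"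
    "fs \<in> Arr (inputs_cat P S p) \<Longrightarrow> fs \<in> Arr (inputs_cat P C p)"
  using SO SA Src_nth_Obj[OF assms]
  by (auto simp: inputs_cat_simps list_all2_conv_all_nth subset_iff)

lemma categorical_sub_alg: "categorical_algebra P S"
proof (rule categorical_algebra.intro)
  fix a assume a: "a \<in> Obj (Col P)"
  interpret Ca: category "Cmpt C a" by (rule Cmpt_category[OF a])
  have hom: "f \<in> Hom (Cmpt C a) x y" if "f \<in> Hom (Cmpt S a) x y" for f x y
    using that SA[OF a] by (auto simp: Hom_def)
  show "category (Cmpt S a)"
  proof (rule category.intro)
    fix f x y g z h w
    show "f \<in> Arr (Cmpt S a) \<Longrightarrow> Dom (Cmpt S a) f \<in> Obj (Cmpt S a)"
      "f \<in> Arr (Cmpt S a) \<Longrightarrow> Cod (Cmpt S a) f \<in> Obj (Cmpt S a)"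
      using SA_Dom SA_Cod a by simp_all
    show "x \<in> Obj (Cmpt S a) \<Longrightarrow> Idn (Cmpt S a) x \<in> Hom (Cmpt S a) x x"
      using SA_Idn[OF a, of x] HomD[OF Ca.Idn_Hom, of x] SO[OF a] by (auto simp: Hom_sub_alg)
    assume f: "f \<in> Hom (Cmpt S a) x y"
    show "Cmp (Cmpt S a) f (Idn (Cmpt S a) x) = f" "Cmp (Cmpt S a) (Idn (Cmpt S a) y) f = f"
      using Ca.Cmp_Idn_left[OF hom[OF f]] Ca.Cmp_Idn_right[OF hom[OF f]] by simp_all
    assume g: "g \<in> Hom (Cmpt S a) y z"
    show "Cmp (Cmpt S a) g f \<in> Hom (Cmpt S a) x z"
      using SA_Cmp[OF a, of f g] HomD[OF Ca.Cmp_Hom[OF hom[OF f] hom[OF g]]] f g by (simp add: Hom_sub_alg)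
  next
    fix f g h w x y z
    assume "f \<in> Hom (Cmpt S a) w x" "g \<in> Hom (Cmpt S a) x y" "h \<in> Hom (Cmpt S a) y z"
    then show "Cmp (Cmpt S a) h (Cmp (Cmpt S a) g f) = Cmp (Cmpt S a) (Cmp (Cmpt S a) h g) f"
      using Ca.Cmp_assoc[OF hom hom hom] by simp
  qed
next
  fix p assume p: "p \<in> Ops P"
  note F = Act_functor[OF p, unfolded is_functor_def]
  have eq: "Dom (inputs_cat P S p) = Dom (inputs_cat P C p)" "Cod (inputs_cat P S p) = Cod (inputs_cat P C p)"
    "Idn (inputs_cat P S p) = Idn (inputs_cat P C p)" "Cmp (inputs_cat P S p) = Cmp (inputs_cat P C p)"
    by (simp_all add: fun_eq_iff inputs_cat_simps)
  show "is_functor (inputs_cat P S p) (Cmpt S (Tgt P p)) (Act S p)"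
    unfolding is_functor_def eq
  proof (intro conjI ballI impI)
    fix xs assume xs: "xs \<in> Obj (inputs_cat P S p)"
    show "FOb (Act S p) xs \<in> Obj (Cmpt S (Tgt P p))"
      using SO_Act[OF p] xs by (simp add: inputs_cat_simps)
    show "FAr (Act S p) (Idn (inputs_cat P C p) xs) = Idn (Cmpt S (Tgt P p)) (FOb (Act S p) xs)"
      using F inputs_sub(1)[OF p xs] by simp
  next
    fix fs assume fs: "fs \<in> Arr (inputs_cat P S p)"
    show "FAr (Act S p) fs \<in> Hom (Cmpt S (Tgt P p)) (FOb (Act S p) (Dom (inputs_cat P C p) fs))
        (FOb (Act S p) (Cod (inputs_cat P C p) fs))"
      using SA_Act[OF p] fs F inputs_sub(2)[OF p fs] by (auto simp: inputs_cat_simps(2) Hom_def)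
    fix gs assume gs: "gs \<in> Arr (inputs_cat P S p)"
      and "Cod (inputs_cat P C p) fs = Dom (inputs_cat P C p) gs"
    then show "FAr (Act S p) (Cmp (inputs_cat P C p) gs fs) = Cmp (Cmpt S (Tgt P p)) (FAr (Act S p) gs) (FAr (Act S p) fs)"
      using F inputs_sub(2)[OF p fs] inputs_sub(2)[OF p gs] by simp
  qed
next
  fix a x assume "a \<in> Obj (Col P)" "x \<in> Obj (Cmpt S a)"
  then show "FOb (Act S (Unt P a)) [x] = x" using Act_Unt_Obj SO by auto
next
  fix a f assume "a \<in> Obj (Col P)" "f \<in> Arr (Cmpt S a)"
  then show "FAr (Act S (Unt P a)) [f] = f" using Act_Unt_Arr SA by auto
next
  fix p qs and xss :: "'s list list"
  assume pq: "substitutable P p qs" and xss: "list_all2 (\<lambda>xs q. xs \<in> Obj (inputs_cat P S q)) xss qs"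
  have "set qs \<subseteq> Ops P" using pq by (simp add: substitutable_def)
  with xss have "list_all2 (\<lambda>xs q. xs \<in> Obj (inputs_cat P C q)) xss qs"
    by (induction rule: list_all2_induct) (auto intro: inputs_sub)
  with pq show "FOb (Act S (Sub P p qs)) (concat xss) = FOb (Act S p) (map2 (\<lambda>q. FOb (Act S q)) qs xss)"
    using Act_Sub_Obj by simp
next
  fix p qs and xss :: "'s list list"
  assume pq: "substitutable P p qs" and xss: "list_all2 (\<lambda>xs q. xs \<in> Arr (inputs_cat P S q)) xss qs"
  have "set qs \<subseteq> Ops P" using pq by (simp add: substitutable_def)
  with xss have "list_all2 (\<lambda>xs q. xs \<in> Arr (inputs_cat P C q)) xss qs"
    by (induction rule: list_all2_induct) (auto intro: inputs_sub)
  with pq show "FAr (Act S (Sub P p qs)) (concat xss) = FAr (Act S p) (map2 (\<lambda>q. FAr (Act S q)) qs xss)"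
    using Act_Sub_Arr by simp
next
  fix p \<sigma> and xs :: "'s list"
  assume "p \<in> Ops P" "arity_perm P p \<sigma>" "xs \<in> Obj (inputs_cat P S p)"
  then show "FOb (Act S (Sym P p \<sigma>)) (permute_list \<sigma> xs) = FOb (Act S p) xs"
    using Act_Sym_Obj inputs_sub by simp
next
  fix p \<sigma> and xs :: "'s list"
  assume "p \<in> Ops P" "arity_perm P p \<sigma>" "xs \<in> Arr (inputs_cat P S p)"
  then show "FAr (Act S (Sym P p \<sigma>)) (permute_list \<sigma> xs) = FAr (Act S p) xs"
    using Act_Sym_Arr inputs_sub by simp
qed

end

text \<open>The morphism to a subalgebra
  given by the universal property, followed by the inclusion, is the identity by uniqueness.\<close>

theorem classifier_generated:
  assumes "classifier P C U" "subalgebra P C SO SA"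
    and SO_edge: "\<And>a e. a \<in> Obj (Col P) \<Longrightarrow> edge_obj U e a \<in> SO a"
    and SA_XAct: "\<And>p. p \<in> Ops P \<Longrightarrow> XAct U p \<in> SA (Tgt P p)"
    and SA_KAct: "\<And>u. u \<in> Arr (Col P) \<Longrightarrow> KAct U u \<in> SA (Cod (Col P) u)"
    and SA_LAct: "\<And>u. u \<in> Arr (Col P) \<Longrightarrow> LAct U u \<in> SA (Cod (Col P) u)"
    and SA_FMap: "\<And>a. a \<in> Obj (Col P) \<Longrightarrow> FMap U a \<in> SA a"
    and SA_GMap: "\<And>a. a \<in> Obj (Col P) \<Longrightarrow> GMap U a \<in> SA a"
    and a: "a \<in> Obj (Col P)"
  shows "Obj (Cmpt C a) = SO a" "Arr (Cmpt C a) = SA a"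
proof -
  interpret subalgebra P C SO SA by fact
  have U: "internal_algebra P C U" using assms(1) by (simp add: classifier_def)
  then interpret internal_algebra P C U .
  have hom: "f \<in> Hom (Cmpt S b) x y" if "f \<in> SA b" "f \<in> Hom (Cmpt C b) x y" for f b x y
    using that by (simp add: Hom_def)
  have "internal_algebra P S U"
  proof (rule internal_algebra.intro)
    show "XOb U b \<in> Obj (Cmpt S b)" if "b \<in> Obj (Col P)" for b
      using SO_edge[OF that, of X_edge] by simp
    show "XAct U p \<in> Hom (Cmpt S (Tgt P p)) (FOb (Act S p) (map (XOb U) (Src P p))) (XOb U (Tgt P p))"
      if "p \<in> Ops P" for p
      using hom[OF SA_XAct[OF that] XAct_Hom[OF that]] by simp
    have KL: "is_A_object P S Z act" if "is_A_object P C Z act" "\<And>b. b \<in> Obj (Col P) \<Longrightarrow> Z b \<in> SO b"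
      "\<And>u. u \<in> Arr (Col P) \<Longrightarrow> act u \<in> SA (Cod (Col P) u)" for Z act
      using that unfolding is_A_object_def by (simp add: Hom_def)
    show "is_A_object P S (KOb U) (KAct U)" "is_A_object P S (LOb U) (LAct U)"
      using KL[OF K_object] KL[OF L_object] SO_edge[of _ K_edge] SO_edge[of _ L_edge] SA_KAct SA_LAct by simp_all
    have FG: "is_A_map P S Z act Z' act' h" if "is_A_map P C Z act Z' act' h"
      "\<And>b. b \<in> Obj (Col P) \<Longrightarrow> h b \<in> SA b" for Z act Z' act' h
      using that unfolding is_A_map_def by (simp add: Hom_def)
    show "is_A_map P S (KOb U) (KAct U) (LOb U) (LAct U) (FMap U)"
      "is_A_map P S (KOb U) (KAct U) (XOb U) (\<lambda>u. XAct U (Eta P u)) (GMap U)"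
      using FG[OF F_map SA_FMap] FG[OF G_map SA_GMap] by simp_all
  qed (simp_all add: XAct_Unt XAct_Sub XAct_Sym)
  then obtain H where H: "is_alg_mor P C S H" "same_internal_alg P (image_alg P H U) U"
    using assms(1) categorical_sub_alg unfolding classifier_def by blast
  \<comment> \<open>The inclusion of the subalgebra changes neither objects nor arrows, so
    \<open>H\<close> itself serves as the composite endomorphism of \<open>C\<close>.\<close>
  have "is_alg_mor P C C H"
    unfolding is_alg_mor_def
  proof (intro conjI ballI)
    fix b assume b: "b \<in> Obj (Col P)"
    then have "is_functor (Cmpt C b) (Cmpt S b) (H b)" using H(1) by (simp add: is_alg_mor_def)
    then show "is_functor (Cmpt C b) (Cmpt C b) (H b)"
      using SO[OF b] SA[OF b] unfolding is_functor_def by (auto simp: Hom_def)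
  qed (use H(1) in \<open>auto simp: is_alg_mor_def\<close>)
  moreover have "is_alg_mor P C C (\<lambda>_. id_func)"
  proof -
    have "map2 (\<lambda>a x. x) (Src P p) xs = xs" if "length xs = length (Src P p)" for p and xs :: "'a list"
      by (rule nth_equalityI) (simp_all add: that)
    then show ?thesis
      unfolding is_alg_mor_def id_func_def is_functor_def inputs_cat_simps
      by (auto simp: Hom_def inputs_cat_simps dest!: list_all2_lengthD)
  qed
  moreover have "same_internal_alg P (image_alg P (\<lambda>_. id_func) U) U"
    by (simp add: same_internal_alg_def image_alg_def id_func_def)
  moreover have "\<exists>H0. \<forall>H'. is_alg_mor P C C H' \<and> same_internal_alg P (image_alg P H' U) U \<longrightarrow> same_alg_mor P C H0 H'"
    using assms(1) U unfolding classifier_def by blast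
  ultimately obtain H0 where "same_alg_mor P C H0 H" "same_alg_mor P C H0 (\<lambda>_. id_func)"
    using H(2) by blast
  then have id: "\<And>x. x \<in> Obj (Cmpt C a) \<Longrightarrow> FOb (H a) x = x" "\<And>f. f \<in> Arr (Cmpt C a) \<Longrightarrow> FAr (H a) f = f"
    using a by (auto simp: same_alg_mor_def id_func_def)
  have "is_functor (Cmpt C a) (Cmpt S a) (H a)" using H(1) a by (simp add: is_alg_mor_def)
  then have "Obj (Cmpt C a) \<subseteq> SO a" "Arr (Cmpt C a) \<subseteq> SA a"
    using id unfolding is_functor_def by (auto simp: Hom_def)
  with SO[OF a] SA[OF a] show "Obj (Cmpt C a) = SO a" "Arr (Cmpt C a) = SA a" by auto
qed

section \<open>Relabelling of decorated operations\<close>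

lemma zip_concat:
  assumes "\<And>i. i \<in> set I \<Longrightarrow> length (f i) = length (g i)"
  shows "zip (concat (map f I)) (concat (map g I)) = concat (map (\<lambda>i. zip (f i) (g i)) I)"
  using assms by (induction I) auto

lemma in_set_zip_fst_snd:
  assumes "j \<in> set (zip xs ys)"
  shows "fst j \<in> set xs" "snd j \<in> set ys"
  using assms by (metis prod.collapse set_zip_leftD, metis prod.collapse set_zip_rightD)

text \<open>Serves to cut the branches of an arrow into the groups that sit on the inputs of each
  branch of the next arrow.\<close>

lemma map_concat_split:
  assumes "map f ys = concat (map g xs)"
  shows "\<exists>G. map fst G = xs \<and> ys = concat (map snd G) \<and> (\<forall>(x, zs)\<in>set G. map f zs = g x)"
  using assms
proof (induction xs arbitrary: ys)
  case (Cons x xs)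
  define zs where "zs = take (length (g x)) ys"
  define zs' where "zs' = drop (length (g x)) ys"
  have "map f zs = g x" "map f zs' = concat (map g xs)"
    using Cons.prems by (simp_all add: zs_def zs'_def flip: take_map drop_map)
  moreover from Cons.IH[OF this(2)] obtain G where "map fst G = xs" "zs' = concat (map snd G)"
    "\<forall>(x, zs)\<in>set G. map f zs = g x" by blast
  moreover have "ys = zs @ zs'" by (simp add: zs_def zs'_def)
  ultimately show ?case by (intro exI[of _ "(x, zs) # G"]) auto
qed simp

text \<open>The maps \<open>f\<close> and \<open>g\<close> start at \<open>K\<close>, so labels other than \<open>K\<close> only admit the identity;
  \<open>change\<close> is junk on pairs that are not admissible.\<close>

definition admissible :: "edge \<times> edge \<Rightarrow> bool" where
  "admissible w \<longleftrightarrow> fst w = K_edge \<or> fst w = snd w"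

fun change :: "'s cat_alg \<Rightarrow> 's internal_alg \<Rightarrow> edge \<times> edge \<Rightarrow> 's \<Rightarrow> 's" where
  "change C U (e, e') a = (if e = e' then Idn (Cmpt C a) (edge_obj U e a)
     else if e' = X_edge then GMap U a else FMap U a)"

definition relabel :: "'s substitude_data \<Rightarrow> 's cat_alg \<Rightarrow> 's internal_alg \<Rightarrow> 's \<Rightarrow> (edge \<times> edge) list \<Rightarrow> 's" where
  "relabel P C U p ws = FAr (Act C p) (map2 (change C U) ws (Src P p))"

text \<open>Gives the three labels a common treatment. They differ only in the operations that act:
  all operations on \<open>X\<close>, those coming from \<open>A\<close> on \<open>K\<close> and
  \<open>L\<close>.\<close>

inductive structure_map :: "'s substitude_data \<Rightarrow> 's internal_alg \<Rightarrow> edge \<Rightarrow> 's \<Rightarrow> 's \<Rightarrow> bool"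
  for P U where
  "p \<in> Ops P \<Longrightarrow> structure_map P U X_edge p (XAct U p)"
| "u \<in> Arr (Col P) \<Longrightarrow> structure_map P U K_edge (Eta P u) (KAct U u)"
| "u \<in> Arr (Col P) \<Longrightarrow> structure_map P U L_edge (Eta P u) (LAct U u)"

text \<open>Meant for arrows with a single edge as target. The operation and labels of the source
  are stored, since in the classifier the source object determines them only up to
  reordering.\<close>

record 's branch =
  blab :: edge
  bop :: 's
  blabs :: "edge list"
  barr :: 's

section \<open>Calculus of label changes under the action of operations\<close>

locale universal_alg = substitude P + categorical_algebra P C + internal_algebra P C U
  for P :: "'s substitude_data" and C :: "'s cat_alg" and U :: "'s internal_alg"
begin

abbreviation "hom a \<equiv> Hom (Cmpt C a)"
abbreviation "cmp a \<equiv> Cmp (Cmpt C a)"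
abbreviation "edg \<equiv> edge_obj U"
abbreviation "chg \<equiv> change C U"
abbreviation "rel \<equiv> relabel P C U"
abbreviation "obj \<equiv> ob P C U"
abbreviation "smap \<equiv> structure_map P U"

sublocale A: category "Col P" by (rule Col_category)

lemma edg_Obj: "a \<in> Obj (Col P) \<Longrightarrow> edg e a \<in> Obj (Cmpt C a)"
  using XOb_Obj K_object L_object by (cases e) (auto simp: is_A_object_def)

text \<open>An index list \<open>I\<close> with colours \<open>c\<close> replaces parallel lists, so
  that this and the following lemmas serve both for families of branches and for lists of
  label-colour pairs.\<close>

lemma inputs_Hom:
  assumes "map c I = Src P p" "\<And>i. i \<in> set I \<Longrightarrow> f i \<in> hom (c i) (x i) (y i)"
  shows "map f I \<in> Hom (inputs_cat P C p) (map x I) (map y I)"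
  unfolding Hom_def inputs_cat_simps assms(1)[symmetric] mem_Collect_eq map2_map_map
  using assms(2) by (auto simp: Hom_def list_all2_map1 list_all2_map2 list_all2_same inputs_cat_simps
    map2_map_map simp flip: assms(1))

lemma Act_Hom:
  assumes "p \<in> Ops P" "map c I = Src P p" "\<And>i. i \<in> set I \<Longrightarrow> f i \<in> hom (c i) (x i) (y i)"
  shows "FAr (Act C p) (map f I) \<in> hom (Tgt P p) (FOb (Act C p) (map x I)) (FOb (Act C p) (map y I))"
  by (rule is_functor_Hom[OF Act_functor[OF assms(1)] inputs_Hom[OF assms(2,3)]])

lemma Act_Cmp:
  assumes "p \<in> Ops P" "map c I = Src P p" "\<And>i. i \<in> set I \<Longrightarrow> f i \<in> hom (c i) (x i) (y i)"
    "\<And>i. i \<in> set I \<Longrightarrow> g i \<in> hom (c i) (y i) (z i)"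
  shows "FAr (Act C p) (map (\<lambda>i. cmp (c i) (g i) (f i)) I) =
    cmp (Tgt P p) (FAr (Act C p) (map g I)) (FAr (Act C p) (map f I))"
proof -
  have "Cmp (inputs_cat P C p) (map g I) (map f I) = map (\<lambda>i. cmp (c i) (g i) (f i)) I"
    unfolding inputs_cat_simps assms(2)[symmetric] by (rule nth_equalityI) simp_all
  then show ?thesis
    using is_functor_Cmp[OF Act_functor[OF assms(1)] inputs_Hom[OF assms(2,3)] inputs_Hom[OF assms(2,4)]]
    by simp
qed

lemma Act_Idn:
  assumes "p \<in> Ops P" "map c I = Src P p" "\<And>i. i \<in> set I \<Longrightarrow> x i \<in> Obj (Cmpt C (c i))"
  shows "FAr (Act C p) (map (\<lambda>i. Idn (Cmpt C (c i)) (x i)) I) = Idn (Cmpt C (Tgt P p)) (FOb (Act C p) (map x I))"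
proof -
  have "Idn (inputs_cat P C p) (map x I) = map (\<lambda>i. Idn (Cmpt C (c i)) (x i)) I"
    unfolding inputs_cat_simps assms(2)[symmetric] map2_map_map ..
  moreover have "map x I \<in> Obj (inputs_cat P C p)"
    unfolding inputs_cat_simps assms(2)[symmetric] list_all2_map1 list_all2_map2 list_all2_same
    using assms(3) by blast
  ultimately show ?thesis using is_functor_Idn[OF Act_functor[OF assms(1)]] by metis
qed

lemma Sub_map:
  assumes "p \<in> Ops P" "map c I = Src P p" "\<And>i. i \<in> set I \<Longrightarrow> q i \<in> Ops P \<and> Tgt P (q i) = c i"
  shows "substitutable P p (map q I)" "Sub P p (map q I) \<in> Ops P"
    "Src P (Sub P p (map q I)) = concat (map (\<lambda>i. Src P (q i)) I)"
    "Tgt P (Sub P p (map q I)) = Tgt P p"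
proof -
  have "map (Tgt P) (map q I) = Src P p"
    unfolding assms(2)[symmetric] map_map using assms(3) by (intro map_cong) auto
  then show *: "substitutable P p (map q I)"
    using assms(1,3) by (auto simp: substitutable_def)
  from Sub_simps[OF this] show "Sub P p (map q I) \<in> Ops P"
    "Src P (Sub P p (map q I)) = concat (map (\<lambda>i. Src P (q i)) I)"
    "Tgt P (Sub P p (map q I)) = Tgt P p" by (simp_all add: comp_def)
qed

lemma Act_Sub_map_Arr:
  assumes "p \<in> Ops P" "map c I = Src P p" "\<And>i. i \<in> set I \<Longrightarrow> q i \<in> Ops P \<and> Tgt P (q i) = c i"
    "\<And>i. i \<in> set I \<Longrightarrow> fs i \<in> Arr (inputs_cat P C (q i))"
  shows "FAr (Act C (Sub P p (map q I))) (concat (map fs I)) = FAr (Act C p) (map (\<lambda>i. FAr (Act C (q i)) (fs i)) I)"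
proof -
  have "list_all2 (\<lambda>fs q. fs \<in> Arr (inputs_cat P C q)) (map fs I) (map q I)"
    unfolding list_all2_map1 list_all2_map2 list_all2_same using assms(4) by blast
  from Act_Sub_Arr[OF Sub_map(1)[OF assms(1-3)] this] show ?thesis
    by (simp add: map2_map_map)
qed

lemma Act_Sub_map_Obj:
  assumes "p \<in> Ops P" "map c I = Src P p" "\<And>i. i \<in> set I \<Longrightarrow> q i \<in> Ops P \<and> Tgt P (q i) = c i"
    "\<And>i. i \<in> set I \<Longrightarrow> xs i \<in> Obj (inputs_cat P C (q i))"
  shows "FOb (Act C (Sub P p (map q I))) (concat (map xs I)) = FOb (Act C p) (map (\<lambda>i. FOb (Act C (q i)) (xs i)) I)"
proof -
  have "list_all2 (\<lambda>xs q. xs \<in> Obj (inputs_cat P C q)) (map xs I) (map q I)"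
    unfolding list_all2_map1 list_all2_map2 list_all2_same using assms(4) by blast
  from Act_Sub_Obj[OF Sub_map(1)[OF assms(1-3)] this] show ?thesis
    by (simp add: map2_map_map)
qed

lemma decoratedD:
  assumes "decorated P (p, es)"
  shows "p \<in> Ops P" "length es = length (Src P p)" "map snd (zip es (Src P p)) = Src P p"
    "map fst (zip es (Src P p)) = es" "(e, a) \<in> set (zip es (Src P p)) \<Longrightarrow> a \<in> Obj (Col P)"
  using assms Src_nth_Obj by (auto simp: decorated_def dest: set_zip_rightD)

lemma edg_inputs:
  assumes "decorated P (p, es)"
  shows "map2 edg es (Src P p) \<in> Obj (inputs_cat P C p)"
  using decoratedD[OF assms] Src_nth_Obj[of p]
  by (auto simp: inputs_cat_simps list_all2_conv_all_nth intro!: edg_Obj)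

lemma obj_Obj: "decorated P (p, es) \<Longrightarrow> obj p es \<in> Obj (Cmpt C (Tgt P p))"
  unfolding ob_def using is_functor_Obj[OF Act_functor edg_inputs] decoratedD(1) by blast

lemma obj_Unt: "a \<in> Obj (Col P) \<Longrightarrow> obj (Unt P a) [e] = edg e a"
  by (simp add: ob_def Unt_simps Act_Unt_Obj edg_Obj)

lemma decorated_Sub:
  assumes "p \<in> Ops P" "map c I = Src P p" "\<And>i. i \<in> set I \<Longrightarrow> decorated P (q i, es i) \<and> Tgt P (q i) = c i"
  shows "decorated P (Sub P p (map q I), concat (map es I))"
proof -
  have "map (length \<circ> es) I = map (length \<circ> (\<lambda>i. Src P (q i))) I"
    using assms(3) by (auto simp: decorated_def)
  then have "length (concat (map es I)) = length (concat (map (\<lambda>i. Src P (q i)) I))"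
    unfolding length_concat map_map by (rule arg_cong)
  then show ?thesis
    using Sub_map[OF assms(1,2), of q] assms(3) by (simp add: decorated_def)
qed

lemma obj_Sub:
  assumes "p \<in> Ops P" "map c I = Src P p" "\<And>i. i \<in> set I \<Longrightarrow> decorated P (q i, es i) \<and> Tgt P (q i) = c i"
  shows "obj (Sub P p (map q I)) (concat (map es I)) = FOb (Act C p) (map (\<lambda>i. obj (q i) (es i)) I)"
proof -
  have q: "q i \<in> Ops P \<and> Tgt P (q i) = c i" if "i \<in> set I" for i
    using assms(3)[OF that] by (simp add: decorated_def)
  have "map2 edg (concat (map es I)) (concat (map (\<lambda>i. Src P (q i)) I)) =
      concat (map (\<lambda>i. map2 edg (es i) (Src P (q i))) I)"
    by (subst zip_concat) (use assms(3) in \<open>simp_all add: decorated_def map_concat comp_def\<close>)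
  moreover have "Src P (Sub P p (map q I)) = concat (map (\<lambda>i. Src P (q i)) I)"
    by (rule Sub_map(3)[OF assms(1,2) q])
  ultimately show ?thesis
    unfolding ob_def
    using Act_Sub_map_Obj[where q = q, OF assms(1,2) q, of "\<lambda>i. map2 edg (es i) (Src P (q i))"] edg_inputs assms(3) by simp
qed

lemma chg_Hom:
  assumes "a \<in> Obj (Col P)" "admissible w"
  shows "chg w a \<in> hom a (edg (fst w) a) (edg (snd w) a)"
proof -
  have F: "FMap U a \<in> hom a (KOb U a) (LOb U a)" "GMap U a \<in> hom a (KOb U a) (XOb U a)"
    using F_map G_map assms(1) by (auto simp: is_A_map_def)
  obtain e e' where w: "w = (e, e')" by (cases w)
  have I: "Idn (Cmpt C a) (edg e a) \<in> hom a (edg e a) (edg e a)" for e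
    by (rule category.Idn_Hom[OF Cmpt_category[OF assms(1)] edg_Obj[OF assms(1)]])
  show ?thesis
    using F assms(2) I[of X_edge] I[of K_edge] I[of L_edge]
    unfolding w by (cases e; cases e') (auto simp: admissible_def)
qed

text \<open>A change other than an identity leads from \<open>K\<close> to \<open>X\<close> or
  \<open>L\<close>, where only identities start; so at least one of two composable changes is an
  identity.\<close>

lemma chg_comp:
  assumes "a \<in> Obj (Col P)" "admissible (e, e')" "admissible (e', e'')"
  shows "cmp a (chg (e', e'') a) (chg (e, e') a) = chg (e, e'') a" "admissible (e, e'')"
proof -
  interpret Ca: category "Cmpt C a" by (rule Cmpt_category[OF assms(1)])
  show "cmp a (chg (e', e'') a) (chg (e, e') a) = chg (e, e'') a"
    using Ca.Cmp_Idn_left[OF chg_Hom[OF assms(1,2)]] Ca.Cmp_Idn_right[OF chg_Hom[OF assms(1,3)]] assms(2,3)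
    by (auto simp: admissible_def)
  show "admissible (e, e'')" using assms(2,3) by (auto simp: admissible_def)
qed

lemma rel_Hom:
  assumes "decorated P (p, ws)" "\<And>w. w \<in> set ws \<Longrightarrow> admissible w"
  shows "rel p ws \<in> hom (Tgt P p) (obj p (map fst ws)) (obj p (map snd ws))"
proof -
  note p = decoratedD[OF assms(1)]
  let ?J = "zip ws (Src P p)"
  have "snd j \<in> Obj (Col P)" "admissible (fst j)" if "j \<in> set ?J" for j
    using Src_nth_Obj[OF p(1)] assms(2) in_set_zip_fst_snd[OF that] by blast+
  then have "FAr (Act C p) (map (\<lambda>j. chg (fst j) (snd j)) ?J) \<in> hom (Tgt P p)
      (FOb (Act C p) (map (\<lambda>j. edg (fst (fst j)) (snd j)) ?J))
      (FOb (Act C p) (map (\<lambda>j. edg (snd (fst j)) (snd j)) ?J))"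
    by - (rule Act_Hom[OF p(1,3)], rule chg_Hom)
  then show ?thesis by (simp add: relabel_def ob_def zip_map1 case_prod_unfold comp_def)
qed

lemma rel_Cmp:
  assumes "p \<in> Ops P" "length I = length (Src P p)"
    "\<And>i. i \<in> set I \<Longrightarrow> admissible (\<alpha> i, \<beta> i) \<and> admissible (\<beta> i, \<gamma> i)"
  shows "cmp (Tgt P p) (rel p (map (\<lambda>i. (\<beta> i, \<gamma> i)) I)) (rel p (map (\<lambda>i. (\<alpha> i, \<beta> i)) I)) =
    rel p (map (\<lambda>i. (\<alpha> i, \<gamma> i)) I)"
proof -
  let ?J = "zip I (Src P p)"
  have J: "map snd ?J = Src P p" using assms(2) by simp
  have col: "snd j \<in> Obj (Col P)" and adm: "admissible (\<alpha> (fst j), \<beta> (fst j)) \<and> admissible (\<beta> (fst j), \<gamma> (fst j))"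
    if "j \<in> set ?J" for j
    using Src_nth_Obj[OF assms(1)] assms(3) in_set_zip_fst_snd[OF that] by blast+
  have r: "rel p (map h I) = FAr (Act C p) (map (\<lambda>j. chg (h (fst j)) (snd j)) ?J)" for h
    by (simp add: relabel_def zip_map1 case_prod_unfold comp_def)
  have "FAr (Act C p) (map (\<lambda>j. cmp (snd j) (chg (\<beta> (fst j), \<gamma> (fst j)) (snd j)) (chg (\<alpha> (fst j), \<beta> (fst j)) (snd j))) ?J) =
      cmp (Tgt P p) (FAr (Act C p) (map (\<lambda>j. chg (\<beta> (fst j), \<gamma> (fst j)) (snd j)) ?J))
        (FAr (Act C p) (map (\<lambda>j. chg (\<alpha> (fst j), \<beta> (fst j)) (snd j)) ?J))"
  proof (rule Act_Cmp[OF assms(1) J])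
    fix j assume j: "j \<in> set ?J"
    show "chg (\<alpha> (fst j), \<beta> (fst j)) (snd j) \<in> hom (snd j) (edg (\<alpha> (fst j)) (snd j)) (edg (\<beta> (fst j)) (snd j))"
      "chg (\<beta> (fst j), \<gamma> (fst j)) (snd j) \<in> hom (snd j) (edg (\<beta> (fst j)) (snd j)) (edg (\<gamma> (fst j)) (snd j))"
      using chg_Hom[OF col[OF j]] adm[OF j] by (metis fst_conv snd_conv)+
  qed
  moreover have "map (\<lambda>j. cmp (snd j) (chg (\<beta> (fst j), \<gamma> (fst j)) (snd j)) (chg (\<alpha> (fst j), \<beta> (fst j)) (snd j))) ?J =
      map (\<lambda>j. chg (\<alpha> (fst j), \<gamma> (fst j)) (snd j)) ?J"
    by (rule map_cong[OF refl]) (use chg_comp(1)[OF col] adm in blast)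
  ultimately show ?thesis unfolding r by (simp only:)
qed

lemma rel_Idn:
  assumes "decorated P (p, es)"
  shows "rel p (map (\<lambda>e. (e, e)) es) = Idn (Cmpt C (Tgt P p)) (obj p es)"
proof -
  note p = decoratedD[OF assms]
  have "FAr (Act C p) (map (\<lambda>i. Idn (Cmpt C (snd i)) (edg (fst i) (snd i))) (zip es (Src P p))) =
    Idn (Cmpt C (Tgt P p)) (FOb (Act C p) (map (\<lambda>i. edg (fst i) (snd i)) (zip es (Src P p))))"
    by (rule Act_Idn[OF p(1,3)]) (metis edg_Obj p(5) prod.collapse)
  then show ?thesis by (simp add: relabel_def ob_def zip_map1 case_prod_unfold comp_def)
qed

lemma rel_inputs:
  assumes "decorated P (p, ws)" "\<And>w. w \<in> set ws \<Longrightarrow> admissible w"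
  shows "map2 chg ws (Src P p) \<in> Arr (inputs_cat P C p)"
  using decoratedD[OF assms(1)] Src_nth_Obj[of p] chg_Hom[THEN HomD(1)] assms(2)
  by (auto simp: inputs_cat_simps list_all2_conv_all_nth)

lemma rel_Sub:
  assumes "p \<in> Ops P" "map c I = Src P p" "\<And>i. i \<in> set I \<Longrightarrow> decorated P (q i, ws i) \<and> Tgt P (q i) = c i"
    "\<And>i w. i \<in> set I \<Longrightarrow> w \<in> set (ws i) \<Longrightarrow> admissible w"
  shows "rel (Sub P p (map q I)) (concat (map ws I)) = FAr (Act C p) (map (\<lambda>i. rel (q i) (ws i)) I)"
proof -
  have q: "q i \<in> Ops P \<and> Tgt P (q i) = c i" if "i \<in> set I" for i
    using assms(3)[OF that] by (simp add: decorated_def)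
  have "map2 chg (concat (map ws I)) (concat (map (\<lambda>i. Src P (q i)) I)) =
      concat (map (\<lambda>i. map2 chg (ws i) (Src P (q i))) I)"
    by (subst zip_concat) (use assms(3) in \<open>simp_all add: decorated_def map_concat comp_def\<close>)
  moreover have "Src P (Sub P p (map q I)) = concat (map (\<lambda>i. Src P (q i)) I)"
    by (rule Sub_map(3)[OF assms(1,2) q])
  ultimately show ?thesis
    unfolding relabel_def
    using Act_Sub_map_Arr[where q = q, OF assms(1,2) q, of "\<lambda>i. map2 chg (ws i) (Src P (q i))"] rel_inputs assms(3,4) by simp
qed

lemma rel_Sym:
  assumes "decorated P (p, ws)" "arity_perm P p \<sigma>" "\<And>w. w \<in> set ws \<Longrightarrow> admissible w"
  shows "rel (Sym P p \<sigma>) (permute_list \<sigma> ws) = rel p ws"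
proof -
  note p = decoratedD[OF assms(1)]
  have "\<sigma> permutes {..<length (Src P p)}" using assms(2) by (simp add: arity_perm_def)
  then have "map2 chg (permute_list \<sigma> ws) (permute_list \<sigma> (Src P p)) = permute_list \<sigma> (map2 chg ws (Src P p))"
    using p(2) by (simp add: permute_list_zip[symmetric] permute_list_map)
  then show ?thesis
    using Act_Sym_Arr[OF p(1) assms(2) rel_inputs[OF assms(1,3)]] Sym_simps[OF p(1) assms(2)]
    by (simp add: relabel_def)
qed

end

section \<open>Branches\<close>

context universal_alg
begin

lemma map2_const: "map2 f (map (\<lambda>_. x) as) as = map (f x) as"
  by (rule nth_equalityI) simp_all

lemma obj_const: "obj p (map (\<lambda>_. e) (Src P p)) = FOb (Act C p) (map (edg e) (Src P p))"
  by (simp only: ob_def map2_const)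

lemma rel_const: "rel p (map (\<lambda>_. w) (Src P p)) = FAr (Act C p) (map (chg w) (Src P p))"
  by (simp only: relabel_def map2_const)

lemma smap_Hom:
  assumes "smap e p h"
  shows "p \<in> Ops P" "h \<in> hom (Tgt P p) (obj p (map (\<lambda>_. e) (Src P p))) (edg e (Tgt P p))"
proof -
  show "p \<in> Ops P" using assms by cases (simp_all add: Eta_simps)
  have act: "act u \<in> hom (Cod (Col P) u) (FOb (Act C (Eta P u)) [Z (Dom (Col P) u)]) (Z (Cod (Col P) u))"
    if "is_A_object P C Z act" "u \<in> Arr (Col P)" for Z act u
    using that(1) Arr_Hom[OF that(2)] unfolding is_A_object_def by blast
  have "edg X_edge = XOb U" by (rule ext) simp
  then show "h \<in> hom (Tgt P p) (obj p (map (\<lambda>_. e) (Src P p))) (edg e (Tgt P p))"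
    unfolding obj_const using XAct_Hom act[OF K_object] act[OF L_object]
    by - (rule structure_map.cases[OF assms]; simp add: Eta_simps)
qed

text \<open>Either the change is an identity, or the label is \<open>K\<close> and the structure map
  is the action of an arrow of \<open>A\<close>, with which \<open>f\<close> and \<open>g\<close>
  commute.\<close>

lemma smap_nat:
  assumes "smap e p h" "admissible (e, e')"
  shows "\<exists>h'. smap e' p h' \<and>
    cmp (Tgt P p) (chg (e, e') (Tgt P p)) h = cmp (Tgt P p) h' (rel p (map (\<lambda>_. (e, e')) (Src P p)))"
proof (cases "e = e'")
  case True
  note h = smap_Hom[OF assms(1)]
  interpret Ca: category "Cmpt C (Tgt P p)" by (rule Cmpt_category[OF Tgt_Obj[OF h(1)]])
  have "rel p (map (\<lambda>_. (e, e)) (Src P p)) = Idn (Cmpt C (Tgt P p)) (obj p (map (\<lambda>_. e) (Src P p)))"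
    using rel_Idn[of p "map (\<lambda>_. e) (Src P p)"] h(1) by (simp add: decorated_def comp_def)
  then show ?thesis
    using True assms(1) Ca.Cmp_Idn_left[OF h(2)] Ca.Cmp_Idn_right[OF h(2)] by auto
next
  case False
  then have e: "e = K_edge" using assms(2) by (simp add: admissible_def)
  obtain u where u: "u \<in> Arr (Col P)" "p = Eta P u" "h = KAct U u"
    using assms(1) e by (auto elim: structure_map.cases)
  have F: "cmp (Cod (Col P) u) (FMap U (Cod (Col P) u)) (KAct U u) =
      cmp (Cod (Col P) u) (LAct U u) (FAr (Act C (Eta P u)) [FMap U (Dom (Col P) u)])"
    using F_map Arr_Hom[OF u(1)] unfolding is_A_map_def by blast
  have G: "cmp (Cod (Col P) u) (GMap U (Cod (Col P) u)) (KAct U u) =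
      cmp (Cod (Col P) u) (XAct U (Eta P u)) (FAr (Act C (Eta P u)) [GMap U (Dom (Col P) u)])"
    using G_map Arr_Hom[OF u(1)] unfolding is_A_map_def by blast
  have s: "smap L_edge p (LAct U u)" "smap X_edge p (XAct U (Eta P u))"
    unfolding u(2) by (intro structure_map.intros u(1) Eta_simps(1))+
  show ?thesis
    unfolding rel_const using F G s u(2,3) e False Eta_simps[OF u(1)]
    by (cases e') auto
qed

text \<open>The operation of an arrow of \<open>A\<close> is unary, so \<open>I\<close> has one
  entry, and functoriality makes the result the action of a composite arrow.\<close>

lemma smap_Sub_A:
  assumes "is_A_object P C Z act" "\<And>v. v \<in> Arr (Col P) \<Longrightarrow> smap e (Eta P v) (act v)" "u \<in> Arr (Col P)"
    and "map c I = Src P (Eta P u)"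
    "\<And>i. i \<in> set I \<Longrightarrow> \<exists>v. v \<in> Arr (Col P) \<and> q i = Eta P v \<and> k i = act v \<and> Tgt P (q i) = c i"
  shows "smap e (Sub P (Eta P u) (map q I)) (cmp (Tgt P (Eta P u)) (act u) (FAr (Act C (Eta P u)) (map k I)))"
proof -
  obtain i where i: "I = [i]" "c i = Dom (Col P) u"
    using assms(4) Eta_simps(2)[OF assms(3)] by auto
  obtain v where v: "v \<in> Arr (Col P)" "q i = Eta P v" "k i = act v" "Tgt P (q i) = c i"
    using assms(5)[of i] i by auto
  have hom: "v \<in> Hom (Col P) (Dom (Col P) v) (Dom (Col P) u)" "u \<in> Hom (Col P) (Dom (Col P) u) (Cod (Col P) u)"
    using v i assms(3) Eta_simps(3)[of v] by (auto simp: Hom_def)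
  have "act (Cmp (Col P) u v) = cmp (Cod (Col P) u) (act u) (FAr (Act C (Eta P u)) [act v])"
    using assms(1) hom unfolding is_A_object_def by blast
  then show ?thesis
    using assms(2)[of "Cmp (Col P) u v"] HomD[OF A.Cmp_Hom[OF hom]] Eta_Cmp[OF hom] i v Eta_simps(3)[OF assms(3)]
    by simp
qed

text \<open>On \<open>X\<close> this is compatibility of the action with substitution, on
  \<open>K\<close> and \<open>L\<close> functoriality of the action of \<open>A\<close>. It merges
  the structure maps when branches are composed.\<close>

lemma smap_Sub:
  assumes "smap e p h" "map c I = Src P p" "\<And>i. i \<in> set I \<Longrightarrow> smap e (q i) (k i) \<and> Tgt P (q i) = c i"
  shows "smap e (Sub P p (map q I)) (cmp (Tgt P p) h (FAr (Act C p) (map k I)))"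
  using assms(1)
proof cases
  case 1
  have k: "k i = XAct U (q i)" "q i \<in> Ops P" "Tgt P (q i) = c i" if "i \<in> set I" for i
    using assms(3)[OF that] 1 by (auto elim: structure_map.cases)
  have q: "substitutable P p (map q I)"
    by (rule Sub_map(1)[OF 1(3) assms(2)]) (use k in blast)
  have "map k I = map (XAct U) (map q I)" using k by simp
  then have "cmp (Tgt P p) h (FAr (Act C p) (map k I)) = XAct U (Sub P p (map q I))"
    using XAct_Sub[OF q] 1(2) by (simp only:)
  then show ?thesis using 1 Sub_simps(1)[OF q] by (simp add: structure_map.intros)
next
  case (2 u)
  have "\<exists>v. v \<in> Arr (Col P) \<and> q i = Eta P v \<and> k i = KAct U v \<and> Tgt P (q i) = c i" if "i \<in> set I" for i
    using assms(3)[OF that] 2(1) by (auto elim: structure_map.cases)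
  from smap_Sub_A[OF K_object structure_map.intros(2) 2(4) assms(2)[unfolded 2(2)] this] show ?thesis
    unfolding 2(1-3) by simp
next
  case (3 u)
  have "\<exists>v. v \<in> Arr (Col P) \<and> q i = Eta P v \<and> k i = LAct U v \<and> Tgt P (q i) = c i" if "i \<in> set I" for i
    using assms(3)[OF that] 3(1) by (auto elim: structure_map.cases)
  from smap_Sub_A[OF L_object structure_map.intros(3) 3(4) assms(2)[unfolded 3(2)] this] show ?thesis
    unfolding 3(1-3) by simp
qed

lemma smap_Unt:
  assumes "a \<in> Obj (Col P)"
  shows "smap e (Unt P a) (Idn (Cmpt C a) (edg e a))"
proof -
  have u: "Idn (Col P) a \<in> Arr (Col P)" using HomD(1)[OF A.Idn_Hom[OF assms]] .
  have "KAct U (Idn (Col P) a) = Idn (Cmpt C a) (KOb U a)" "LAct U (Idn (Col P) a) = Idn (Cmpt C a) (LOb U a)"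
    using K_object L_object assms by (auto simp: is_A_object_def)
  then show ?thesis
    using structure_map.intros(1)[OF Unt_simps(1)[OF assms], of U] structure_map.intros(2,3)[OF u, of U]
      XAct_Unt[OF assms] Eta_Idn[OF assms]
    by (cases e) auto
qed

text \<open>Every arrow of the classifier will turn out to be an operation applied to branches.\<close>

definition branch :: "'s branch \<Rightarrow> bool" where
  "branch t \<longleftrightarrow> decorated P (bop t, blabs t) \<and> (\<forall>l\<in>set (blabs t). admissible (l, blab t)) \<and>
     (\<exists>h. smap (blab t) (bop t) h \<and>
       barr t = cmp (Tgt P (bop t)) h (rel (bop t) (map (\<lambda>l. (l, blab t)) (blabs t))))"

definition family :: "'s \<Rightarrow> 's branch list \<Rightarrow> bool" where
  "family p ts \<longleftrightarrow> p \<in> Ops P \<and> (\<forall>t\<in>set ts. branch t) \<and> map (Tgt P \<circ> bop) ts = Src P p"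

abbreviation "source_op p ts \<equiv> Sub P p (map bop ts)"
abbreviation "source_labels ts \<equiv> concat (map blabs ts)"
abbreviation "assemble p ts \<equiv> FAr (Act C p) (map barr ts)"

lemma decorated_map: "decorated P (p, xs) \<Longrightarrow> decorated P (p, map f xs)"
  by (simp add: decorated_def)

lemma map_const_Src: "decorated P (p, xs) \<Longrightarrow> map (\<lambda>_. y) xs = map (\<lambda>_. y) (Src P p)"
  by (rule nth_equalityI) (simp_all add: decorated_def)

text \<open>An intermediate label \<open>T l\<close> splits each change in two, and the second half
  is absorbed into \<open>h\<close>. The identity as \<open>T\<close> recovers the arrow of the
  branch itself; other choices give the factorisations behind the spans.\<close>

lemma branch_factor:
  assumes "branch t" "\<And>l. l \<in> set (blabs t) \<Longrightarrow> admissible (l, T l) \<and> admissible (T l, blab t)"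
  shows "\<exists>h. h \<in> hom (Tgt P (bop t)) (obj (bop t) (map T (blabs t))) (edg (blab t) (Tgt P (bop t))) \<and>
    barr t = cmp (Tgt P (bop t)) h (rel (bop t) (map (\<lambda>l. (l, T l)) (blabs t)))"
proof -
  let ?q = "bop t" and ?I = "blabs t" and ?e = "blab t"
  let ?C = "Cmpt C (Tgt P ?q)"
  obtain h where dec: "decorated P (?q, ?I)" and h: "smap ?e ?q h"
    and t: "barr t = Cmp ?C h (rel ?q (map (\<lambda>l. (l, ?e)) ?I))"
    using assms(1) by (auto simp: branch_def)
  note q = smap_Hom[OF h]
  interpret Ca: category ?C by (rule Cmpt_category[OF Tgt_Obj[OF q(1)]])
  have h': "h \<in> Hom ?C (obj ?q (map (\<lambda>_. ?e) ?I)) (edg ?e (Tgt P ?q))"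
    using q(2) unfolding map_const_Src[OF dec] .
  have r1: "rel ?q (map (\<lambda>l. (l, T l)) ?I) \<in> Hom ?C (obj ?q ?I) (obj ?q (map T ?I))"
    using rel_Hom[OF decorated_map[OF dec], of "\<lambda>l. (l, T l)"] assms(2) by (auto simp: comp_def)
  have r2: "rel ?q (map (\<lambda>l. (T l, ?e)) ?I) \<in> Hom ?C (obj ?q (map T ?I)) (obj ?q (map (\<lambda>_. ?e) ?I))"
    using rel_Hom[OF decorated_map[OF dec], of "\<lambda>l. (T l, ?e)"] assms(2) by (auto simp: comp_def)
  have "Cmp ?C (rel ?q (map (\<lambda>l. (T l, ?e)) ?I)) (rel ?q (map (\<lambda>l. (l, T l)) ?I)) = rel ?q (map (\<lambda>l. (l, ?e)) ?I)"
    using dec assms(2) by (intro rel_Cmp) (auto simp: decorated_def)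
  then have "barr t = Cmp ?C (Cmp ?C h (rel ?q (map (\<lambda>l. (T l, ?e)) ?I))) (rel ?q (map (\<lambda>l. (l, T l)) ?I))"
    using t Ca.Cmp_assoc[OF r1 r2 h'] by simp
  with Ca.Cmp_Hom[OF r2 h'] show ?thesis by blast
qed

lemma branch_Hom:
  assumes "branch t"
  shows "barr t \<in> hom (Tgt P (bop t)) (obj (bop t) (blabs t)) (edg (blab t) (Tgt P (bop t)))"
proof -
  have dec: "decorated P (bop t, blabs t)" using assms by (simp add: branch_def)
  interpret Ca: category "Cmpt C (Tgt P (bop t))"
    by (rule Cmpt_category[OF Tgt_Obj]) (use dec in \<open>simp add: decorated_def\<close>)
  obtain h where h: "h \<in> hom (Tgt P (bop t)) (obj (bop t) (map (\<lambda>l. l) (blabs t))) (edg (blab t) (Tgt P (bop t)))"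
    "barr t = cmp (Tgt P (bop t)) h (rel (bop t) (map (\<lambda>l. (l, l)) (blabs t)))"
    using branch_factor[OF assms, of "\<lambda>l. l"] assms by (auto simp: branch_def admissible_def)
  then have "barr t = h" using rel_Idn[OF dec] Ca.Cmp_Idn_right[OF h(1)] by simp
  then show ?thesis using h(1) by simp
qed

text \<open>The trivial equation in the fourth conclusion gives it the shape of the premise of
  \<open>obj_Sub\<close>, with the target colour of the branch as \<open>c\<close>.\<close>

lemma familyD:
  assumes "family p ts"
  shows "p \<in> Ops P" "t \<in> set ts \<Longrightarrow> branch t" "map (\<lambda>t. Tgt P (bop t)) ts = Src P p"
    "t \<in> set ts \<Longrightarrow> decorated P (bop t, blabs t) \<and> Tgt P (bop t) = Tgt P (bop t)"
    "obj p (map blab ts) = FOb (Act C p) (map (\<lambda>t. edg (blab t) (Tgt P (bop t))) ts)"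
    "decorated P (p, map blab ts)"
proof -
  show "p \<in> Ops P" "t \<in> set ts \<Longrightarrow> branch t" and src: "map (\<lambda>t. Tgt P (bop t)) ts = Src P p"
    using assms by (simp_all add: family_def comp_def)
  then show "t \<in> set ts \<Longrightarrow> decorated P (bop t, blabs t) \<and> Tgt P (bop t) = Tgt P (bop t)"
    by (simp add: branch_def)
  show "obj p (map blab ts) = FOb (Act C p) (map (\<lambda>t. edg (blab t) (Tgt P (bop t))) ts)"
    unfolding ob_def src[symmetric] map2_map_map ..
  show "decorated P (p, map blab ts)" using assms by (auto simp: decorated_def family_def dest: arg_cong[where f = length])
qed

lemma decorated_source:
  assumes "family p ts"
  shows "decorated P (source_op p ts, source_labels ts)" "Tgt P (source_op p ts) = Tgt P p"
  using decorated_Sub[OF familyD(1,3)[OF assms]] Sub_map(4)[OF familyD(1,3)[OF assms]] familyD(4)[OF assms]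
  by (auto simp: decorated_def)

text \<open>The factorisations of the single branches are put together by functoriality of the
  action of \<open>p\<close>. The intermediate label may depend on the branch, which
  \<open>spanned_p\<close> exploits.\<close>

lemma assemble_factor:
  assumes "family p ts"
    "\<And>t l. t \<in> set ts \<Longrightarrow> l \<in> set (blabs t) \<Longrightarrow> admissible (l, T t l) \<and> admissible (T t l, blab t)"
  shows "\<exists>h. h \<in> hom (Tgt P p) (obj (source_op p ts) (concat (map (\<lambda>t. map (T t) (blabs t)) ts))) (obj p (map blab ts)) \<and>
    assemble p ts = cmp (Tgt P p) h (rel (source_op p ts) (concat (map (\<lambda>t. map (\<lambda>l. (l, T t l)) (blabs t)) ts)))"
proof -
  note D = familyD[OF assms(1)]
  let ?C = "\<lambda>t. Cmpt C (Tgt P (bop t))"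
  let ?r = "\<lambda>t. rel (bop t) (map (\<lambda>l. (l, T t l)) (blabs t))"
  have "\<forall>t\<in>set ts. \<exists>h. h \<in> Hom (?C t) (obj (bop t) (map (T t) (blabs t))) (edg (blab t) (Tgt P (bop t))) \<and>
      barr t = Cmp (?C t) h (?r t)"
    using branch_factor[OF D(2)] assms(2) by blast
  from bchoice[OF this] obtain h where
    h: "\<And>t. t \<in> set ts \<Longrightarrow> h t \<in> Hom (?C t) (obj (bop t) (map (T t) (blabs t))) (edg (blab t) (Tgt P (bop t)))"
    and eq: "\<And>t. t \<in> set ts \<Longrightarrow> barr t = Cmp (?C t) (h t) (?r t)" by blast
  have r: "?r t \<in> Hom (?C t) (obj (bop t) (blabs t)) (obj (bop t) (map (T t) (blabs t)))" if "t \<in> set ts" for t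
    using rel_Hom[OF decorated_map, of "bop t" "blabs t" "\<lambda>l. (l, T t l)"] D(4)[OF that] assms(2)[OF that]
    by (auto simp: comp_def)
  have dec: "decorated P (bop t, map f (blabs t)) \<and> Tgt P (bop t) = Tgt P (bop t)"
    if "t \<in> set ts" for t and f :: "edge \<Rightarrow> 'z"
    using decorated_map D(4)[OF that] by blast
  have "map barr ts = map (\<lambda>t. Cmp (?C t) (h t) (?r t)) ts" by (rule map_cong[OF refl eq])
  then have "assemble p ts = cmp (Tgt P p) (FAr (Act C p) (map h ts)) (FAr (Act C p) (map ?r ts))"
    using Act_Cmp[OF D(1,3) r h] by (simp only:)
  moreover have "FAr (Act C p) (map ?r ts) = rel (source_op p ts) (concat (map (\<lambda>t. map (\<lambda>l. (l, T t l)) (blabs t)) ts))"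
    by (rule rel_Sub[OF D(1,3) dec, symmetric]) (use assms(2) in auto)
  moreover have "FAr (Act C p) (map h ts) \<in> hom (Tgt P p)
      (FOb (Act C p) (map (\<lambda>t. obj (bop t) (map (T t) (blabs t))) ts)) (obj p (map blab ts))"
    unfolding D(5) by (rule Act_Hom[OF D(1,3) h])
  moreover have "FOb (Act C p) (map (\<lambda>t. obj (bop t) (map (T t) (blabs t))) ts) =
      obj (source_op p ts) (concat (map (\<lambda>t. map (T t) (blabs t)) ts))"
    by (rule obj_Sub[OF D(1,3) dec, symmetric])
  ultimately show ?thesis by auto
qed

lemma assemble_Hom:
  assumes "family p ts"
  shows "assemble p ts \<in> hom (Tgt P p) (obj (source_op p ts) (source_labels ts)) (obj p (map blab ts))"
proof -
  note D = familyD[OF assms]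
  have "assemble p ts \<in> hom (Tgt P p) (FOb (Act C p) (map (\<lambda>t. obj (bop t) (blabs t)) ts)) (obj p (map blab ts))"
    unfolding D(5) by (rule Act_Hom[OF D(1,3) branch_Hom[OF D(2)]])
  then show ?thesis using obj_Sub[OF D(1,3,4)] by simp
qed

lemma assemble_Sym:
  assumes "family p ts" "arity_perm P p \<sigma>"
  shows "family (Sym P p \<sigma>) (permute_list \<sigma> ts)" "assemble (Sym P p \<sigma>) (permute_list \<sigma> ts) = assemble p ts"
proof -
  note D = familyD[OF assms(1)]
  have "length ts = length (Src P p)" using D(3) by (metis length_map)
  then have perm: "\<sigma> permutes {..<length ts}" using assms(2) by (simp add: arity_perm_def)
  show "family (Sym P p \<sigma>) (permute_list \<sigma> ts)"
    using assms(1) Sym_simps[OF D(1) assms(2)] perm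
    by (simp add: family_def flip: permute_list_map)
  have "map barr ts \<in> Arr (inputs_cat P C p)"
    using inputs_Hom[OF D(3) branch_Hom[OF D(2)]] by (simp add: Hom_def)
  from Act_Sym_Arr[OF D(1) assms(2) this]
  show "assemble (Sym P p \<sigma>) (permute_list \<sigma> ts) = assemble p ts"
    using perm by (simp add: permute_list_map)
qed

text \<open>The composite of \<open>t\<close> with the branches \<open>ss\<close> placed on its
  inputs, recorded with the grafted source so that it can again be a branch.\<close>

definition prepend :: "'s branch \<Rightarrow> 's branch list \<Rightarrow> 's branch" where
  "prepend t ss = \<lparr>blab = blab t, bop = source_op (bop t) ss, blabs = source_labels ss,
     barr = cmp (Tgt P (bop t)) (barr t) (assemble (bop t) ss)\<rparr>"

text \<open>Read from the last arrow to the first, the composite consists of the structure map of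
  \<open>t\<close>, changes to the label of \<open>t\<close>, the structure maps of
  \<open>ss\<close>, and changes to their labels. \<open>smap_nat\<close> moves the middle changes
  before the structure maps of \<open>ss\<close>; then \<open>rel_Cmp\<close> merges the two rounds
  of changes and \<open>smap_Sub\<close> merges the structure maps.\<close>

lemma branch_prepend:
  assumes "branch t" "family (bop t) ss" "map blab ss = blabs t"
  shows "branch (prepend t ss)"
proof -
  note D = familyD[OF assms(2)]
  let ?q = "bop t" and ?e = "blab t"
  let ?C = "\<lambda>s. Cmpt C (Tgt P (bop s))"
  obtain h where dec: "decorated P (?q, blabs t)" and h: "smap ?e ?q h"
    and t: "barr t = Cmp (?C t) h (rel ?q (map (\<lambda>l. (l, ?e)) (blabs t)))"
    and adm: "\<And>s. s \<in> set ss \<Longrightarrow> admissible (blab s, ?e)"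
    using assms(1) assms(3)[symmetric] by (auto simp: branch_def)
  interpret Ca: category "?C t" by (rule Cmpt_category[OF Tgt_Obj[OF D(1)]])
  have col: "Tgt P (bop s) \<in> Obj (Col P)" if "s \<in> set ss" for s
    using D(4)[OF that] Tgt_Obj by (simp add: decorated_def)
  let ?g = "\<lambda>s. chg (blab s, ?e) (Tgt P (bop s))"
  let ?r = "\<lambda>s. rel (bop s) (map (\<lambda>l. (l, ?e)) (blabs s))"
  have g: "?g s \<in> Hom (?C s) (edg (blab s) (Tgt P (bop s))) (edg ?e (Tgt P (bop s)))" if "s \<in> set ss" for s
    using chg_Hom[OF col[OF that] adm[OF that]] by simp
  have "rel ?q (map (\<lambda>l. (l, ?e)) (blabs t)) = FAr (Act C ?q) (map ?g ss)"
    unfolding relabel_def assms(3)[symmetric] D(3)[symmetric] map_map map2_map_map by (simp add: comp_def)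
  moreover have adm': "admissible (l, ?e)" if "s \<in> set ss" "l \<in> set (blabs s)" for s l
    using chg_comp(2)[OF col[OF that(1)] _ adm[OF that(1)], of l] D(2)[OF that(1)] that(2) by (simp add: branch_def)
  \<comment> \<open>Naturality for one branch: the change of its target label moves to its inputs,
    and its structure map is replaced by one with the label of \<open>t\<close>.\<close>
  have "\<forall>s\<in>set ss. \<exists>k. smap ?e (bop s) k \<and> Cmp (?C s) (?g s) (barr s) = Cmp (?C s) k (?r s)"
  proof
    fix s assume s: "s \<in> set ss"
    let ?b = "rel (bop s) (map (\<lambda>l. (l, blab s)) (blabs s))"
    let ?n = "rel (bop s) (map (\<lambda>_. (blab s, ?e)) (blabs s))"
    interpret Cs: category "?C s" by (rule Cmpt_category[OF col[OF s]])
    obtain k where k: "smap (blab s) (bop s) k" and b: "barr s = Cmp (?C s) k ?b"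
      and as: "\<And>l. l \<in> set (blabs s) \<Longrightarrow> admissible (l, blab s)"
      using D(2)[OF s] by (auto simp: branch_def)
    have ds: "decorated P (bop s, blabs s)" using D(4)[OF s] by simp
    obtain k' where k': "smap ?e (bop s) k'"
      "Cmp (?C s) (?g s) k = Cmp (?C s) k' ?n"
      using smap_nat[OF k adm[OF s]] map_const_Src[OF ds] by metis
    note kH = smap_Hom(2)[OF k, folded map_const_Src[OF ds]] and k'H = smap_Hom(2)[OF k'(1), folded map_const_Src[OF ds]]
    have r1: "?b \<in> Hom (?C s) (obj (bop s) (blabs s)) (obj (bop s) (map (\<lambda>_. blab s) (blabs s)))"
      using rel_Hom[OF decorated_map[OF ds], of "\<lambda>l. (l, blab s)"] as by (auto simp: comp_def)
    have r2: "?n \<in> Hom (?C s) (obj (bop s) (map (\<lambda>_. blab s) (blabs s))) (obj (bop s) (map (\<lambda>_. ?e) (blabs s)))"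
      using rel_Hom[OF decorated_map[OF ds], of "\<lambda>_. (blab s, ?e)"] adm[OF s] by (auto simp: comp_def)
    have "Cmp (?C s) (?g s) (barr s) = Cmp (?C s) (Cmp (?C s) (?g s) k) ?b"
      unfolding b by (rule Cs.Cmp_assoc[OF r1 kH g[OF s]])
    also have "\<dots> = Cmp (?C s) k' (Cmp (?C s) ?n ?b)"
      unfolding k'(2) by (rule Cs.Cmp_assoc[OF r1 r2 k'H, symmetric])
    also have "Cmp (?C s) ?n ?b = ?r s"
      using ds as adm[OF s] by (intro rel_Cmp) (auto simp: decorated_def)
    finally show "\<exists>k. smap ?e (bop s) k \<and> Cmp (?C s) (?g s) (barr s) = Cmp (?C s) k (?r s)"
      using k'(1) by blast
  qed
  from bchoice[OF this] obtain k where k: "\<And>s. s \<in> set ss \<Longrightarrow> smap ?e (bop s) (k s)"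
    and ke: "\<And>s. s \<in> set ss \<Longrightarrow> Cmp (?C s) (?g s) (barr s) = Cmp (?C s) (k s) (?r s)" by blast
  have r: "?r s \<in> Hom (?C s) (obj (bop s) (blabs s)) (obj (bop s) (map (\<lambda>_. ?e) (Src P (bop s))))" if "s \<in> set ss" for s
  proof -
    have ds: "decorated P (bop s, blabs s)" using D(4)[OF that] by simp
    show ?thesis
      unfolding map_const_Src[OF ds, symmetric]
      using rel_Hom[OF decorated_map[OF ds], of "\<lambda>l. (l, ?e)"] adm'[OF that] by (auto simp: comp_def)
  qed
  note kH = smap_Hom(2)[OF k]
  note hH = smap_Hom(2)[OF h]
  have Ak: "FAr (Act C ?q) (map k ss) \<in> Hom (?C t) (FOb (Act C ?q) (map (\<lambda>s. obj (bop s) (map (\<lambda>_. ?e) (Src P (bop s)))) ss))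
      (FOb (Act C ?q) (map (\<lambda>s. edg ?e (Tgt P (bop s))) ss))"
    by (rule Act_Hom[OF D(1,3) kH])
  have Ag: "FAr (Act C ?q) (map ?g ss) \<in> Hom (?C t) (FOb (Act C ?q) (map (\<lambda>s. edg (blab s) (Tgt P (bop s))) ss))
      (FOb (Act C ?q) (map (\<lambda>s. edg ?e (Tgt P (bop s))) ss))"
    by (rule Act_Hom[OF D(1,3) g])
  have Ab: "assemble ?q ss \<in> Hom (?C t) (FOb (Act C ?q) (map (\<lambda>s. obj (bop s) (blabs s)) ss))
      (FOb (Act C ?q) (map (\<lambda>s. edg (blab s) (Tgt P (bop s))) ss))"
    by (rule Act_Hom[OF D(1,3) branch_Hom[OF D(2)]])
  have Ar: "FAr (Act C ?q) (map ?r ss) \<in> Hom (?C t) (FOb (Act C ?q) (map (\<lambda>s. obj (bop s) (blabs s)) ss))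
      (FOb (Act C ?q) (map (\<lambda>s. obj (bop s) (map (\<lambda>_. ?e) (Src P (bop s)))) ss))"
    by (rule Act_Hom[OF D(1,3) r])
  have hH': "h \<in> Hom (?C t) (FOb (Act C ?q) (map (\<lambda>s. edg ?e (Tgt P (bop s))) ss)) (edg ?e (Tgt P ?q))"
    using hH[unfolded obj_const] unfolding D(3)[symmetric] by (simp add: comp_def)
  \<comment> \<open>The exchange found for each branch is now carried out under the action of the
    operation of \<open>t\<close>, which is functorial.\<close>
  ultimately have "Cmp (?C t) (barr t) (assemble ?q ss) = Cmp (?C t) h (Cmp (?C t) (FAr (Act C ?q) (map ?g ss)) (assemble ?q ss))"
    using t Ca.Cmp_assoc[OF Ab Ag hH'] by simp
  also have "Cmp (?C t) (FAr (Act C ?q) (map ?g ss)) (assemble ?q ss) =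
      FAr (Act C ?q) (map (\<lambda>s. Cmp (?C s) (?g s) (barr s)) ss)"
    by (rule Act_Cmp[OF D(1,3) branch_Hom[OF D(2)] g, symmetric])
  also have "map (\<lambda>s. Cmp (?C s) (?g s) (barr s)) ss = map (\<lambda>s. Cmp (?C s) (k s) (?r s)) ss"
    by (rule map_cong[OF refl ke])
  also have "FAr (Act C ?q) \<dots> = Cmp (?C t) (FAr (Act C ?q) (map k ss)) (FAr (Act C ?q) (map ?r ss))"
    by (rule Act_Cmp[OF D(1,3) r kH])
  also have "Cmp (?C t) h \<dots> = Cmp (?C t) (Cmp (?C t) h (FAr (Act C ?q) (map k ss))) (FAr (Act C ?q) (map ?r ss))"
    by (rule Ca.Cmp_assoc[OF Ar Ak hH'])
  also have "FAr (Act C ?q) (map ?r ss) = rel (source_op ?q ss) (concat (map (\<lambda>s. map (\<lambda>l. (l, ?e)) (blabs s)) ss))"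
    by (rule rel_Sub[OF D(1,3), symmetric]) (use D(4) adm' in \<open>auto intro!: decorated_map\<close>)
  also have "concat (map (\<lambda>s. map (\<lambda>l. (l, ?e)) (blabs s)) ss) = map (\<lambda>l. (l, ?e)) (source_labels ss)"
    by (simp add: map_concat comp_def)
  finally have eq: "Cmp (?C t) (barr t) (assemble ?q ss) = Cmp (?C t) (Cmp (?C t) h (FAr (Act C ?q) (map k ss)))
      (rel (source_op ?q ss) (map (\<lambda>l. (l, ?e)) (source_labels ss)))" .
  have "smap ?e (source_op ?q ss) (Cmp (?C t) h (FAr (Act C ?q) (map k ss)))"
    by (rule smap_Sub[OF h D(3)]) (use k in auto)
  then show ?thesis
    unfolding branch_def prepend_def using decorated_source[OF assms(2)] adm' eq by auto
qed

end

section \<open>Normal form of the arrows of the classifier\<close>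

context universal_alg
begin

text \<open>Together with \<open>branch_structure_map\<close> this puts all the structure arrows of
  \<open>U\<close>, and the identities of edges, among the branches.\<close>

lemma branch_unit:
  assumes "a \<in> Obj (Col P)" "admissible (l, e)"
  shows "branch \<lparr>blab = e, bop = Unt P a, blabs = [l], barr = chg (l, e) a\<rparr>"
proof -
  have h: "chg (l, e) a \<in> hom a (edg l a) (edg e a)" using chg_Hom[OF assms] by simp
  have "rel (Unt P a) [(l, e)] = chg (l, e) a"
    using Act_Unt_Arr[OF assms(1) HomD(1)[OF h]] Unt_simps[OF assms(1)] by (simp add: relabel_def del: change.simps)
  then show ?thesis
    unfolding branch_def
    using category.Cmp_Idn_left[OF Cmpt_category[OF assms(1)] h] smap_Unt[OF assms(1), of e] Unt_simps[OF assms(1)] assms(2)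
    by (auto simp: decorated_def simp del: change.simps intro!: exI[of _ "Idn (Cmpt C a) (edg e a)"])
qed

lemma branch_structure_map:
  assumes "smap e p h"
  shows "branch \<lparr>blab = e, bop = p, blabs = map (\<lambda>_. e) (Src P p), barr = h\<rparr>"
proof -
  note p = smap_Hom[OF assms]
  have "rel p (map (\<lambda>_. (e, e)) (Src P p)) = Idn (Cmpt C (Tgt P p)) (obj p (map (\<lambda>_. e) (Src P p)))"
    using rel_Idn[of p "map (\<lambda>_. e) (Src P p)"] p(1) by (simp add: decorated_def comp_def)
  with category.Cmp_Idn_right[OF Cmpt_category[OF Tgt_Obj[OF p(1)]] p(2)] show ?thesis
    unfolding branch_def using p(1) assms
    by (auto simp: decorated_def admissible_def comp_def intro!: exI[of _ h])
qed

lemma assemble_single: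
  assumes "branch t"
  shows "family (Unt P (Tgt P (bop t))) [t]" "assemble (Unt P (Tgt P (bop t))) [t] = barr t"
proof -
  have a: "Tgt P (bop t) \<in> Obj (Col P)" using assms Tgt_Obj by (auto simp: branch_def decorated_def)
  show "family (Unt P (Tgt P (bop t))) [t]" using assms Unt_simps[OF a] by (simp add: family_def)
  show "assemble (Unt P (Tgt P (bop t))) [t] = barr t"
    using Act_Unt_Arr[OF a HomD(1)[OF branch_Hom[OF assms]]] by simp
qed

lemma assemble_Idn:
  assumes "decorated P (p, es)"
  shows "\<exists>ts. family p ts \<and> assemble p ts = Idn (Cmpt C (Tgt P p)) (obj p es)"
proof -
  note p = decoratedD[OF assms]
  let ?J = "zip es (Src P p)"
  let ?b = "\<lambda>j. \<lparr>blab = fst j, bop = Unt P (snd j), blabs = [fst j], barr = chg (fst j, fst j) (snd j)\<rparr>"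
  have col: "snd j \<in> Obj (Col P)" if "j \<in> set ?J" for j
    using in_set_zip_fst_snd(2)[OF that] Src_nth_Obj[OF p(1)] by blast
  have "map (Tgt P \<circ> bop) (map ?b ?J) = map snd ?J"
    unfolding map_map by (rule map_cong[OF refl]) (simp add: Unt_simps col)
  moreover have "branch t" if t: "t \<in> set (map ?b ?J)" for t
  proof -
    obtain j where "j \<in> set ?J" "t = ?b j" using t unfolding set_map by blast
    then show ?thesis using branch_unit[OF col, of j "fst j" "fst j"] by (simp add: admissible_def)
  qed
  ultimately have "family p (map ?b ?J)"
    unfolding family_def using p(1,3) by (metis (no_types, lifting))
  moreover have "FAr (Act C p) (map (\<lambda>j. Idn (Cmpt C (snd j)) (edg (fst j) (snd j))) ?J) =
      Idn (Cmpt C (Tgt P p)) (FOb (Act C p) (map (\<lambda>j. edg (fst j) (snd j)) ?J))"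
    by (rule Act_Idn[OF p(1,3)]) (rule edg_Obj[OF col])
  then have "assemble p (map ?b ?J) = Idn (Cmpt C (Tgt P p)) (obj p es)"
    by (simp add: ob_def case_prod_unfold comp_def)
  ultimately show ?thesis by blast
qed

lemma assemble_Sub:
  assumes "p \<in> Ops P" "map c I = Src P p" "\<And>i. i \<in> set I \<Longrightarrow> family (q i) (ts i) \<and> Tgt P (q i) = c i"
  shows "family (Sub P p (map q I)) (concat (map ts I))"
    "assemble (Sub P p (map q I)) (concat (map ts I)) = FAr (Act C p) (map (\<lambda>i. assemble (q i) (ts i)) I)"
proof -
  have q: "q i \<in> Ops P \<and> Tgt P (q i) = c i" if "i \<in> set I" for i
    using assms(3)[OF that] by (simp add: family_def)
  note S = Sub_map(2,3)[OF assms(1,2) q]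
  have "map (Tgt P \<circ> bop) (concat (map ts I)) = concat (map (\<lambda>i. Src P (q i)) I)"
    unfolding map_concat map_map by (rule arg_cong[where f = concat]) (use assms(3) in \<open>simp add: family_def\<close>)
  moreover have "\<forall>t\<in>set (concat (map ts I)). branch t"
    using assms(3) by (auto simp: family_def)
  ultimately show "family (Sub P p (map q I)) (concat (map ts I))"
    unfolding family_def using S by simp
  have "map barr (ts i) \<in> Arr (inputs_cat P C (q i))" if "i \<in> set I" for i
    using inputs_Hom[OF familyD(3) branch_Hom[OF familyD(2)]] assms(3)[OF that] by (auto simp: Hom_def)
  from Act_Sub_map_Arr[OF assms(1,2) q this]
  show "assemble (Sub P p (map q I)) (concat (map ts I)) = FAr (Act C p) (map (\<lambda>i. assemble (q i) (ts i)) I)"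
    by (simp add: map_concat comp_def)
qed

text \<open>Cut \<open>ss\<close> into the groups feeding the individual branches of
  \<open>ts\<close> and compose each group with its branch by \<open>prepend\<close>; functoriality
  of the action of \<open>p\<close> identifies the result with the composite.\<close>

lemma assemble_Cmp:
  assumes "family p ts" "family (source_op p ts) ss" "map blab ss = source_labels ts"
  shows "\<exists>rs. family p rs \<and> assemble p rs = cmp (Tgt P p) (assemble p ts) (assemble (source_op p ts) ss)"
proof -
  note D = familyD[OF assms(1)]
  have opq: "bop t \<in> Ops P \<and> Tgt P (bop t) = Tgt P (bop t)" if "t \<in> set ts" for t
    using D(4)[OF that] by (simp add: decorated_def)
  \<comment> \<open>Labels and colours are paired so that a single cut matches both at once.\<close>
  have "map (\<lambda>s. (blab s, Tgt P (bop s))) ss = zip (map blab ss) (map (Tgt P \<circ> bop) ss)"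
    by (rule nth_equalityI) simp_all
  also have "map (Tgt P \<circ> bop) ss = concat (map (\<lambda>t. Src P (bop t)) ts)"
    using assms(2) Sub_map(3)[OF D(1,3) opq] by (simp add: family_def)
  also have "zip (map blab ss) (concat (map (\<lambda>t. Src P (bop t)) ts)) = concat (map (\<lambda>t. zip (blabs t) (Src P (bop t))) ts)"
    unfolding assms(3) by (rule zip_concat) (use D(4) in \<open>simp add: decorated_def\<close>)
  finally obtain G where G: "map fst G = ts" "ss = concat (map snd G)"
    "\<forall>(t, zs)\<in>set G. map (\<lambda>s. (blab s, Tgt P (bop s))) zs = zip (blabs t) (Src P (bop t))"
    using map_concat_split by blast
  have tG: "fst g \<in> set ts" "set (snd g) \<subseteq> set ss" if "g \<in> set G" for g
    using that unfolding G(2) G(1)[symmetric] by auto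
  have lab: "map blab (snd g) = blabs (fst g)"
    and col: "map (Tgt P \<circ> bop) (snd g) = Src P (bop (fst g))" if g: "g \<in> set G" for g
  proof -
    have *: "map (\<lambda>s. (blab s, Tgt P (bop s))) (snd g) = zip (blabs (fst g)) (Src P (bop (fst g)))"
      using G(3) g by (auto simp: case_prod_unfold)
    have len: "length (blabs (fst g)) = length (Src P (bop (fst g)))"
      using D(4)[OF tG(1)[OF g]] by (simp add: decorated_def)
    show "map blab (snd g) = blabs (fst g)" "map (Tgt P \<circ> bop) (snd g) = Src P (bop (fst g))"
      using arg_cong[OF *, of "map fst"] arg_cong[OF *, of "map snd"] len by (simp_all add: comp_def)
  qed
  have fam: "family (bop (fst g)) (snd g)" if "g \<in> set G" for g
    using opq[OF tG(1)[OF that]] tG(2)[OF that] col[OF that] assms(2) by (auto simp: family_def)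
  have br: "branch (prepend (fst g) (snd g))" if "g \<in> set G" for g
    by (rule branch_prepend[OF D(2)[OF tG(1)[OF that]] fam[OF that] lab[OF that]])
  let ?rs = "map (\<lambda>g. prepend (fst g) (snd g)) G"
  have tgt: "Tgt P (bop (prepend (fst g) (snd g))) = Tgt P (bop (fst g))" if "g \<in> set G" for g
    using decorated_source(2)[OF fam[OF that]] by (simp add: prepend_def)
  have "map (Tgt P \<circ> bop) ?rs = map (Tgt P \<circ> bop) ts"
    unfolding G(1)[symmetric] map_map using tgt by simp
  then have rs: "family p ?rs" using br assms(1) unfolding family_def by auto
  have src: "map (\<lambda>g. Tgt P (bop (fst g))) G = Src P p"
    using D(3) unfolding G(1)[symmetric] map_map by (simp add: comp_def)
  have "assemble p ?rs = FAr (Act C p) (map (\<lambda>g. cmp (Tgt P (bop (fst g))) (barr (fst g)) (assemble (bop (fst g)) (snd g))) G)"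
    by (simp add: prepend_def comp_def)
  also have "\<dots> = cmp (Tgt P p) (FAr (Act C p) (map (\<lambda>g. barr (fst g)) G)) (FAr (Act C p) (map (\<lambda>g. assemble (bop (fst g)) (snd g)) G))"
  proof (rule Act_Cmp[OF D(1) src])
    fix g assume g: "g \<in> set G"
    show "assemble (bop (fst g)) (snd g) \<in> hom (Tgt P (bop (fst g)))
        (obj (source_op (bop (fst g)) (snd g)) (source_labels (snd g))) (obj (bop (fst g)) (blabs (fst g)))"
      using assemble_Hom[OF fam[OF g]] lab[OF g] by simp
    show "barr (fst g) \<in> hom (Tgt P (bop (fst g))) (obj (bop (fst g)) (blabs (fst g))) (edg (blab (fst g)) (Tgt P (bop (fst g))))"
      by (rule branch_Hom[OF D(2)[OF tG(1)[OF g]]])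
  qed
  also have "map (\<lambda>g. barr (fst g)) G = map barr ts"
    unfolding G(1)[symmetric] by simp
  also have "FAr (Act C p) (map (\<lambda>g. assemble (bop (fst g)) (snd g)) G) = assemble (source_op p ts) ss"
    using assemble_Sub(2)[OF D(1) src, of "\<lambda>g. bop (fst g)" snd] fam unfolding G(1)[symmetric] G(2) by (simp add: comp_def)
  finally show ?thesis using rs by blast
qed

end

section \<open>The subalgebra of corollas and assembled arrows\<close>

locale classifying_alg = universal_alg P C U
  for P :: "'s substitude_data" and C :: "'s cat_alg" and U :: "'s internal_alg" +
  assumes inf: "infinite (UNIV :: 's set)" and cls: "classifier P C U"
begin

lemma obj_eqD:
  assumes "decorated P (p, es)" "decorated P (p', es')" "Tgt P p = Tgt P p'" "obj p es = obj p' es'"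
  shows "perm_equiv P (p, es) (p', es')"
  by (rule corolla_eq_perm_equiv[OF inf substitude_axioms cls assms(1,2)]) (simp add: corolla_ob assms(3,4))

text \<open>The target of one arrow and the source of the next present their common object only up
  to a reordering of inputs. This moves a family to the other presentation without changing its
  arrow.\<close>

lemma assemble_transport:
  assumes "family p ts" "perm_equiv P (p, map blab ts) (p', es')"
  shows "\<exists>ts'. family p' ts' \<and> map blab ts' = es' \<and> assemble p' ts' = assemble p ts"
proof -
  obtain \<sigma> where \<sigma>: "arity_perm P p \<sigma>" "p' = Sym P p \<sigma>" "es' = permute_list \<sigma> (map blab ts)"
    using assms(2) by (auto simp: perm_equiv_def)
  have "length ts = length (Src P p)" using familyD(3)[OF assms(1)] by (metis length_map)
  then have "map blab (permute_list \<sigma> ts) = es'"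
    using \<sigma> by (simp add: arity_perm_def permute_list_map)
  then show ?thesis using assemble_Sym[OF assms(1) \<sigma>(1)] \<sigma>(2) by blast
qed

definition corolla_objects :: "'s \<Rightarrow> 's set" where
  "corolla_objects a = {obj p es | p es. decorated P (p, es) \<and> Tgt P p = a}"

definition assembled_arrows :: "'s \<Rightarrow> 's set" where
  "assembled_arrows a = {assemble p ts | p ts. family p ts \<and> Tgt P p = a}"

lemma corolla_objectsI: "decorated P (p, es) \<Longrightarrow> Tgt P p = a \<Longrightarrow> x = obj p es \<Longrightarrow> x \<in> corolla_objects a"
  by (auto simp: corolla_objects_def)

lemma assembled_arrowsI: "family p ts \<Longrightarrow> Tgt P p = a \<Longrightarrow> f = assemble p ts \<Longrightarrow> f \<in> assembled_arrows a"
  by (auto simp: assembled_arrows_def)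

lemma subalgebra_assembled: "subalgebra P C corolla_objects assembled_arrows"
proof
  fix a assume a: "a \<in> Obj (Col P)"
  show "corolla_objects a \<subseteq> Obj (Cmpt C a)" using obj_Obj by (auto simp: corolla_objects_def)
  show "assembled_arrows a \<subseteq> Arr (Cmpt C a)" using assemble_Hom by (auto simp: assembled_arrows_def Hom_def)
  show "Dom (Cmpt C a) f \<in> corolla_objects a" "Cod (Cmpt C a) f \<in> corolla_objects a" if "f \<in> assembled_arrows a" for f
  proof -
    obtain p ts where f: "family p ts" "Tgt P p = a" "f = assemble p ts"
      using \<open>f \<in> assembled_arrows a\<close> by (auto simp: assembled_arrows_def)
    note hom = HomD(2,3)[OF assemble_Hom[OF f(1)]]
    show "Dom (Cmpt C a) f \<in> corolla_objects a"
      by (rule corolla_objectsI[OF decorated_source(1)[OF f(1)]])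
        (use f(2,3) hom decorated_source(2)[OF f(1)] in simp_all)
    show "Cod (Cmpt C a) f \<in> corolla_objects a"
      by (rule corolla_objectsI[OF familyD(6)[OF f(1)]]) (use f(2,3) hom in simp_all)
  qed
  show "Idn (Cmpt C a) x \<in> assembled_arrows a" if "x \<in> corolla_objects a" for x
  proof -
    obtain p es where p: "decorated P (p, es)" "Tgt P p = a" "x = obj p es"
      using \<open>x \<in> corolla_objects a\<close> by (auto simp: corolla_objects_def)
    obtain ts where ts: "family p ts" "assemble p ts = Idn (Cmpt C (Tgt P p)) (obj p es)"
      using assemble_Idn[OF p(1)] by blast
    show ?thesis
      by (rule assembled_arrowsI[OF ts(1) p(2)]) (simp only: ts(2) p(2,3))
  qed
  fix f g assume f: "f \<in> assembled_arrows a" and g: "g \<in> assembled_arrows a" and fg: "Cod (Cmpt C a) f = Dom (Cmpt C a) g"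
  obtain p ts where p: "family p ts" "Tgt P p = a" "g = assemble p ts" using g by (auto simp: assembled_arrows_def)
  obtain q ss where q: "family q ss" "Tgt P q = a" "f = assemble q ss" using f by (auto simp: assembled_arrows_def)
  have "obj q (map blab ss) = obj (source_op p ts) (source_labels ts)"
    using fg HomD(2)[OF assemble_Hom[OF p(1)]] HomD(3)[OF assemble_Hom[OF q(1)]] p q by simp
  then have "perm_equiv P (q, map blab ss) (source_op p ts, source_labels ts)"
    using familyD(6)[OF q(1)] decorated_source[OF p(1)] p(2) q(2) by (intro obj_eqD) auto
  from assemble_transport[OF q(1) this]
  obtain ss' where ss': "family (source_op p ts) ss'" "map blab ss' = source_labels ts" "assemble (source_op p ts) ss' = f"
    unfolding q(3) by blast
  obtain rs where rs: "family p rs" "assemble p rs = cmp (Tgt P p) (assemble p ts) (assemble (source_op p ts) ss')"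
    using assemble_Cmp[OF p(1) ss'(1,2)] by blast
  show "cmp a g f \<in> assembled_arrows a"
    by (rule assembled_arrowsI[OF rs(1) p(2)]) (simp only: rs(2) ss'(3) p(2,3))
next
  fix p xs assume p: "p \<in> Ops P" and "list_all2 (\<lambda>x a. x \<in> corolla_objects a) xs (Src P p)"
  then have "list_all2 (\<lambda>x a. \<exists>y. decorated P y \<and> Tgt P (fst y) = a \<and> x = obj (fst y) (snd y)) xs (Src P p)"
    by (auto elim!: list_all2_mono simp: corolla_objects_def)
  from list_all2_representatives[where Q = "decorated P" and t = "\<lambda>y. Tgt P (fst y)" and g = "\<lambda>y. obj (fst y) (snd y)", OF this]
  obtain ys where ys: "\<forall>y\<in>set ys. decorated P y" "map (\<lambda>y. Tgt P (fst y)) ys = Src P p" "xs = map (\<lambda>y. obj (fst y) (snd y)) ys"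
    by blast
  have d: "decorated P (fst y, snd y) \<and> Tgt P (fst y) = Tgt P (fst y)" if "y \<in> set ys" for y
    using ys(1) that by simp
  have q: "fst y \<in> Ops P \<and> Tgt P (fst y) = Tgt P (fst y)" if "y \<in> set ys" for y
    using ys(1) that by (simp add: decorated_def)
  show "FOb (Act C p) xs \<in> corolla_objects (Tgt P p)"
    unfolding ys(3)
    by (rule corolla_objectsI[OF decorated_Sub[OF p ys(2) d] Sub_map(4)[OF p ys(2) q] obj_Sub[OF p ys(2) d, symmetric]])
next
  fix p fs assume p: "p \<in> Ops P" and "list_all2 (\<lambda>f a. f \<in> assembled_arrows a) fs (Src P p)"
  then have "list_all2 (\<lambda>x a. \<exists>y. family (fst y) (snd y) \<and> Tgt P (fst y) = a \<and> x = assemble (fst y) (snd y)) fs (Src P p)"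
    by (auto elim!: list_all2_mono simp: assembled_arrows_def)
  from list_all2_representatives[where Q = "\<lambda>y. family (fst y) (snd y)" and t = "\<lambda>y. Tgt P (fst y)"
      and g = "\<lambda>y. assemble (fst y) (snd y)", OF this]
  obtain ys where ys: "\<forall>y\<in>set ys. family (fst y) (snd y)" "map (\<lambda>y. Tgt P (fst y)) ys = Src P p" "fs = map (\<lambda>y. assemble (fst y) (snd y)) ys"
    by blast
  have d: "family (fst y) (snd y) \<and> Tgt P (fst y) = Tgt P (fst y)" if "y \<in> set ys" for y
    using ys(1) that by simp
  have q: "fst y \<in> Ops P \<and> Tgt P (fst y) = Tgt P (fst y)" if "y \<in> set ys" for y
    using familyD(1) d[OF that] by blast
  show "FAr (Act C p) fs \<in> assembled_arrows (Tgt P p)"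
    unfolding ys(3)
    by (rule assembled_arrowsI[OF assemble_Sub(1)[OF p ys(2) d] Sub_map(4)[OF p ys(2) q] assemble_Sub(2)[OF p ys(2) d, symmetric]])
qed

text \<open>The subalgebra contains the edges of \<open>U\<close> as corollas on units and its
  structure arrows as single branches, so \<open>classifier_generated\<close> makes it the whole
  classifier.\<close>

theorem classifier_normal_form:
  assumes a: "a \<in> Obj (Col P)"
  shows "Obj (Cmpt C a) = corolla_objects a" "Arr (Cmpt C a) = assembled_arrows a"
proof -
  have br: "barr t \<in> assembled_arrows (Tgt P (bop t))" if "branch t" for t
    by (rule assembled_arrowsI[OF assemble_single(1)[OF that] _ assemble_single(2)[OF that, symmetric]])
      (use that in \<open>simp add: branch_def decorated_def Unt_simps Tgt_Obj\<close>)
  have sm: "h \<in> assembled_arrows (Tgt P p)" if "smap e p h" for e p h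
    using br[OF branch_structure_map[OF that]] by simp
  have ch: "chg (l, e) b \<in> assembled_arrows b" if "b \<in> Obj (Col P)" "admissible (l, e)" for l e b
    using br[OF branch_unit[OF that]] Unt_simps(3)[OF that(1)] by simp
  have edge: "edg e b \<in> corolla_objects b" if "b \<in> Obj (Col P)" for e b
    by (rule corolla_objectsI[OF decorated_generator[OF that] Unt_simps(3)[OF that] obj_Unt[OF that, symmetric]])
  have K: "KAct U u \<in> assembled_arrows (Cod (Col P) u)" "LAct U u \<in> assembled_arrows (Cod (Col P) u)" if "u \<in> Arr (Col P)" for u
    using sm[OF structure_map.intros(2)[OF that]] sm[OF structure_map.intros(3)[OF that]] Eta_simps(3)[OF that] by auto
  have F: "FMap U b \<in> assembled_arrows b" "GMap U b \<in> assembled_arrows b" if "b \<in> Obj (Col P)" for b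
    using ch[OF that, of K_edge L_edge] ch[OF that, of K_edge X_edge] by (auto simp: admissible_def)
  show "Obj (Cmpt C a) = corolla_objects a" "Arr (Cmpt C a) = assembled_arrows a"
    using classifier_generated[OF cls subalgebra_assembled edge sm[OF structure_map.intros(1)] K F a] by simp_all
qed

end

section \<open>The degree filtration\<close>

lemma Hom_total_cat:
  "f \<in> Hom (total_cat P C) x y \<longleftrightarrow>
    (\<exists>a h x' y'. a \<in> Obj (Col P) \<and> f = (a, h) \<and> x = (a, x') \<and> y = (a, y') \<and> h \<in> Hom (Cmpt C a) x' y')"
  by (auto simp: total_cat_def Hom_def)

lemma total_cat_simps:
  "x \<in> Obj (total_cat P C) \<longleftrightarrow> fst x \<in> Obj (Col P) \<and> snd x \<in> Obj (Cmpt C (fst x))"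
  "f \<in> Arr (total_cat P C) \<longleftrightarrow> fst f \<in> Obj (Col P) \<and> snd f \<in> Arr (Cmpt C (fst f))"
  "Dom (total_cat P C) (a, h) = (a, Dom (Cmpt C a) h)" "Cod (total_cat P C) (a, h) = (a, Cod (Cmpt C a) h)"
  "Idn (total_cat P C) (a, z) = (a, Idn (Cmpt C a) z)"
  "Cmp (total_cat P C) (b, g) (a, h) = (a, Cmp (Cmpt C a) g h)"
  by (cases x; cases f; auto simp: total_cat_def)+

lemma category_total_cat:
  assumes "categorical_algebra P C"
  shows "category (total_cat P C)"
proof -
  interpret categorical_algebra P C by fact
  show ?thesis
  proof (rule category.intro)
    fix f assume "f \<in> Arr (total_cat P C)"
    then obtain a h where f: "f = (a, h)" "a \<in> Obj (Col P)" "h \<in> Arr (Cmpt C a)"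
      by (cases f) (auto simp: total_cat_simps)
    then show "Dom (total_cat P C) f \<in> Obj (total_cat P C)" "Cod (total_cat P C) f \<in> Obj (total_cat P C)"
      using category.Dom_Obj[OF Cmpt_category] category.Cod_Obj[OF Cmpt_category]
      by (auto simp: total_cat_simps)
  next
    fix x assume "x \<in> Obj (total_cat P C)"
    then obtain a z where "x = (a, z)" "a \<in> Obj (Col P)" "z \<in> Obj (Cmpt C a)"
      by (cases x) (auto simp: total_cat_simps)
    then show "Idn (total_cat P C) x \<in> Hom (total_cat P C) x x"
      using category.Idn_Hom[OF Cmpt_category] by (auto simp: total_cat_simps Hom_total_cat)
  next
    fix f x y assume "f \<in> Hom (total_cat P C) x y"
    then obtain a h x' y' where a: "a \<in> Obj (Col P)" and f: "f = (a, h)" "x = (a, x')" "y = (a, y')"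
      "h \<in> Hom (Cmpt C a) x' y'" unfolding Hom_total_cat by blast
    interpret Ca: category "Cmpt C a" by (rule Cmpt_category[OF a])
    show "Cmp (total_cat P C) f (Idn (total_cat P C) x) = f" "Cmp (total_cat P C) (Idn (total_cat P C) y) f = f"
      using f Ca.Cmp_Idn_left Ca.Cmp_Idn_right by (simp_all add: total_cat_simps)
    fix g z assume "g \<in> Hom (total_cat P C) y z"
    then obtain k z' where g: "g = (a, k)" "z = (a, z')" "k \<in> Hom (Cmpt C a) y' z'"
      using f(3) unfolding Hom_total_cat by blast
    show "Cmp (total_cat P C) g f \<in> Hom (total_cat P C) x z"
      using a f g Ca.Cmp_Hom by (auto simp: total_cat_simps Hom_total_cat)
    fix l w assume "l \<in> Hom (total_cat P C) z w"
    then obtain m w' where l: "l = (a, m)" "w = (a, w')" "m \<in> Hom (Cmpt C a) z' w'"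
      using g(2) unfolding Hom_total_cat by blast
    show "Cmp (total_cat P C) l (Cmp (total_cat P C) g f) = Cmp (total_cat P C) (Cmp (total_cat P C) l g) f"
      using f g l Ca.Cmp_assoc[OF f(4) g(3) l(3)] by (simp add: total_cat_simps)
  qed
qed

section \<open>Types and degrees of corollas\<close>

definition degree :: "edge list \<Rightarrow> nat" where
  "degree es = length (filter (\<lambda>e. e \<noteq> X_edge) es)"

lemma degree_Cons: "degree (e # es) = (if e = X_edge then 0 else 1) + degree es"
  by (simp add: degree_def)

lemma degree_count: "degree es = count_list es K_edge + count_list es L_edge"
proof (induction es)
  case (Cons e es)
  then show ?case by (cases e) (simp_all add: degree_def)
qed (simp add: degree_def)

lemma degree_concat: "degree (concat ess) = sum_list (map degree ess)"
  by (induction ess) (simp_all add: degree_def)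

context universal_alg
begin

text \<open>Structure maps on \<open>K\<close> and \<open>L\<close> come from \<open>A\<close> and
  are unary, and admissibility allows only \<open>K\<close> and the target label in the
  source.\<close>

lemma branch_labels:
  assumes "branch t"
  shows "(blab t = X_edge \<and> L_edge \<notin> set (blabs t)) \<or> (blab t = K_edge \<and> blabs t = [K_edge]) \<or>
    (blab t = L_edge \<and> (blabs t = [K_edge] \<or> blabs t = [L_edge]))"
proof -
  obtain h where h: "smap (blab t) (bop t) h" using assms by (auto simp: branch_def)
  have len: "length (blabs t) = length (Src P (bop t))" and adm: "\<And>l. l \<in> set (blabs t) \<Longrightarrow> l = K_edge \<or> l = blab t"
    using assms by (auto simp: branch_def decorated_def admissible_def)
  have single: "\<exists>l. blabs t = [l]" if "u \<in> Arr (Col P)" "bop t = Eta P u" for u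
    using len Eta_simps(2)[OF that(1)] that(2) by (auto simp: length_Suc_conv)
  from h show ?thesis
  proof cases
    case 1
    then show ?thesis using adm[of L_edge] by auto
  next
    case (2 u)
    obtain l where "blabs t = [l]" using single 2 by blast
    then show ?thesis using adm[of l] 2 by simp
  next
    case (3 u)
    obtain l where "blabs t = [l]" using single 3 by blast
    then show ?thesis using adm[of l] 3 by auto
  qed
qed

text \<open>Branches with label \<open>K\<close> or \<open>L\<close> preserve the degree, while a
  branch with label \<open>X\<close> loses its \<open>K\<close>-edges. The four claims go through
  one induction, since the last needs the degree inequality for the remaining branches.\<close>

lemma source_counts:
  assumes "\<forall>t\<in>set ts. branch t"
  shows "count_list (map blab ts) K_edge \<le> count_list (source_labels ts) K_edge" (is ?K)
    and "count_list (source_labels ts) L_edge \<le> count_list (map blab ts) L_edge" (is ?L)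
    and "degree (map blab ts) \<le> degree (source_labels ts)" (is ?D)
    and "degree (map blab ts) = degree (source_labels ts) \<Longrightarrow> t \<in> set ts \<Longrightarrow> blab t = X_edge \<Longrightarrow> K_edge \<notin> set (blabs t)"
    (is "?E \<Longrightarrow> _ \<Longrightarrow> _ \<Longrightarrow> _")
proof -
  have "?K \<and> ?L \<and> ?D \<and> (?E \<longrightarrow> (\<forall>t\<in>set ts. blab t = X_edge \<longrightarrow> K_edge \<notin> set (blabs t)))"
    using assms
  proof (induction ts)
    case (Cons t ts)
    have deg: "degree (blabs t @ source_labels ts) = degree (blabs t) + degree (source_labels ts)" by (simp add: degree_def)
    have X: "degree (blabs t) = 0 \<Longrightarrow> K_edge \<notin> set (blabs t)"
      by (auto simp: degree_def filter_empty_conv)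
    have IH: "count_list (map blab ts) K_edge \<le> count_list (source_labels ts) K_edge"
      "count_list (source_labels ts) L_edge \<le> count_list (map blab ts) L_edge"
      "degree (map blab ts) \<le> degree (source_labels ts)"
      "degree (map blab ts) = degree (source_labels ts) \<Longrightarrow> \<forall>t\<in>set ts. blab t = X_edge \<longrightarrow> K_edge \<notin> set (blabs t)"
      using Cons by auto
    have "branch t" using Cons.prems by simp
    from branch_labels[OF this] consider "blab t = X_edge" "L_edge \<notin> set (blabs t)"
      | "blab t = K_edge" "blabs t = [K_edge]" | "blab t = L_edge" "blabs t = [K_edge]" | "blab t = L_edge" "blabs t = [L_edge]"
      by blast
    then show ?case
    proof cases
      case 1
      then have "count_list (blabs t) L_edge = 0" by (simp add: count_list_0_iff)
      with 1 IH X show ?thesis by (simp add: deg degree_Cons)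
    qed (use IH in \<open>simp_all add: degree_Cons\<close>)
  qed (simp add: degree_def)
  then show ?K ?L ?D "?E \<Longrightarrow> t \<in> set ts \<Longrightarrow> blab t = X_edge \<Longrightarrow> K_edge \<notin> set (blabs t)"
    by blast+
qed

text \<open>The new label depends only on the old one, so this relabelling belongs to the class and
  not to its presentation.\<close>

lemma rel_perm_equiv:
  assumes "decorated P (p, es)" "perm_equiv P (p, es) (p', es')" "\<And>e. e \<in> set es \<Longrightarrow> admissible (e, f e)"
  shows "rel p (map (\<lambda>e. (e, f e)) es) = rel p' (map (\<lambda>e. (e, f e)) es')"
proof -
  obtain \<sigma> where \<sigma>: "arity_perm P p \<sigma>" "p' = Sym P p \<sigma>" "es' = permute_list \<sigma> es"
    using assms(2) by (auto simp: perm_equiv_def)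
  have "\<sigma> permutes {..<length es}" using \<sigma>(1) assms(1) by (simp add: arity_perm_def decorated_def)
  moreover have "rel (Sym P p \<sigma>) (permute_list \<sigma> (map (\<lambda>e. (e, f e)) es)) = rel p (map (\<lambda>e. (e, f e)) es)"
    by (rule rel_Sym[OF decorated_map[OF assms(1)] \<sigma>(1)]) (use assms(3) in auto)
  ultimately show ?thesis
    using \<sigma>(2,3) by (simp add: permute_list_map)
qed

end

context classifying_alg
begin

abbreviation "T \<equiv> total_cat P C"
abbreviation "typ \<equiv> has_type P C U"
abbreviation "cor \<equiv> corolla P C U"

lemma typ_iff: "typ x m n \<longleftrightarrow> (\<exists>p es. decorated P (p, es) \<and> x = cor p es \<and>
    count_list es K_edge = m \<and> count_list es L_edge = n)"
  by (auto simp: has_type_def decorated_def)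

lemma cor_eqD:
  assumes "decorated P (p, es)" "decorated P (p', es')" "cor p es = cor p' es'"
  shows "perm_equiv P (p, es) (p', es')"
  using obj_eqD[OF assms(1,2)] assms(3) by (simp add: corolla_ob)

text \<open>Equal corollas differ by a reordering of inputs, which keeps the multiset of
  labels.\<close>

lemma typ_unique:
  assumes "typ x m n" "typ x m' n'"
  shows "m = m'" "n = n'"
proof -
  obtain p es where p: "decorated P (p, es)" "x = cor p es" "count_list es K_edge = m" "count_list es L_edge = n"
    using assms(1) unfolding typ_iff by blast
  obtain q fs where q: "decorated P (q, fs)" "x = cor q fs" "count_list fs K_edge = m'" "count_list fs L_edge = n'"
    using assms(2) unfolding typ_iff by blast
  have "mset fs = mset es" using perm_equiv_decorated(3)[OF p(1) cor_eqD[OF p(1) q(1)]] p(2) q(2) by simp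
  then have "count_list fs e = count_list es e" for e by (metis count_mset)
  then show "m = m'" "n = n'" using p q by auto
qed

lemma typ_cor: "decorated P (p, es) \<Longrightarrow> typ (cor p es) (count_list es K_edge) (count_list es L_edge)"
  unfolding typ_iff by blast

lemma Obj_typ:
  assumes "x \<in> Obj T"
  shows "\<exists>m n. typ x m n"
proof -
  obtain a z where x: "x = (a, z)" "a \<in> Obj (Col P)" "z \<in> Obj (Cmpt C a)"
    using assms by (cases x) (auto simp: total_cat_simps)
  then obtain p es where "decorated P (p, es)" "Tgt P p = a" "z = obj p es"
    using classifier_normal_form(1)[OF x(2)] by (auto simp: corolla_objects_def)
  then show ?thesis using x typ_cor[of p es] by (auto simp: corolla_ob)
qed

text \<open>The normal form comes with some presentation of the target; it is moved to the
  prescribed one by a reordering.\<close>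

lemma arrow_form:
  assumes "f \<in> Hom T x (cor p es)" "decorated P (p, es)"
  obtains ts where "family p ts" "map blab ts = es" "f = (Tgt P p, assemble p ts)"
    "x = cor (source_op p ts) (source_labels ts)"
proof -
  obtain h x' where a: "Tgt P p \<in> Obj (Col P)" and f: "f = (Tgt P p, h)" "x = (Tgt P p, x')"
    "h \<in> hom (Tgt P p) x' (obj p es)"
    using assms(1) unfolding Hom_total_cat corolla_ob by blast
  then obtain q ts where q: "family q ts" "Tgt P q = Tgt P p" "h = assemble q ts"
    using classifier_normal_form(2)[OF a] HomD(1)[OF f(3)] by (auto simp: assembled_arrows_def)
  have "obj q (map blab ts) = obj p es"
    using HomD(3)[OF assemble_Hom[OF q(1)]] HomD(3)[OF f(3)] q by simp
  then have "perm_equiv P (q, map blab ts) (p, es)"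
    using obj_eqD[OF familyD(6)[OF q(1)] assms(2)] q(2) by simp
  then obtain ts' where ts': "family p ts'" "map blab ts' = es" "assemble p ts' = assemble q ts"
    using assemble_transport[OF q(1)] by blast
  have "x' = obj (source_op p ts') (source_labels ts')"
    using HomD(2)[OF assemble_Hom[OF ts'(1)]] HomD(2)[OF f(3)] q ts' by simp
  then have "x = cor (source_op p ts') (source_labels ts')"
    using f(2) decorated_source(2)[OF ts'(1)] by (simp add: corolla_ob)
  with ts' f(1) q(3) show ?thesis by (intro that) auto
qed

lemma arrow_types:
  assumes "f \<in> Hom T x y" "typ x m n" "typ y m' n'"
  shows "m' \<le> m" "n \<le> n'" "m' + n' \<le> m + n"
proof -
  obtain p es where p: "decorated P (p, es)" "y = cor p es" "count_list es K_edge = m'" "count_list es L_edge = n'"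
    using assms(3) unfolding typ_iff by blast
  obtain ts where ts: "family p ts" "map blab ts = es" "x = cor (source_op p ts) (source_labels ts)"
    using arrow_form[of f x p es] assms(1) p(1,2) by metis
  have "count_list (source_labels ts) K_edge = m" "count_list (source_labels ts) L_edge = n"
    using typ_unique[OF typ_cor[OF decorated_source(1)[OF ts(1)]]] assms(2) ts(3) by auto
  with source_counts[of ts] ts(1,2) p(3,4) show "m' \<le> m" "n \<le> n'" "m' + n' \<le> m + n"
    by (auto simp: family_def degree_count)
qed

lemma rel_Hom_T:
  assumes "decorated P (p, ws)" "\<And>w. w \<in> set ws \<Longrightarrow> admissible w"
  shows "(Tgt P p, rel p ws) \<in> Hom T (cor p (map fst ws)) (cor p (map snd ws))"
  using rel_Hom[OF assms] Tgt_Obj decoratedD(1)[OF assms(1)] by (auto simp: Hom_total_cat corolla_ob)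

section \<open>Spans connecting the arrows into lower degree and into objects without
  \<open>K\<close>-edges\<close>

fun K_to :: "edge \<Rightarrow> edge \<Rightarrow> edge" where
  "K_to e K_edge = e" | "K_to e X_edge = X_edge" | "K_to e L_edge = L_edge"

lemma admissible_K_to: "admissible (l, K_to e l)"
  by (cases l) (auto simp: admissible_def)

lemma K_to_arrow:
  assumes "decorated P (r, ls)"
  shows "(Tgt P r, rel r (map (\<lambda>l. (l, K_to e l)) ls)) \<in> Hom T (cor r ls) (cor r (map (K_to e) ls))"
  using rel_Hom_T[OF decorated_map[OF assms], of "\<lambda>l. (l, K_to e l)"] admissible_K_to by (auto simp: comp_def)

lemma rel_factor_T:
  assumes "family p ts"
    "\<And>t l. t \<in> set ts \<Longrightarrow> l \<in> set (blabs t) \<Longrightarrow> admissible (l, S t l) \<and> admissible (S t l, blab t)"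
    and ws: "ws = concat (map (\<lambda>t. map (\<lambda>l. (l, S t l)) (blabs t)) ts)"
  obtains h where "h \<in> Hom T (cor (source_op p ts) (map snd ws)) (cor p (map blab ts))"
    "(Tgt P p, assemble p ts) = Cmp T h (Tgt P p, rel (source_op p ts) ws)"
    "decorated P (source_op p ts, ws)" "\<forall>w\<in>set ws. admissible w" "map fst ws = source_labels ts"
proof -
  have snd: "map snd ws = concat (map (\<lambda>t. map (S t) (blabs t)) ts)" and fst: "map fst ws = source_labels ts"
    unfolding ws by (simp_all add: map_concat comp_def)
  obtain h where "h \<in> hom (Tgt P p) (obj (source_op p ts) (map snd ws)) (obj p (map blab ts))"
    "assemble p ts = cmp (Tgt P p) h (rel (source_op p ts) ws)"
    using assemble_factor[where T = S, OF assms(1,2), folded snd ws] by blast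
  moreover have "length ws = length (source_labels ts)" using fst by (metis length_map)
  then have "decorated P (source_op p ts, ws)"
    using decorated_source(1)[OF assms(1)] by (simp add: decorated_def)
  moreover have "admissible w" if "w \<in> set ws" for w
    using that assms(2) unfolding ws by auto
  ultimately show ?thesis
    using that[of "(Tgt P p, h)"] fst Tgt_Obj[OF familyD(1)[OF assms(1)]] decorated_source(2)[OF assms(1)]
    by (auto simp: Hom_total_cat corolla_ob total_cat_simps)
qed

text \<open>Every arrow into an object of type \<open>(0, k)\<close> factors through the fixed arrow
  \<open>?g\<close> itself, so the vertex of the span can be \<open>?y\<close>, with an identity as
  one leg.\<close>

lemma spanned_l:
  assumes x: "typ x m n" "m + n = k"
  shows "spanned_under T {y. typ y 0 k} x"
proof -
  obtain r ls where r: "decorated P (r, ls)" "x = cor r ls" "count_list ls K_edge = m" "count_list ls L_edge = n"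
    using x(1) unfolding typ_iff by blast
  let ?w = "map (\<lambda>l. (l, K_to L_edge l))"
  let ?y = "cor r (map (K_to L_edge) ls)" and ?g = "(Tgt P r, rel r (?w ls))"
  have g: "?g \<in> Hom T x ?y" using K_to_arrow[OF r(1)] r(2) by simp
  have counts: "count_list (map (K_to L_edge) es) K_edge = 0 \<and>
      count_list (map (K_to L_edge) es) L_edge = count_list es K_edge + count_list es L_edge" for es
  proof (induction es)
    case (Cons e es) then show ?case by (cases e) auto
  qed simp
  have y: "typ ?y 0 k"
    using typ_cor[OF decorated_map[OF r(1)], of "K_to L_edge"] counts[of ls] r(3,4) x(2) by simp
  show ?thesis
    unfolding spanned_under_def
  proof (intro exI conjI ballI)
    show "?y \<in> {y. typ y 0 k}" "?g \<in> Hom T x ?y" using y g by auto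
    fix z f assume "z \<in> {y. typ y 0 k}" and f: "f \<in> Hom T x z"
    then obtain p es where p: "decorated P (p, es)" "z = cor p es" "count_list es K_edge = 0" "count_list es L_edge = k"
      unfolding typ_iff by blast
    obtain ts where ts: "family p ts" "map blab ts = es" "f = (Tgt P p, assemble p ts)" "x = cor (source_op p ts) (source_labels ts)"
      using arrow_form[of f x p es] f p(1,2) by metis
    have brs: "\<forall>t\<in>set ts. branch t" using ts(1) by (simp add: family_def)
    note ds = decorated_source[OF ts(1)]
    note pe = cor_eqD[OF ds(1) r(1) trans[OF ts(4)[symmetric] r(2)]]
    have "degree (source_labels ts) = k" "degree es = k"
      using typ_unique[OF typ_cor[OF ds(1)]] x ts(4) p(3,4) by (auto simp: degree_count)
    then have noK: "K_edge \<notin> set (blabs t)" if "t \<in> set ts" "blab t = X_edge" for t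
      using source_counts(4)[OF brs _ that] ts(2) by simp
    have notK: "blab t \<noteq> K_edge" if "t \<in> set ts" for t
    proof -
      have "K_edge \<notin> blab ` set ts" using p(3) ts(2) by (auto simp: count_list_0_iff)
      then show ?thesis using that by (metis imageI)
    qed
    \<comment> \<open>Every \<open>K\<close>-edge of the source sits in a branch with target label
      \<open>L\<close>: in an \<open>X\<close> branch it would lower the degree, and a
      \<open>K\<close> branch would leave a \<open>K\<close>-edge in the target.\<close>
    have adm: "admissible (l, K_to L_edge l) \<and> admissible (K_to L_edge l, blab t)"
      if "t \<in> set ts" "l \<in> set (blabs t)" for t l
      using branch_labels[of t] brs noK[OF that(1)] notK[OF that(1)] that
      by (cases l) (auto simp: admissible_def)
    have "?w (source_labels ts) = concat (map (\<lambda>t. ?w (blabs t)) ts)" by (simp add: map_concat comp_def)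
    from rel_factor_T[where S = "\<lambda>_. K_to L_edge", OF ts(1) adm this]
    obtain h where h: "h \<in> Hom T (cor (source_op p ts) (map snd (?w (source_labels ts)))) (cor p (map blab ts))"
      "f = Cmp T h (Tgt P p, rel (source_op p ts) (?w (source_labels ts)))"
      unfolding ts(3)[symmetric] by blast
    \<comment> \<open>The presentation of \<open>x\<close> found with \<open>f\<close> and the one
      fixed at the start differ by a reordering, which does not affect this relabelling.\<close>
    have rel_eq: "rel (source_op p ts) (?w (source_labels ts)) = rel r (?w ls)"
      by (rule rel_perm_equiv[OF ds(1) pe]) (rule admissible_K_to)
    have tgt: "Tgt P p = Tgt P r"
      using ts(4) r(2) ds(2) by (simp add: corolla_ob)
    have "(Tgt P p, rel (source_op p ts) (?w (source_labels ts))) \<in> Hom T x (cor (source_op p ts) (map (K_to L_edge) (source_labels ts)))"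
      using K_to_arrow[OF ds(1)] ts(4) ds(2) by simp
    with g have cod: "cor (source_op p ts) (map (K_to L_edge) (source_labels ts)) = ?y"
      unfolding rel_eq tgt using HomD(3) by metis
    interpret T: category T by (rule category_total_cat) unfold_locales
    have "h \<in> Hom T ?y z" "f = Cmp T h ?g"
      using h cod p(2) ts(2) unfolding rel_eq tgt by (simp_all add: comp_def)
    moreover have "Idn T ?y \<in> Hom T ?y ?y" "?g = Cmp T (Idn T ?y) ?g"
      using T.Idn_Hom[OF T.Hom_Obj(2)[OF g]] T.Cmp_Idn_left[OF g] by auto
    ultimately show "\<exists>w\<in>{y. typ y 0 k}. \<exists>\<gamma>\<in>Hom T x w. \<exists>h\<in>Hom T w z. \<exists>h'\<in>Hom T w ?y. f = Cmp T h \<gamma> \<and> ?g = Cmp T h' \<gamma>"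
      using y g by blast
  qed
qed

text \<open>For given \<open>f\<close>, the vertex of the span is obtained from \<open>x\<close> by
  turning into \<open>X\<close> only those \<open>K\<close>-edges that \<open>f\<close> sends into
  \<open>X\<close> branches. It has the degree of the target of \<open>f\<close>, and turning its
  remaining \<open>K\<close>-edges into \<open>X\<close> gives \<open>?y\<close>.\<close>

lemma spanned_p:
  assumes x: "typ x m n" "m + n = Suc k" "m \<noteq> 0"
  shows "spanned_under T {y. \<exists>m n. typ y m n \<and> m + n \<le> k} x"
proof -
  let ?S = "{y. \<exists>m n. typ y m n \<and> m + n \<le> k}"
  obtain r ls where r: "decorated P (r, ls)" "x = cor r ls" "count_list ls K_edge = m" "count_list ls L_edge = n"
    using x(1) unfolding typ_iff by blast
  let ?w = "map (\<lambda>l. (l, K_to X_edge l))"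
  let ?y = "cor r (map (K_to X_edge) ls)" and ?g = "(Tgt P r, rel r (?w ls))"
  have g: "?g \<in> Hom T x ?y" using K_to_arrow[OF r(1)] r(2) by simp
  have counts: "count_list (map (K_to X_edge) es) K_edge = 0 \<and>
      count_list (map (K_to X_edge) es) L_edge = count_list es L_edge" for es
  proof (induction es)
    case (Cons e es) then show ?case by (cases e) auto
  qed simp
  have "typ ?y 0 n"
    using typ_cor[OF decorated_map[OF r(1)], of "K_to X_edge"] counts[of ls] r(3,4) by simp
  \<comment> \<open>Since \<open>m \<noteq> 0\<close>, turning the \<open>K\<close>-edges into
    \<open>X\<close> strictly lowers the degree, so \<open>n \<le> k\<close>.\<close>
  then have y: "?y \<in> ?S" using x(2,3) by (intro CollectI exI[of _ 0] exI[of _ n]) auto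
  show ?thesis
    unfolding spanned_under_def
  proof (intro exI conjI ballI)
    show "?y \<in> ?S" "?g \<in> Hom T x ?y" using y g by auto
    fix z f assume "z \<in> ?S" and f: "f \<in> Hom T x z"
    then obtain p es where p: "decorated P (p, es)" "z = cor p es" "degree es \<le> k"
      unfolding typ_iff by (auto simp: degree_count)
    obtain ts where ts: "family p ts" "map blab ts = es" "f = (Tgt P p, assemble p ts)" "x = cor (source_op p ts) (source_labels ts)"
      using arrow_form[of f x p es] f p(1,2) by metis
    have brs: "\<forall>t\<in>set ts. branch t" using ts(1) by (simp add: family_def)
    note ds = decorated_source[OF ts(1)]
    note pe = cor_eqD[OF ds(1) r(1) trans[OF ts(4)[symmetric] r(2)]]
    \<comment> \<open>Branches with label \<open>K\<close> or \<open>L\<close> have a single input,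
      which already has the right degree, so labels are changed only in \<open>X\<close>
      branches.\<close>
    define S where "S t l = (if blab t = X_edge then X_edge else l)" for t :: "'s branch" and l
    define ws where "ws = concat (map (\<lambda>t. map (\<lambda>l. (l, S t l)) (blabs t)) ts)"
    have adm: "admissible (l, S t l) \<and> admissible (S t l, blab t)" if "t \<in> set ts" "l \<in> set (blabs t)" for t l
      using branch_labels[of t] brs that by (cases l) (auto simp: admissible_def S_def)
    obtain h where h: "h \<in> Hom T (cor (source_op p ts) (map snd ws)) (cor p (map blab ts))"
      "(Tgt P p, assemble p ts) = Cmp T h (Tgt P p, rel (source_op p ts) ws)"
      and dws: "decorated P (source_op p ts, ws)" and adm_ws: "\<forall>w\<in>set ws. admissible w" and fst: "map fst ws = source_labels ts"
      by (rule rel_factor_T[where S = S, OF ts(1) adm ws_def]) blast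
    have aws: "admissible w" if "w \<in> set ws" for w using adm_ws that by blast
    let ?w' = "cor (source_op p ts) (map snd ws)" and ?\<gamma> = "(Tgt P p, rel (source_op p ts) ws)"
    \<comment> \<open>Each branch now contributes to the degree of the vertex exactly what its
      target edge contributes to the degree of \<open>z\<close>.\<close>
    have "degree (map (S t) (blabs t)) = degree [blab t]" if "t \<in> set ts" for t
      using branch_labels[of t] brs that by (auto simp: degree_def S_def)
    then have "map degree (map (\<lambda>t. map (S t) (blabs t)) ts) = map degree (map (\<lambda>t. [blab t]) ts)" by simp
    then have "degree (concat (map (\<lambda>t. map (S t) (blabs t)) ts)) = degree (concat (map (\<lambda>t. [blab t]) ts))"
      unfolding degree_concat by (rule arg_cong)
    moreover have snd: "map snd ws = concat (map (\<lambda>t. map (S t) (blabs t)) ts)"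
      unfolding ws_def by (simp add: map_concat comp_def)
    moreover have "concat (map (\<lambda>t. [blab t]) ts) = es" using ts(2) by (simp add: concat_map_singleton)
    ultimately have "degree (map snd ws) \<le> k" using p(3) by simp
    then have w': "?w' \<in> ?S"
      using typ_cor[OF decorated_map[OF dws, of snd]] by (auto simp: degree_count)
    have \<gamma>: "?\<gamma> \<in> Hom T x ?w'"
      using rel_Hom_T[OF dws aws] fst ts(4) ds(2) by simp
    let ?h' = "(Tgt P p, rel (source_op p ts) (map (\<lambda>w. (snd w, K_to X_edge (snd w))) ws))"
    have h': "?h' \<in> Hom T ?w' (cor (source_op p ts) (map (\<lambda>w. K_to X_edge (snd w)) ws))"
      using rel_Hom_T[OF decorated_map[OF dws], of "\<lambda>w. (snd w, K_to X_edge (snd w))"] admissible_K_to ds(2)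
      by (auto simp: comp_def)
    \<comment> \<open>The edges that \<open>S\<close> turns into \<open>X\<close> were
      \<open>K\<close> or \<open>X\<close> before, so the total effect is that of
      \<open>K_to X_edge\<close> on the original labels.\<close>
    have collapse: "K_to X_edge (snd w) = K_to X_edge (fst w)" if w: "w \<in> set ws" for w
    proof -
      obtain t l where t: "t \<in> set ts" "l \<in> set (blabs t)" "w = (l, S t l)"
        using w unfolding ws_def by auto
      then show ?thesis using branch_labels[of t] brs by (cases l) (auto simp: S_def)
    qed
    have "cmp (Tgt P (source_op p ts)) (rel (source_op p ts) (map (\<lambda>w. (snd w, K_to X_edge (snd w))) ws))
        (rel (source_op p ts) (map (\<lambda>w. (fst w, snd w)) ws)) = rel (source_op p ts) (map (\<lambda>w. (fst w, K_to X_edge (snd w))) ws)"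
      by (rule rel_Cmp) (use dws aws admissible_K_to in \<open>auto simp: decorated_def\<close>)
    also have "map (\<lambda>w. (fst w, K_to X_edge (snd w))) ws = ?w (source_labels ts)"
      unfolding fst[symmetric] map_map using collapse by simp
    also have "rel (source_op p ts) (?w (source_labels ts)) = rel r (?w ls)"
      by (rule rel_perm_equiv[OF ds(1) pe]) (rule admissible_K_to)
    finally have "cmp (Tgt P p) (rel (source_op p ts) (map (\<lambda>w. (snd w, K_to X_edge (snd w))) ws))
        (rel (source_op p ts) ws) = rel r (?w ls)" using ds(2) by simp
    moreover have tgt: "Tgt P p = Tgt P r"
      using ts(4) r(2) ds(2) by (simp add: corolla_ob)
    ultimately have eq: "?g = Cmp T ?h' ?\<gamma>"
      by (simp add: total_cat_simps)
    interpret T: category T by (rule category_total_cat) unfold_locales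
    have "cor (source_op p ts) (map (\<lambda>w. K_to X_edge (snd w)) ws) = ?y"
      using HomD(3)[OF T.Cmp_Hom[OF \<gamma> h']] HomD(3)[OF g] eq by simp
    with h' have "?h' \<in> Hom T ?w' ?y" by simp
    moreover have "h \<in> Hom T ?w' z" using h(1) p(2) ts(2) by simp
    ultimately show "\<exists>w\<in>?S. \<exists>\<gamma>\<in>Hom T x w. \<exists>h\<in>Hom T w z. \<exists>h'\<in>Hom T w ?y. f = Cmp T h \<gamma> \<and> ?g = Cmp T h' \<gamma>"
      using w' \<gamma> eq h(2) ts(3) by blast
  qed
qed

end

section \<open>Colimit of the filtration and its pushout squares\<close>

theorem proposition4p6:
  fixes P :: "'s substitude_data" and C :: "'s cat_alg" and U :: "'s internal_alg"
    and M :: "('o, 'm) cat" and X :: "('s \<times> 's, 's \<times> 's, 'o, 'm) func"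
  assumes "infinite (UNIV :: 's set)"
    and "substitude P" and "sigma_free P"
    and "classifier P C U"
    and "cocomplete TYPE('s) M"
    and "is_functor (total_cat P C) M X"
  shows "is_colimit M omega_cat (filtration P C U M X)
      (colim_obj M (total_cat P C) X)
      (\<lambda>k. colim_map M (p_sub P C U k) (total_cat P C) X) \<and>
    (\<forall>k\<ge>1. \<exists>w \<alpha>.
      w \<in> Hom M (colim_obj M (q_sub P C U k) X) (colim_obj M (l_sub P C U k) X) \<and>
      \<alpha> \<in> Hom M (colim_obj M (q_sub P C U k) X) (colim_obj M (p_sub P C U (k - 1)) X) \<and>
      (\<forall>x \<in> Obj (q_sub P C U k). \<forall>y \<in> Obj (l_sub P C U k). \<forall>f \<in> Hom (total_cat P C) x y.
        Cmp M w (colim_inj M (q_sub P C U k) X x) =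
        Cmp M (colim_inj M (l_sub P C U k) X y) (FAr X f)) \<and>
      (\<forall>x \<in> Obj (q_sub P C U k). \<forall>y \<in> Obj (p_sub P C U (k - 1)). \<forall>f \<in> Hom (total_cat P C) x y.
        Cmp M \<alpha> (colim_inj M (q_sub P C U k) X x) =
        Cmp M (colim_inj M (p_sub P C U (k - 1)) X y) (FAr X f)) \<and>
      is_pushout M w \<alpha>
        (colim_map M (l_sub P C U k) (p_sub P C U k) X)
        (colim_map M (p_sub P C U (k - 1)) (p_sub P C U k) X))"
proof -
  have alg: "categorical_algebra P C" "internal_algebra P C U"
    using assms(4) by (simp_all add: classifier_def)
  interpret classifying_alg P C U
    by (intro classifying_alg.intro universal_alg.intro classifying_alg_axioms.intro assms alg)
  \<comment> \<open>Codes for pairs make \<open>T\<close> and its full subcategories small relative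
    to the universe, so the colimits exist.\<close>
  obtain pr :: "'s \<times> 's \<Rightarrow> 's" where pr: "inj pr" using infinite_inj_pair[OF assms(1)] .
  have M: "category M" using assms(5) by (simp add: cocomplete_def)
  have T: "category T" by (rule category_total_cat[OF alg(1)])
  have col: "has_colimit M (full_sub T S) X" for S
    by (rule has_colimit_small[OF assms(5) category_full_sub[OF T] is_functor_full_sub[OF assms(6)] pr pr])
  have colT: "has_colimit M T X"
    by (rule has_colimit_small[OF assms(5) T assms(6) pr pr])
  define A where "A k = {x. \<exists>m n. typ x m n \<and> m + n \<le> k}" for k
  have p_sub: "p_sub P C U k = full_sub T (A k)" for k
    by (simp add: p_sub_def A_def)
  have "is_colimit M omega_cat
      \<lparr>FOb = (\<lambda>k. colim_obj M (full_sub T (A k)) X),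
       FAr = (\<lambda>(i, j). colim_map M (full_sub T (A i)) (full_sub T (A j)) X)\<rparr>
      (colim_obj M T X) (\<lambda>k. colim_map M (full_sub T (A k)) T X)"
  proof (rule sequential_colimit[OF M T assms(6) _ _ col colT])
    show "A i \<subseteq> A j" if "i \<le> j" for i j using that unfolding A_def by fastforce
    show "Obj T \<subseteq> (\<Union>k. A k)" using Obj_typ unfolding A_def by blast
  qed
  then have seq: "is_colimit M omega_cat (filtration P C U M X) (colim_obj M T X) (\<lambda>k. colim_map M (p_sub P C U k) T X)"
    by (simp add: filtration_def p_sub)
  show ?thesis
  proof (intro conjI allI impI seq, goal_cases)
    case k: (1 k)
    define Q where "Q = {x. \<exists>m n. typ x m n \<and> m + n = k \<and> m \<noteq> 0}"
    define L where "L = {x. typ x 0 k}"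
    have "{x. \<exists>m n. typ x m n \<and> m + n = k} \<inter> Q = Q" "{x. \<exists>m n. typ x m n \<and> m + n = k} \<inter> L = L"
      unfolding Q_def L_def by fastforce+
    then have ql: "q_sub P C U k = full_sub T Q" "l_sub P C U k = full_sub T L"
      unfolding q_sub_def l_sub_def w_sub_def full_sub_full_sub by (simp_all add: Q_def L_def)
    show ?case
      unfolding p_sub ql
    proof (rule pushout_of_full_subs[OF M T assms(6) _ _ _ _ _ _ _ _ col])
      have "x \<in> A k \<longleftrightarrow> x \<in> A (k - 1) \<union> Q \<union> L" for x
      proof
        assume "x \<in> A k"
        then obtain m n where x: "typ x m n" "m + n \<le> k" by (auto simp: A_def)
        consider "m + n \<le> k - 1" | "m + n = k" "m \<noteq> 0" | "m = 0" "n = k" using x(2) by linarith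
        then show "x \<in> A (k - 1) \<union> Q \<union> L" by cases (use x(1) in \<open>auto simp: A_def Q_def L_def\<close>)
      next
        assume "x \<in> A (k - 1) \<union> Q \<union> L"
        then obtain m n where "typ x m n" "m + n \<le> k" using k by (fastforce simp: A_def Q_def L_def)
        then show "x \<in> A k" by (auto simp: A_def)
      qed
      then show "Obj T \<inter> A k = Obj T \<inter> (A (k - 1) \<union> Q \<union> L)" by blast
      \<comment> \<open>Here \<open>k \<ge> 1\<close> enters: truncated subtraction would give
        \<open>k - 1 = k\<close> for \<open>k = 0\<close>, and the stages of degree at most
        \<open>k - 1\<close> and exactly \<open>k\<close> would overlap.\<close>
      have low: False if "x \<in> A (k - 1)" "typ x m n" "m + n = k" for x m n
      proof -
        obtain m' n' where "typ x m' n'" "m' + n' \<le> k - 1" using \<open>x \<in> A (k - 1)\<close> by (auto simp: A_def)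
        then show False using typ_unique[OF that(2)] that(3) k by force
      qed
      show "A (k - 1) \<inter> Q = {}" using low unfolding Q_def by blast
      show "A (k - 1) \<inter> L = {}" using low[of _ 0 k] unfolding L_def by auto
      show "Q \<inter> L = {}" using typ_unique(1) unfolding Q_def L_def by blast
      show "y \<in> A (k - 1)" if "x \<in> A (k - 1)" "y \<in> A k" "f \<in> Hom T x y" for x y f
      proof -
        obtain m n where x: "typ x m n" "m + n \<le> k - 1" using \<open>x \<in> A (k - 1)\<close> by (auto simp: A_def)
        obtain m' n' where y: "typ y m' n'" using \<open>y \<in> A k\<close> by (auto simp: A_def)
        show ?thesis unfolding A_def using y arrow_types(3)[OF that(3) x(1) y] x(2) by force
      qed
      show "y \<in> L" if "x \<in> L" "y \<in> A k" "f \<in> Hom T x y" for x y f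
      proof -
        have x: "typ x 0 k" using \<open>x \<in> L\<close> by (simp add: L_def)
        obtain m' n' where y: "typ y m' n'" using \<open>y \<in> A k\<close> by (auto simp: A_def)
        \<comment> \<open>Along an arrow the number of \<open>K\<close>-edges cannot grow, the
          number of \<open>L\<close>-edges cannot shrink, and the degree cannot rise above
          \<open>k\<close>.\<close>
        have "m' = 0" "n' = k" using arrow_types[OF that(3) x y] by auto
        then show ?thesis using y by (simp add: L_def)
      qed
      show "spanned_under T (A (k - 1)) x" if "x \<in> Q" for x
      proof -
        obtain m n where "typ x m n" "m + n = k" "m \<noteq> 0" using \<open>x \<in> Q\<close> by (auto simp: Q_def)
        then show ?thesis using spanned_p[of x m n "k - 1"] k by (simp add: A_def)
      qed
      show "spanned_under T L x" if "x \<in> Q" for x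
      proof -
        obtain m n where "typ x m n" "m + n = k" "m \<noteq> 0" using \<open>x \<in> Q\<close> by (auto simp: Q_def)
        then show ?thesis using spanned_l[of x m n k] by (simp add: L_def)
      qed
    qed
  qed
qed

end
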